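(* Let $R$ be a ring with unity, let $\mathcal{X}$ be a semibrick of left $R$-modules, and let $M,N\in\mathrm{Filt}(\mathcal{X})$ with $\mathcal{X}$-socle filtrations $(M_\lambda,\lambda\le\mu)$ and $(N_\omega,\omega\le\nu)$. Let $f\in\mathrm{Hom}_R(M,N)$ be a homomorphism. (a) If two submodules of $N$ lie in $\mathrm{Filt}(\mathcal{X})$, then both their sum and their intersection also belong to $\mathrm{Filt}(\mathcal{X})$. (b) The filtration $(\mathrm{Im}\,f\cap N_\lambda,\ \lambda\le\mu)$ is the $\mathcal{X}$-socle filtration of $\mathrm{Im}\,f$. (c) The cokernel of $f$ lies in $\mathrm{Filt}(\mathcal{X})$.
   Context: A brick is a finitely presented left $R$-module whose endomorphism ring is a division ring. A semibrick is a class $\mathcal{X}$ of pairwise non-isomorphic bricks with $\mathrm{Hom}(X,X')=0$ for distinct $X,X'\in\mathcal{X}$. A filtration of a module $M$ is an ascending chain $(M_\lambda,\lambda\le\mu)$ of submodules ($\mu$ an ordinal) with $M_0=0$, $M_\mu=M$ and $M_\nu=\bigcup_{\lambda<\nu}M_\lambda$ for limit ordinals $\nu\le\mu$. It is an $\mathcal{X}$-filtration if each $M_{\lambda+1}/M_\lambda$ ($\lambda<\mu$) is isomorphic to a module in $\mathcal{X}$. $\mathrm{Filt}(\mathcal{X})$ is the class of modules admitting an $\mathcal{X}$-filtration. For a module $N$ put $\mathrm{soc}_{\mathcal{X}}N=\sum_{X\in\mathcal{X},\,f\in\mathrm{Hom}(X,N)}\mathrm{Im}\,f$. The $\mathcal{X}$-socle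 filtration $(V_\lambda,\lambda\le\mu)$ of $M\in\mathrm{Filt}(\mathcal{X})$ is defined inductively by $V_0=0$, $V_{\lambda+1}$ the preimage of $\mathrm{soc}_{\mathcal{X}}(M/V_\lambda)$ under $M\to M/V_\lambda$, and $V_\lambda=\bigcup_{\alpha<\lambda}V_\alpha$ for limit ordinals $\lambda$, up to an ordinal $\mu$ with $V_\mu=M$. Convention: socle filtrations are continued by constant terms, i.e. $V_\lambda=M$ for all $\lambda$ beyond the length (so $N_\lambda=N$ for $\lambda>\nu$), and filtrations that agree up to such constant terms are identified. *)

theory Defs
  imports "HOL-Algebra.Module" "HOL-Algebra.AbelCoset"
begin

text \<open>
  The locale \<open>module\<close> of HOL-Algebra requires a commutative ring of scalars. Left modules over an
  arbitrary unital ring are built here on the same record type; its fields \<open>mult\<close> and \<open>one\<close>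
  carry no meaning and are left unspecified in the constructions below.
\<close>

locale left_module = R?: ring R + M?: abelian_group M
  for R :: "('a, 'b) ring_scheme" (structure) and M :: "('a, 'c, 'd) module_scheme" (structure) +
  assumes smult_closed [simp, intro]:
      "\<lbrakk>a \<in> carrier R; x \<in> carrier M\<rbrakk> \<Longrightarrow> a \<odot>\<^bsub>M\<^esub> x \<in> carrier M"
    and smult_l_distr:
      "\<lbrakk>a \<in> carrier R; b \<in> carrier R; x \<in> carrier M\<rbrakk> \<Longrightarrow>
      (a \<oplus> b) \<odot>\<^bsub>M\<^esub> x = a \<odot>\<^bsub>M\<^esub> x \<oplus>\<^bsub>M\<^esub> b \<odot>\<^bsub>M\<^esub> x"
    and smult_r_distr:
      "\<lbrakk>a \<in> carrier R; x \<in> carrier M; y \<in> carrier M\<rbrakk> \<Longrightarrow>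
      a \<odot>\<^bsub>M\<^esub> (x \<oplus>\<^bsub>M\<^esub> y) = a \<odot>\<^bsub>M\<^esub> x \<oplus>\<^bsub>M\<^esub> a \<odot>\<^bsub>M\<^esub> y"
    and smult_assoc1:
      "\<lbrakk>a \<in> carrier R; b \<in> carrier R; x \<in> carrier M\<rbrakk> \<Longrightarrow>
      (a \<otimes> b) \<odot>\<^bsub>M\<^esub> x = a \<odot>\<^bsub>M\<^esub> (b \<odot>\<^bsub>M\<^esub> x)"
    and smult_one [simp]:
      "x \<in> carrier M \<Longrightarrow> \<one> \<odot>\<^bsub>M\<^esub> x = x"

definition lmod_hom ::
  "('r, 's) ring_scheme \<Rightarrow> ('r, 'm) module \<Rightarrow> ('r, 'n) module \<Rightarrow> ('m \<Rightarrow> 'n) set" where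
  "lmod_hom R M N = {h \<in> carrier M \<rightarrow> carrier N.
     (\<forall>x\<in>carrier M. \<forall>y\<in>carrier M. h (x \<oplus>\<^bsub>M\<^esub> y) = h x \<oplus>\<^bsub>N\<^esub> h y) \<and>
     (\<forall>a\<in>carrier R. \<forall>x\<in>carrier M. h (a \<odot>\<^bsub>M\<^esub> x) = a \<odot>\<^bsub>N\<^esub> h x)}"

definition lmod_iso ::
  "('r, 's) ring_scheme \<Rightarrow> ('r, 'm) module \<Rightarrow> ('r, 'n) module \<Rightarrow> bool" where
  "lmod_iso R M N \<longleftrightarrow> (\<exists>h\<in>lmod_hom R M N. bij_betw h (carrier M) (carrier N))"

definition lmod_quot :: "('r, 'm) module \<Rightarrow> 'm set \<Rightarrow> ('r, 'm set) module" where
  "lmod_quot M H =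
    \<lparr>carrier = a_rcosets\<^bsub>M\<^esub> H, mult = undefined, one = undefined,
     zero = H, add = set_add M,
     smult = (\<lambda>a A. \<Union>x\<in>A. H +>\<^bsub>M\<^esub> (a \<odot>\<^bsub>M\<^esub> x))\<rparr>"

definition lmod_span ::
  "('r, 's) ring_scheme \<Rightarrow> ('r, 'm) module \<Rightarrow> 'm set \<Rightarrow> 'm set" where
  "lmod_span R M S = \<Inter>{H. submodule H R M \<and> S \<subseteq> H}"

text \<open>\<open>free_lmod R n\<close> is the left module \<open>R\<^sup>n\<close>.\<close>

definition free_lmod :: "('r, 's) ring_scheme \<Rightarrow> nat \<Rightarrow> ('r, nat \<Rightarrow> 'r) module" where
  "free_lmod R n =
    \<lparr>carrier = {..<n} \<rightarrow>\<^sub>E carrier R, mult = undefined, one = undefined,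
     zero = (\<lambda>i\<in>{..<n}. \<zero>\<^bsub>R\<^esub>), add = (\<lambda>x y. \<lambda>i\<in>{..<n}. x i \<oplus>\<^bsub>R\<^esub> y i),
     smult = (\<lambda>a x. \<lambda>i\<in>{..<n}. a \<otimes>\<^bsub>R\<^esub> x i)\<rparr>"

definition finitely_presented :: "('r, 's) ring_scheme \<Rightarrow> ('r, 'm) module \<Rightarrow> bool" where
  "finitely_presented R M \<longleftrightarrow> left_module R M \<and>
     (\<exists>n. \<exists>p\<in>lmod_hom R (free_lmod R n) M. p ` carrier (free_lmod R n) = carrier M \<and>
        (\<exists>S. finite S \<and> S \<subseteq> carrier (free_lmod R n) \<and>
             a_kernel (free_lmod R n) M p = lmod_span R (free_lmod R n) S))"

text \<open>
  Homomorphisms only matter on the carrier, so the elements of the endomorphism ring are taken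
  to be \<open>undefined\<close> outside it.
\<close>

definition End_ring :: "('r, 's) ring_scheme \<Rightarrow> ('r, 'm) module \<Rightarrow> ('m \<Rightarrow> 'm) ring" where
  "End_ring R M =
    \<lparr>carrier = lmod_hom R M M \<inter> extensional (carrier M),
     mult = compose (carrier M), one = (\<lambda>x\<in>carrier M. x),
     zero = (\<lambda>x\<in>carrier M. \<zero>\<^bsub>M\<^esub>), add = (\<lambda>g h. \<lambda>x\<in>carrier M. g x \<oplus>\<^bsub>M\<^esub> h x)\<rparr>"

definition division_ring :: "('a, 'b) ring_scheme \<Rightarrow> bool" where
  "division_ring D \<longleftrightarrow> ring D \<and> \<one>\<^bsub>D\<^esub> \<noteq> \<zero>\<^bsub>D\<^esub> \<and> Units D = carrier D - {\<zero>\<^bsub>D\<^esub>}"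

definition brick :: "('r, 's) ring_scheme \<Rightarrow> ('r, 'm) module \<Rightarrow> bool" where
  "brick R X \<longleftrightarrow> finitely_presented R X \<and> division_ring (End_ring R X)"

definition semibrick :: "('r, 's) ring_scheme \<Rightarrow> ('r, 'm) module set \<Rightarrow> bool" where
  "semibrick R \<X> \<longleftrightarrow> (\<forall>X\<in>\<X>. brick R X) \<and>
     (\<forall>X\<in>\<X>. \<forall>Y\<in>\<X>. X \<noteq> Y \<longrightarrow> \<not> lmod_iso R X Y \<and>
        (\<forall>h\<in>lmod_hom R X Y. \<forall>x\<in>carrier X. h x = \<zero>\<^bsub>Y\<^esub>))"

text \<open>
  Ordinals are represented by the elements of a well-order \<open>r\<close>: its least element is \<open>0\<close>,
  \<open>wo_rel.suc r {i}\<close> is \<open>i + 1\<close>, and \<open>underS r i\<close>, \<open>under r i\<close> are the ordinals below, resp.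
  up to, \<open>i\<close>. A chain indexed by the ordinals up to \<open>\<mu>\<close> is a function of which only the values on
  \<open>under r \<mu>\<close> are relevant.
\<close>

definition limit_ord :: "'o rel \<Rightarrow> 'o \<Rightarrow> bool" where
  "limit_ord r i \<longleftrightarrow> i \<in> Field r \<and> underS r i \<noteq> {} \<and> (\<forall>j\<in>underS r i. i \<noteq> wo_rel.suc r {j})"

definition filtration ::
  "('r, 's) ring_scheme \<Rightarrow> ('r, 'm) module \<Rightarrow> 'o rel \<Rightarrow> 'o \<Rightarrow> ('o \<Rightarrow> 'm set) \<Rightarrow> bool" where
  "filtration R M r \<mu> F \<longleftrightarrow> Well_order r \<and> \<mu> \<in> Field r \<and>
     (\<forall>i\<in>under r \<mu>. submodule (F i) R M) \<and>
     (\<forall>j\<in>under r \<mu>. \<forall>i\<in>under r j. F i \<subseteq> F j) \<and>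
     F (wo_rel.minim r (Field r)) = {\<zero>\<^bsub>M\<^esub>} \<and>
     F \<mu> = carrier M \<and>
     (\<forall>i\<in>under r \<mu>. limit_ord r i \<longrightarrow> F i = (\<Union>j\<in>underS r i. F j))"

definition X_filtration ::
  "('r, 's) ring_scheme \<Rightarrow> ('r, 'x) module set \<Rightarrow> ('r, 'm) module \<Rightarrow> 'o rel \<Rightarrow> 'o
     \<Rightarrow> ('o \<Rightarrow> 'm set) \<Rightarrow> bool" where
  "X_filtration R \<X> M r \<mu> F \<longleftrightarrow> filtration R M r \<mu> F \<and>
     (\<forall>i\<in>underS r \<mu>. \<exists>X\<in>\<X>.
        lmod_iso R (lmod_quot (M\<lparr>carrier := F (wo_rel.suc r {i})\<rparr>) (F i)) X)"

text \<open>
  A filtration may be indexed by its own distinct terms, so well-orders on \<open>'m set\<close> provide all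
  the ordinals that are needed as lengths of \<open>\<X>\<close>-filtrations of modules on the type \<open>'m\<close>.
\<close>

definition Filt ::
  "('r, 's) ring_scheme \<Rightarrow> ('r, 'x) module set \<Rightarrow> ('r, 'm) module set" where
  "Filt R \<X> = {M. left_module R M \<and>
     (\<exists>(r :: 'm set rel) \<mu> F. X_filtration R \<X> M r \<mu> F)}"

definition X_socle ::
  "('r, 's) ring_scheme \<Rightarrow> ('r, 'x) module set \<Rightarrow> ('r, 'm) module \<Rightarrow> 'm set" where
  "X_socle R \<X> N = lmod_span R N (\<Union>X\<in>\<X>. \<Union>f\<in>lmod_hom R X N. f ` carrier X)"

text \<open>
  The length \<open>\<mu>\<close> need not be minimal: once the chain has reached \<open>M\<close> it stays constant.
\<close>

definition socle_filtration ::
  "('r, 's) ring_scheme \<Rightarrow> ('r, 'x) module set \<Rightarrow> ('r, 'm) module \<Rightarrow> 'o rel \<Rightarrow> 'o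
     \<Rightarrow> ('o \<Rightarrow> 'm set) \<Rightarrow> bool" where
  "socle_filtration R \<X> M r \<mu> V \<longleftrightarrow> filtration R M r \<mu> V \<and>
     (\<forall>i\<in>underS r \<mu>. V (wo_rel.suc r {i}) =
        {x \<in> carrier M. V i +>\<^bsub>M\<^esub> x \<in> X_socle R \<X> (lmod_quot M (V i))})"

text \<open>Continuation of a chain of length \<open>\<nu>\<close> by constant terms.\<close>

definition continued :: "'o rel \<Rightarrow> 'o \<Rightarrow> ('o \<Rightarrow> 'm set) \<Rightarrow> 'o \<Rightarrow> 'm set" where
  "continued r \<nu> V i = (if i \<in> under r \<nu> then V i else V \<nu>)"

end

theory Submission
  imports Defs
begin

text \<open>
  Fix \<open>N\<close> and call a submodule \<open>A\<close> cofiltered if \<open>N/A\<close> lies in \<open>Filt(\<X>)\<close>. If \<open>A\<close> is cofiltered and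
  \<open>X \<in> \<X>\<close>, a map \<open>u: X \<rightarrow> N/A\<close> is zero or injective, and then \<open>A + u(X)\<close> is again cofiltered: as \<open>X\<close>
  is finitely generated, the least term of a filtration of \<open>N/A\<close> containing \<open>u(X)\<close> is a successor
  term, \<open>u\<close> induces an isomorphism onto the corresponding factor, and this factor can be deleted.

  Call \<open>K\<close> admissible if \<open>A + K\<close> is cofiltered for every cofiltered \<open>A\<close>. For admissible \<open>K\<close> and a
  filtration \<open>(C\<^sub>i)\<close> of \<open>N/A\<close> the dichotomy, applied to \<open>C\<^sub>i + K\<close>, shows that each factor
  \<open>C\<^sub>i\<^sub>+\<^sub>1/C\<^sub>i\<close> either meets \<open>K\<close> trivially or is covered by it. Hence intersecting the filtration
  with \<open>K\<close>, or adding \<open>K\<close> to it, only deletes factors. This makes admissibility stable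
  under unions of chains, so by transfinite induction images of modules in \<open>Filt(\<X>)\<close> and all terms of
  the socle filtration are admissible, which gives (a) and (c). For (b), Zorn's lemma yields a maximal
  admissible \<open>T\<close> containing \<open>A\<close> with \<open>T \<inter> Im f \<subseteq> A\<close>; modulo \<open>T\<close> every map \<open>X \<rightarrow> N/A\<close> then lands in \<open>Im f\<close>.
\<close>

section \<open>Congruence and homomorphisms modulo a submodule\<close>

text \<open>A filtration does not combine well: from filtrations of \<open>N/K\<close> and
  \<open>N/L\<close>, or of all \<open>N/K\<close> for a chain of submodules \<open>K\<close>, none
  of \<open>N/(K + L)\<close> or of the quotient by the union can be read off. This is why
  admissibility quantifies over every cofiltered \<open>A\<close>. Each term of a filtration of
  \<open>N/A\<close> is again cofiltered, so the assumption can be used at all of its factors, and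
  the resulting condition on single factors passes to unions, which the mere existence of a
  filtration does not.

  If \<open>N\<close> lies in Filt(\<X>), the admissible submodules turn out to be exactly the
  submodules in Filt(\<X>), by \<open>Filt_submodule_admissible\<close> and
  \<open>admissible_imp_Filt\<close>. Orthogonality of distinct bricks, invertibility of non-zero
  endomorphisms and finite generation enter only through \<open>hom_mod_dichotomy\<close>.

  The elements of a quotient module are sets, so iterated quotients would live on ever higher types.
  All work therefore takes place inside \<open>N\<close>, with congruences in place of cosets;
  \<open>lmod_quot\<close> appears only when the result is translated back.\<close>

definition cong_mod :: "('r, 'm) module \<Rightarrow> 'm set \<Rightarrow> 'm \<Rightarrow> 'm \<Rightarrow> bool" where
  "cong_mod N A x y \<longleftrightarrow> x \<in> carrier N \<and> y \<in> carrier N \<and> (\<exists>a\<in>A. x = a \<oplus>\<^bsub>N\<^esub> y)"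

text \<open>
  Homomorphisms \<open>X \<rightarrow> N/A\<close> are represented by their lifts to functions into \<open>N\<close>, so that the same
  function can be read modulo a larger submodule.
\<close>

definition hom_mod ::
  "('r, 's) ring_scheme \<Rightarrow> ('r, 'x) module \<Rightarrow> ('r, 'm) module \<Rightarrow> 'm set \<Rightarrow> ('x \<Rightarrow> 'm) set" where
  "hom_mod R X N A = {u \<in> carrier X \<rightarrow> carrier N.
     (\<forall>x\<in>carrier X. \<forall>y\<in>carrier X. cong_mod N A (u (x \<oplus>\<^bsub>X\<^esub> y)) (u x \<oplus>\<^bsub>N\<^esub> u y)) \<and>
     (\<forall>a\<in>carrier R. \<forall>x\<in>carrier X. cong_mod N A (u (a \<odot>\<^bsub>X\<^esub> x)) (a \<odot>\<^bsub>N\<^esub> u x))}"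

lemma cong_mod_mono: "cong_mod N A x y \<Longrightarrow> A \<subseteq> B \<Longrightarrow> cong_mod N B x y"
  by (auto simp: cong_mod_def)

lemma hom_mod_mono: "u \<in> hom_mod R X N A \<Longrightarrow> A \<subseteq> B \<Longrightarrow> u \<in> hom_mod R X N B"
  unfolding hom_mod_def mem_Collect_eq using cong_mod_mono[of N A _ _ B] by blast

lemma hom_modD:
  assumes "u \<in> hom_mod R X N A"
  shows "x \<in> carrier X \<Longrightarrow> u x \<in> carrier N"
    and "\<lbrakk>x \<in> carrier X; y \<in> carrier X\<rbrakk> \<Longrightarrow> cong_mod N A (u (x \<oplus>\<^bsub>X\<^esub> y)) (u x \<oplus>\<^bsub>N\<^esub> u y)"
    and "\<lbrakk>a \<in> carrier R; x \<in> carrier X\<rbrakk> \<Longrightarrow> cong_mod N A (u (a \<odot>\<^bsub>X\<^esub> x)) (a \<odot>\<^bsub>N\<^esub> u x)"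
  using assms by (auto simp: hom_mod_def)

text \<open>Restricting the carrier leaves the addition of \<open>N\<close> untouched. This lets
  lifts be moved between a submodule and \<open>N\<close>.\<close>

lemma cong_mod_carrier_update:
  "K \<subseteq> carrier N \<Longrightarrow> cong_mod (N\<lparr>carrier := K\<rparr>) A x y \<longleftrightarrow> x \<in> K \<and> y \<in> K \<and> cong_mod N A x y"
  by (auto simp: cong_mod_def)

locale lmodule = left_module R N
  for R :: "('r, 's) ring_scheme" (structure) and N :: "('r, 'n) module" (structure)
begin

section \<open>Submodules\<close>

lemma smult_r_zero [simp]: "a \<in> carrier R \<Longrightarrow> a \<odot>\<^bsub>N\<^esub> \<zero>\<^bsub>N\<^esub> = \<zero>\<^bsub>N\<^esub>"
  using smult_r_distr[of a "\<zero>\<^bsub>N\<^esub>" "\<zero>\<^bsub>N\<^esub>"] by simp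

lemma smult_l_zero [simp]: "x \<in> carrier N \<Longrightarrow> \<zero> \<odot>\<^bsub>N\<^esub> x = \<zero>\<^bsub>N\<^esub>"
  using smult_l_distr[of \<zero> \<zero> x] by simp

lemma smult_minus_one: "x \<in> carrier N \<Longrightarrow> (\<ominus> \<one>) \<odot>\<^bsub>N\<^esub> x = \<ominus>\<^bsub>N\<^esub> x"
proof -
  assume x: "x \<in> carrier N"
  have "(\<ominus> \<one>) \<odot>\<^bsub>N\<^esub> x \<oplus>\<^bsub>N\<^esub> x = (\<ominus> \<one> \<oplus> \<one>) \<odot>\<^bsub>N\<^esub> x"
    using x by (simp add: smult_l_distr)
  also have "\<dots> = \<zero>\<^bsub>N\<^esub>" using x by (simp add: R.l_neg)
  finally show ?thesis using x by (simp add: M.minus_equality)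
qed

text \<open>Closure under negation comes from closure under scalars, because -x = (-1)x.\<close>

lemma submodule_iff:
  "submodule A R N \<longleftrightarrow> A \<subseteq> carrier N \<and> \<zero>\<^bsub>N\<^esub> \<in> A \<and> (\<forall>x\<in>A. \<forall>y\<in>A. x \<oplus>\<^bsub>N\<^esub> y \<in> A) \<and>
     (\<forall>a\<in>carrier R. \<forall>x\<in>A. a \<odot>\<^bsub>N\<^esub> x \<in> A)"
  (is "_ \<longleftrightarrow> ?r")
proof
  assume "submodule A R N"
  then interpret submodule A R N .
  show ?r using subset m_closed one_closed by auto
next
  assume r: ?r
  have "inv\<^bsub>add_monoid N\<^esub> x \<in> A" if "x \<in> A" for x
  proof -
    have "\<ominus>\<^bsub>N\<^esub> x \<in> A" using that r smult_minus_one[of x] by (metis R.a_inv_closed R.one_closed subsetD)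
    then show ?thesis by (simp add: a_inv_def)
  qed
  then show "submodule A R N" using r
    by (intro submodule.intro subgroup.intro submodule_axioms.intro) auto
qed

lemma submoduleD:
  assumes "submodule A R N"
  shows "A \<subseteq> carrier N" "\<zero>\<^bsub>N\<^esub> \<in> A" "\<And>x y. x \<in> A \<Longrightarrow> y \<in> A \<Longrightarrow> x \<oplus>\<^bsub>N\<^esub> y \<in> A"
    "\<And>a x. a \<in> carrier R \<Longrightarrow> x \<in> A \<Longrightarrow> a \<odot>\<^bsub>N\<^esub> x \<in> A" "\<And>x. x \<in> A \<Longrightarrow> \<ominus>\<^bsub>N\<^esub> x \<in> A"
proof -
  show "A \<subseteq> carrier N" "\<zero>\<^bsub>N\<^esub> \<in> A" "\<And>x y. x \<in> A \<Longrightarrow> y \<in> A \<Longrightarrow> x \<oplus>\<^bsub>N\<^esub> y \<in> A"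
    and sm: "\<And>a x. a \<in> carrier R \<Longrightarrow> x \<in> A \<Longrightarrow> a \<odot>\<^bsub>N\<^esub> x \<in> A"
    using assms by (auto simp: submodule_iff)
  show "\<ominus>\<^bsub>N\<^esub> x \<in> A" if "x \<in> A" for x
    using that sm[of "\<ominus> \<one>" x] smult_minus_one[of x] \<open>A \<subseteq> carrier N\<close> by auto
qed

lemma submodule_zero: "submodule {\<zero>\<^bsub>N\<^esub>} R N"
  by (auto simp: submodule_iff)

lemma submodule_carrier: "submodule (carrier N) R N"
  by (auto simp: submodule_iff)

lemma submodule_Int: "submodule A R N \<Longrightarrow> submodule B R N \<Longrightarrow> submodule (A \<inter> B) R N"
  by (auto simp: submodule_iff)

lemma submodule_Inter:
  "S \<noteq> {} \<Longrightarrow> (\<And>A. A \<in> S \<Longrightarrow> submodule A R N) \<Longrightarrow> submodule (\<Inter>S) R N"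
  unfolding submodule_iff by blast

lemma submodule_Union:
  assumes "S \<noteq> {}" "\<And>A. A \<in> S \<Longrightarrow> submodule A R N" "\<And>A B. A \<in> S \<Longrightarrow> B \<in> S \<Longrightarrow> A \<subseteq> B \<or> B \<subseteq> A"
  shows "submodule (\<Union>S) R N"
proof -
  have "x \<oplus>\<^bsub>N\<^esub> y \<in> \<Union>S" if "x \<in> \<Union>S" "y \<in> \<Union>S" for x y
  proof -
    obtain A B where "A \<in> S" "B \<in> S" "x \<in> A" "y \<in> B" using \<open>x \<in> \<Union>S\<close> \<open>y \<in> \<Union>S\<close> by auto
    then show ?thesis using assms(3)[of A B] submoduleD(3)[OF assms(2)] by blast
  qed
  moreover have "\<Union>S \<subseteq> carrier N" "\<zero>\<^bsub>N\<^esub> \<in> \<Union>S"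
    using assms(1) submoduleD(1,2)[OF assms(2)] by auto
  moreover have "a \<odot>\<^bsub>N\<^esub> x \<in> \<Union>S" if "a \<in> carrier R" "x \<in> \<Union>S" for a x
    using that submoduleD(4)[OF assms(2)] by auto
  ultimately show ?thesis unfolding submodule_iff by auto
qed

lemma lmodule_submodule:
  assumes "submodule K R N" shows "lmodule R (N\<lparr>carrier := K\<rparr>)"
proof -
  note K = submoduleD[OF assms]
  have sub: "x \<in> K \<Longrightarrow> x \<in> carrier N" for x using K(1) by auto
  have "abelian_group (N\<lparr>carrier := K\<rparr>)"
  proof (rule abelian_groupI)
    fix x assume "x \<in> carrier (N\<lparr>carrier := K\<rparr>)"
    then show "\<exists>y\<in>carrier (N\<lparr>carrier := K\<rparr>). y \<oplus>\<^bsub>N\<lparr>carrier := K\<rparr>\<^esub> x = \<zero>\<^bsub>N\<lparr>carrier := K\<rparr>\<^esub>"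
      using K(5)[of x] sub by (auto intro!: bexI[of _ "\<ominus>\<^bsub>N\<^esub> x"] simp: M.l_neg)
  next
    show "x \<oplus>\<^bsub>N\<lparr>carrier := K\<rparr>\<^esub> y = y \<oplus>\<^bsub>N\<lparr>carrier := K\<rparr>\<^esub> x"
      if "x \<in> carrier (N\<lparr>carrier := K\<rparr>)" "y \<in> carrier (N\<lparr>carrier := K\<rparr>)" for x y
      using that sub by (simp add: M.a_comm)
  qed (use K sub in \<open>auto simp: M.a_assoc\<close>)
  then show ?thesis
    by (intro lmodule.intro left_module.intro left_module_axioms.intro)
      (use K sub R.ring_axioms in
        \<open>auto simp: smult_l_distr smult_r_distr smult_assoc1\<close>)
qed

lemma submodule_of_submodule:
  assumes "submodule K R N"
  shows "submodule A R (N\<lparr>carrier := K\<rparr>) \<longleftrightarrow> submodule A R N \<and> A \<subseteq> K"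
proof -
  interpret K: lmodule R "N\<lparr>carrier := K\<rparr>" by (rule lmodule_submodule[OF assms])
  show ?thesis using submoduleD(1)[OF assms] by (auto simp: submodule_iff K.submodule_iff)
qed

section \<open>Congruence modulo a submodule\<close>

lemma cong_mod_refl:
  assumes "submodule A R N" "x \<in> carrier N" shows "cong_mod N A x x"
  using assms submoduleD(2)[OF assms(1)] by (auto simp: cong_mod_def intro!: bexI[of _ "\<zero>\<^bsub>N\<^esub>"])

lemma cong_mod_sym:
  assumes A: "submodule A R N" and "cong_mod N A x y" shows "cong_mod N A y x"
proof -
  obtain a where a: "a \<in> A" "x = a \<oplus>\<^bsub>N\<^esub> y" "x \<in> carrier N" "y \<in> carrier N"
    using assms(2) by (auto simp: cong_mod_def)
  have "a \<in> carrier N" using a A submoduleD(1) by auto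
  then have "y = \<ominus>\<^bsub>N\<^esub> a \<oplus>\<^bsub>N\<^esub> x" using a by (simp add: M.r_neg1)
  then show ?thesis using a submoduleD(5)[OF A] by (auto simp: cong_mod_def)
qed

lemma cong_mod_trans:
  assumes A: "submodule A R N" and "cong_mod N A x y" "cong_mod N A y z" shows "cong_mod N A x z"
proof -
  obtain a b where ab: "a \<in> A" "x = a \<oplus>\<^bsub>N\<^esub> y" "b \<in> A" "y = b \<oplus>\<^bsub>N\<^esub> z"
    and c: "x \<in> carrier N" "z \<in> carrier N"
    using assms(2,3) unfolding cong_mod_def by blast
  then have "a \<in> carrier N" "b \<in> carrier N" using submoduleD(1)[OF A] by auto
  then have "x = (a \<oplus>\<^bsub>N\<^esub> b) \<oplus>\<^bsub>N\<^esub> z" using ab c by (simp add: M.a_assoc)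
  moreover have "a \<oplus>\<^bsub>N\<^esub> b \<in> A" using ab submoduleD(3)[OF A] by simp
  ultimately show ?thesis using c unfolding cong_mod_def by blast
qed

lemma cong_mod_add:
  assumes A: "submodule A R N" and "cong_mod N A x y" "cong_mod N A x' y'"
  shows "cong_mod N A (x \<oplus>\<^bsub>N\<^esub> x') (y \<oplus>\<^bsub>N\<^esub> y')"
proof -
  obtain a b where ab: "a \<in> A" "x = a \<oplus>\<^bsub>N\<^esub> y" "b \<in> A" "x' = b \<oplus>\<^bsub>N\<^esub> y'"
    using assms(2,3) by (auto simp: cong_mod_def)
  have c: "a \<in> carrier N" "b \<in> carrier N" "y \<in> carrier N" "y' \<in> carrier N"
    using ab assms submoduleD(1)[OF A] by (auto simp: cong_mod_def)
  have "x \<oplus>\<^bsub>N\<^esub> x' \<in> carrier N" "y \<oplus>\<^bsub>N\<^esub> y' \<in> carrier N"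
    using c by (simp_all add: ab)
  moreover have "x \<oplus>\<^bsub>N\<^esub> x' = (a \<oplus>\<^bsub>N\<^esub> b) \<oplus>\<^bsub>N\<^esub> (y \<oplus>\<^bsub>N\<^esub> y')"
    using c by (simp add: ab M.a_ac)
  ultimately show ?thesis using ab submoduleD(3)[OF A] unfolding cong_mod_def by blast
qed

lemma cong_mod_smult:
  assumes A: "submodule A R N" and "cong_mod N A x y" and a: "a \<in> carrier R"
  shows "cong_mod N A (a \<odot>\<^bsub>N\<^esub> x) (a \<odot>\<^bsub>N\<^esub> y)"
proof -
  obtain b where b: "b \<in> A" "x = b \<oplus>\<^bsub>N\<^esub> y" using assms(2) by (auto simp: cong_mod_def)
  then have "a \<odot>\<^bsub>N\<^esub> x = a \<odot>\<^bsub>N\<^esub> b \<oplus>\<^bsub>N\<^esub> a \<odot>\<^bsub>N\<^esub> y"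
    using b assms(2) a submoduleD(1)[OF A] by (metis cong_mod_def smult_r_distr subsetD)
  moreover have "a \<odot>\<^bsub>N\<^esub> b \<in> A" using a b submoduleD(4)[OF A] by auto
  moreover have "a \<odot>\<^bsub>N\<^esub> x \<in> carrier N" "a \<odot>\<^bsub>N\<^esub> y \<in> carrier N"
    using a assms(2) by (auto simp: cong_mod_def)
  ultimately show ?thesis unfolding cong_mod_def by blast
qed

lemma cong_mod_mem:
  assumes "submodule B R N" "cong_mod N A x y" "A \<subseteq> B" "y \<in> B" shows "x \<in> B"
  using assms(2-4) submoduleD(3)[OF assms(1)] unfolding cong_mod_def by blast

lemma cong_mod_mem':
  assumes "submodule A R N" "submodule B R N" "cong_mod N A x y" "A \<subseteq> B" "x \<in> B" shows "y \<in> B"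
  using cong_mod_mem[OF assms(2) cong_mod_sym[OF assms(1,3)]] assms by blast

lemma cong_mod_zero:
  assumes "submodule A R N" shows "cong_mod N A x \<zero>\<^bsub>N\<^esub> \<longleftrightarrow> x \<in> A"
proof
  assume "cong_mod N A x \<zero>\<^bsub>N\<^esub>"
  then show "x \<in> A" using cong_mod_mem[OF assms, of A x] submoduleD(2)[OF assms] by blast
next
  assume x: "x \<in> A"
  then have "x \<in> carrier N" using submoduleD(1)[OF assms] by auto
  then have "x = x \<oplus>\<^bsub>N\<^esub> \<zero>\<^bsub>N\<^esub>" by simp
  then show "cong_mod N A x \<zero>\<^bsub>N\<^esub>" using x \<open>x \<in> carrier N\<close> unfolding cong_mod_def by blast
qed

text \<open>The witness of a congruence is the difference of the two elements, so by cancellation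
  the witnesses in \<open>A\<close> and in \<open>B\<close> coincide.\<close>

lemma cong_mod_Int:
  assumes A: "submodule A R N" "submodule B R N" shows "cong_mod N (A \<inter> B) x y \<longleftrightarrow> cong_mod N A x y \<and> cong_mod N B x y"
proof
  assume c: "cong_mod N A x y \<and> cong_mod N B x y"
  then obtain a b where ab: "a \<in> A" "x = a \<oplus>\<^bsub>N\<^esub> y" "b \<in> B" "x = b \<oplus>\<^bsub>N\<^esub> y"
    and y: "x \<in> carrier N" "y \<in> carrier N"
    unfolding cong_mod_def by blast
  then have "a \<in> carrier N" "b \<in> carrier N"
    using submoduleD(1)[OF A(1)] submoduleD(1)[OF A(2)] by auto
  then have "a = b" using ab y M.add.right_cancel[of y a b] by simp
  then show "cong_mod N (A \<inter> B) x y" using ab y unfolding cong_mod_def by blast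
qed (auto intro: cong_mod_mono)

lemma cong_mod_if_mem:
  assumes A: "submodule A R N" and "x \<in> A" "y \<in> A" shows "cong_mod N A x y"
  using cong_mod_trans[OF A _ cong_mod_sym[OF A]] assms cong_mod_zero[OF A] by blast

text \<open>\<open>K\<close> is an arbitrary subset, since the lemma is applied to the image of a
  lift, which in general is not a submodule.\<close>

lemma mem_set_add_iff:
  assumes A: "submodule A R N" and "K \<subseteq> carrier N"
  shows "x \<in> A <+>\<^bsub>N\<^esub> K \<longleftrightarrow> (\<exists>k\<in>K. cong_mod N A x k)"
  using assms(2) submoduleD(1)[OF A] by (auto simp: set_add_def' cong_mod_def)

lemma submodule_set_add:
  assumes A: "submodule A R N" and K: "submodule K R N" shows "submodule (A <+>\<^bsub>N\<^esub> K) R N"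
proof -
  note m = mem_set_add_iff[OF A submoduleD(1)[OF K]]
  show ?thesis unfolding submodule_iff
  proof (intro conjI ballI subsetI)
    show "x \<in> carrier N" if "x \<in> A <+>\<^bsub>N\<^esub> K" for x using that m by (auto simp: cong_mod_def)
    show "\<zero>\<^bsub>N\<^esub> \<in> A <+>\<^bsub>N\<^esub> K" using m submoduleD(2)[OF K] cong_mod_refl[OF A] by blast
    show "x \<oplus>\<^bsub>N\<^esub> y \<in> A <+>\<^bsub>N\<^esub> K" if "x \<in> A <+>\<^bsub>N\<^esub> K" "y \<in> A <+>\<^bsub>N\<^esub> K" for x y
      using that cong_mod_add[OF A, of x _ y] submoduleD(3)[OF K] unfolding m by blast
    show "a \<odot>\<^bsub>N\<^esub> x \<in> A <+>\<^bsub>N\<^esub> K" if "a \<in> carrier R" "x \<in> A <+>\<^bsub>N\<^esub> K" for a x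
      using that cong_mod_smult[OF A, of x _ a] submoduleD(4)[OF K] unfolding m by blast
  qed
qed

lemma set_add_upper1:
  assumes "submodule A R N" "\<zero>\<^bsub>N\<^esub> \<in> K" shows "A \<subseteq> A <+>\<^bsub>N\<^esub> K"
proof
  fix x assume "x \<in> A"
  then have "x = x \<oplus>\<^bsub>N\<^esub> \<zero>\<^bsub>N\<^esub>" using submoduleD(1)[OF assms(1)] by auto
  then show "x \<in> A <+>\<^bsub>N\<^esub> K" using \<open>x \<in> A\<close> assms(2) unfolding set_add_def' by blast
qed

lemma set_add_upper2:
  assumes "submodule A R N" "K \<subseteq> carrier N" shows "K \<subseteq> A <+>\<^bsub>N\<^esub> K"
  using mem_set_add_iff[OF assms] cong_mod_refl[OF assms(1)] assms(2) by blast

lemma set_add_least: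
  assumes "submodule B R N" "A \<subseteq> B" "K \<subseteq> B" shows "A <+>\<^bsub>N\<^esub> K \<subseteq> B"
  using assms submoduleD(3)[OF assms(1)] by (auto simp: set_add_def')

lemma set_add_assoc:
  assumes "A \<subseteq> carrier N" "B \<subseteq> carrier N" "C \<subseteq> carrier N"
  shows "(A <+>\<^bsub>N\<^esub> B) <+>\<^bsub>N\<^esub> C = A <+>\<^bsub>N\<^esub> (B <+>\<^bsub>N\<^esub> C)"
  using M.add.set_mult_assoc[of A B C] assms by (simp add: set_add_def)

lemma set_add_commute:
  assumes "A \<subseteq> carrier N" "B \<subseteq> carrier N" shows "A <+>\<^bsub>N\<^esub> B = B <+>\<^bsub>N\<^esub> A"
proof -
  have "A <+>\<^bsub>N\<^esub> B \<subseteq> B <+>\<^bsub>N\<^esub> A" if "A \<subseteq> carrier N" "B \<subseteq> carrier N" for A B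
  proof
    fix x assume "x \<in> A <+>\<^bsub>N\<^esub> B"
    then obtain a b where "a \<in> A" "b \<in> B" "x = a \<oplus>\<^bsub>N\<^esub> b" unfolding set_add_def' by blast
    moreover then have "x = b \<oplus>\<^bsub>N\<^esub> a" using that M.a_comm[of a b] by blast
    ultimately show "x \<in> B <+>\<^bsub>N\<^esub> A" unfolding set_add_def' by blast
  qed
  then show ?thesis using assms by blast
qed

lemma set_add_absorb:
  assumes "submodule A R N" "submodule B R N" "A \<subseteq> B" shows "A <+>\<^bsub>N\<^esub> B = B"
  using set_add_least[OF assms(2,3) subset_refl]
    set_add_upper2[OF assms(1) submoduleD(1)[OF assms(2)]] by blast

lemma zero_set_add: "A \<subseteq> carrier N \<Longrightarrow> {\<zero>\<^bsub>N\<^esub>} <+>\<^bsub>N\<^esub> A = A"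
  using set_add_upper2[OF submodule_zero, of A] by (auto simp: set_add_def' subset_iff)

end

section \<open>Homomorphisms modulo a submodule\<close>

lemma lmod_hom_zero:
  assumes "lmodule R X" "lmodule R N" "h \<in> lmod_hom R X N" shows "h \<zero>\<^bsub>X\<^esub> = \<zero>\<^bsub>N\<^esub>"
proof -
  interpret X: lmodule R X by fact
  interpret lmodule R N by fact
  have "h (\<zero>\<^bsub>R\<^esub> \<odot>\<^bsub>X\<^esub> \<zero>\<^bsub>X\<^esub>) = \<zero>\<^bsub>R\<^esub> \<odot>\<^bsub>N\<^esub> h \<zero>\<^bsub>X\<^esub>" "h \<zero>\<^bsub>X\<^esub> \<in> carrier N" 
    using assms(3) unfolding lmod_hom_def by blast+
  then show ?thesis by simp
qed

context lmodule
begin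

lemma hom_mod_zero:
  assumes X: "lmodule R X" and A: "submodule A R N" and u: "u \<in> hom_mod R X N A"
  shows "u \<zero>\<^bsub>X\<^esub> \<in> A"
proof -
  interpret X: lmodule R X by fact
  have "cong_mod N A (u (\<zero> \<odot>\<^bsub>X\<^esub> \<zero>\<^bsub>X\<^esub>)) (\<zero> \<odot>\<^bsub>N\<^esub> u \<zero>\<^bsub>X\<^esub>)" "u \<zero>\<^bsub>X\<^esub> \<in> carrier N"
    using hom_modD(1,3)[OF u] by blast+
  then show ?thesis using cong_mod_zero[OF A] by simp
qed

text \<open>A lift is additive only modulo \<open>A\<close>, so its image alone need not be a
  submodule. Adding \<open>A\<close> gives the preimage in \<open>N\<close> of the image of the
  induced map from \<open>X\<close> to \<open>N/A\<close>.\<close>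

lemma submodule_hom_mod_image:
  assumes X: "lmodule R X" and A: "submodule A R N" and u: "u \<in> hom_mod R X N A"
  shows "submodule (A <+>\<^bsub>N\<^esub> u ` carrier X) R N"
proof -
  interpret X: lmodule R X by fact
  have "u ` carrier X \<subseteq> carrier N" using hom_modD(1)[OF u] by auto
  then have m: "y \<in> A <+>\<^bsub>N\<^esub> u ` carrier X \<longleftrightarrow> (\<exists>x\<in>carrier X. cong_mod N A y (u x))" for y
    using mem_set_add_iff[OF A] by auto
  show ?thesis unfolding submodule_iff
  proof (intro conjI ballI subsetI)
    show "x \<in> carrier N" if "x \<in> A <+>\<^bsub>N\<^esub> u ` carrier X" for x using that m by (auto simp: cong_mod_def)
    show "\<zero>\<^bsub>N\<^esub> \<in> A <+>\<^bsub>N\<^esub> u ` carrier X"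
      using m hom_mod_zero[OF assms] submoduleD(2)[OF A] cong_mod_if_mem[OF A] X.M.zero_closed by blast
    show "x \<oplus>\<^bsub>N\<^esub> y \<in> A <+>\<^bsub>N\<^esub> u ` carrier X"
      if "x \<in> A <+>\<^bsub>N\<^esub> u ` carrier X" "y \<in> A <+>\<^bsub>N\<^esub> u ` carrier X" for x y
    proof -
      from that m obtain z w where zw: "z \<in> carrier X" "w \<in> carrier X" "cong_mod N A x (u z)" "cong_mod N A y (u w)"
        by blast
      have "cong_mod N A (x \<oplus>\<^bsub>N\<^esub> y) (u (z \<oplus>\<^bsub>X\<^esub> w))"
        by (rule cong_mod_trans[OF A cong_mod_add[OF A zw(3,4)] cong_mod_sym[OF A hom_modD(2)[OF u zw(1,2)]]])
      then show ?thesis using m zw by blast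
    qed
    show "a \<odot>\<^bsub>N\<^esub> x \<in> A <+>\<^bsub>N\<^esub> u ` carrier X" if "a \<in> carrier R" "x \<in> A <+>\<^bsub>N\<^esub> u ` carrier X" for a x
    proof -
      from that m obtain z where z: "z \<in> carrier X" "cong_mod N A x (u z)" by blast
      have "cong_mod N A (a \<odot>\<^bsub>N\<^esub> x) (u (a \<odot>\<^bsub>X\<^esub> z))"
        by (rule cong_mod_trans[OF A cong_mod_smult[OF A z(2) that(1)] cong_mod_sym[OF A hom_modD(3)[OF u that(1) z(1)]]])
      then show ?thesis using m z that by blast
    qed
  qed
qed

text \<open>The induced map has trivial kernel by \<open>inj\<close>, and \<open>u\<close> sends the
  difference of \<open>x\<close> and \<open>y\<close> into \<open>A\<close>.\<close>

lemma hom_mod_injD: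
  assumes X: "lmodule R X" and A: "submodule A R N" and u: "u \<in> hom_mod R X N A"
    and inj: "\<And>x. x \<in> carrier X \<Longrightarrow> u x \<in> A \<Longrightarrow> x = \<zero>\<^bsub>X\<^esub>"
    and x: "x \<in> carrier X" and y: "y \<in> carrier X" and c: "cong_mod N A (u x) (u y)"
  shows "x = y"
proof -
  interpret X: lmodule R X by fact
  have uc: "u x \<in> carrier N" "u y \<in> carrier N" using hom_modD(1)[OF u] x y by auto
  have "cong_mod N A (u (\<ominus>\<^bsub>X\<^esub> y)) (\<ominus>\<^bsub>N\<^esub> u y)"
    using hom_modD(3)[OF u, of "\<ominus> \<one>" y] y uc by (simp add: smult_minus_one X.smult_minus_one)
  then have "cong_mod N A (u x \<oplus>\<^bsub>N\<^esub> u (\<ominus>\<^bsub>X\<^esub> y)) (u y \<oplus>\<^bsub>N\<^esub> \<ominus>\<^bsub>N\<^esub> u y)"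
    by (intro cong_mod_add[OF A c])
  then have "cong_mod N A (u (x \<oplus>\<^bsub>X\<^esub> \<ominus>\<^bsub>X\<^esub> y)) (u y \<oplus>\<^bsub>N\<^esub> \<ominus>\<^bsub>N\<^esub> u y)"
    using cong_mod_trans[OF A hom_modD(2)[OF u, of x "\<ominus>\<^bsub>X\<^esub> y"]] x y by simp
  then have "u (x \<oplus>\<^bsub>X\<^esub> \<ominus>\<^bsub>X\<^esub> y) \<in> A" using uc by (simp add: M.r_neg cong_mod_zero[OF A])
  then have "x \<oplus>\<^bsub>X\<^esub> \<ominus>\<^bsub>X\<^esub> y = \<zero>\<^bsub>X\<^esub>" using inj x y by simp
  then show ?thesis using x y X.M.minus_equality[of x "\<ominus>\<^bsub>X\<^esub> y"] by simp
qed

text \<open>Pulls terms of a chain back to \<open>X\<close>, where finite generation can be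
  applied.\<close>

lemma submodule_hom_mod_vimage:
  assumes X: "lmodule R X" and A: "submodule A R N" and u: "u \<in> hom_mod R X N A"
    and B: "submodule B R N" "A \<subseteq> B"
  shows "submodule {x \<in> carrier X. u x \<in> B} R X"
proof -
  interpret X: lmodule R X by fact
  show ?thesis unfolding X.submodule_iff
    using hom_mod_zero[OF X A u] B(2) submoduleD(3,4)[OF B(1)]
      cong_mod_mem[OF B(1) hom_modD(2)[OF u] B(2)] cong_mod_mem[OF B(1) hom_modD(3)[OF u] B(2)]
    by auto
qed

text \<open>As \<open>f\<close> maps \<open>C\<close> into \<open>A\<close>, it induces a map from
  \<open>M/C\<close> to \<open>N/A\<close>, which is composed with the map induced by
  \<open>u\<close>.\<close>

lemma hom_mod_comp:
  assumes C: "submodule C R M" "lmodule R M" and A: "submodule A R N"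
    and u: "u \<in> hom_mod R X M C" and f: "f \<in> lmod_hom R M N" "f ` C \<subseteq> A"
  shows "f \<circ> u \<in> hom_mod R X N A"
proof -
  interpret M': lmodule R M by fact
  have c: "cong_mod N A (f x) (f y)" if xy: "cong_mod M C x y" for x y
  proof -
    obtain a where a: "a \<in> C" "x = a \<oplus>\<^bsub>M\<^esub> y" "x \<in> carrier M" "y \<in> carrier M"
      using xy by (auto simp: cong_mod_def)
    then have "f x = f a \<oplus>\<^bsub>N\<^esub> f y" "f x \<in> carrier N" "f y \<in> carrier N" "f a \<in> A"
      using f M'.submoduleD(1)[OF C(1)] by (auto simp: lmod_hom_def)
    then show ?thesis by (auto simp: cong_mod_def)
  qed
  have h: "f x \<in> carrier N" "f (x \<oplus>\<^bsub>M\<^esub> y) = f x \<oplus>\<^bsub>N\<^esub> f y" "f (a \<odot>\<^bsub>M\<^esub> x) = a \<odot>\<^bsub>N\<^esub> f x"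
    if "x \<in> carrier M" "y \<in> carrier M" "a \<in> carrier R" for x y a
    using f(1) that unfolding lmod_hom_def by blast+
  show ?thesis unfolding hom_mod_def mem_Collect_eq comp_def
  proof (intro conjI ballI)
    show "(\<lambda>x. f (u x)) \<in> carrier X \<rightarrow> carrier N"
      using h(1)[OF _ _ R.zero_closed] hom_modD(1)[OF u] by blast
    show "cong_mod N A (f (u (x \<oplus>\<^bsub>X\<^esub> y))) (f (u x) \<oplus>\<^bsub>N\<^esub> f (u y))"
      if "x \<in> carrier X" "y \<in> carrier X" for x y
      using c[OF hom_modD(2)[OF u that]] h(2)[OF _ _ R.zero_closed] hom_modD(1)[OF u] that by simp
    show "cong_mod N A (f (u (a \<odot>\<^bsub>X\<^esub> x))) (a \<odot>\<^bsub>N\<^esub> f (u x))"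
      if "a \<in> carrier R" "x \<in> carrier X" for a x
      using c[OF hom_modD(3)[OF u that]] h(3)[OF _ M'.M.zero_closed] hom_modD(1)[OF u] that by simp
  qed
qed

end

section \<open>Well-ordered chains of sets\<close>

text \<open>
  A filtration is replaced by the set of its terms: the condition on \<open>\<Inter>S\<close> says that inclusion is a
  well-order on \<open>\<C>\<close>, the one on \<open>\<Union>S\<close> that the filtration is continuous.
\<close>

definition wchain :: "'a set set \<Rightarrow> bool" where
  "wchain \<C> \<longleftrightarrow> (\<forall>S\<subseteq>\<C>. S \<noteq> {} \<longrightarrow> \<Inter>S \<in> S \<and> \<Union>S \<in> \<C>)"

text \<open>\<open>D\<close> is the immediate successor of \<open>C\<close> in the chain. The pairs
  of this kind stand for the non-zero factors \<open>D/C\<close> of a filtration.\<close>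

definition covers :: "'a set set \<Rightarrow> 'a set \<Rightarrow> 'a set \<Rightarrow> bool" where
  "covers \<C> C D \<longleftrightarrow> C \<in> \<C> \<and> D \<in> \<C> \<and> C \<subset> D \<and> (\<forall>E\<in>\<C>. C \<subset> E \<longrightarrow> D \<subseteq> E)"

lemma wchainD:
  assumes "wchain \<C>" "S \<subseteq> \<C>" "S \<noteq> {}"
  shows "\<Inter>S \<in> S" "\<Union>S \<in> \<C>"
  using assms by (auto simp: wchain_def)

lemma wchain_linear:
  assumes "wchain \<C>" "A \<in> \<C>" "B \<in> \<C>" shows "A \<subseteq> B \<or> B \<subseteq> A"
  using wchainD(1)[OF assms(1), of "{A, B}"] assms by auto

text \<open>The zero, successor and limit trichotomy without ordinals. The union of the members
  properly below \<open>C\<close> is again a member; either it is \<open>C\<close>, or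
  \<open>C\<close> covers it.\<close>

lemma wchain_cases [consumes 2, case_names bot succ lim]:
  assumes w: "wchain \<C>" and C: "C \<in> \<C>"
  obtains (bot) "C = \<Inter>\<C>" | (succ) D where "covers \<C> D C"
    | (lim) S where "S \<subseteq> \<C>" "S \<noteq> {}" "C = \<Union>S" "\<And>E. E \<in> S \<Longrightarrow> E \<subset> C"
proof (cases "C = \<Inter>\<C>")
  case False
  define S where "S = {E \<in> \<C>. E \<subset> C}"
  have "\<Inter>\<C> \<in> S" using wchainD(1)[OF w, of \<C>] C False by (auto simp: S_def)
  then have S: "S \<subseteq> \<C>" "S \<noteq> {}" "\<And>E. E \<in> S \<Longrightarrow> E \<subset> C" by (auto simp: S_def)
  have U: "\<Union>S \<in> \<C>" by (rule wchainD(2)[OF w S(1,2)])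
  show ?thesis
  proof (cases "C = \<Union>S")
    case True
    show ?thesis by (rule lim[OF S(1,2) True S(3)])
  next
    case nC: False
    have "C \<subseteq> E" if "E \<in> \<C>" "\<Union>S \<subset> E" for E
      using wchain_linear[OF w C that(1)] that by (auto simp: S_def)
    moreover have "\<Union>S \<subset> C" using nC S(3) by blast
    ultimately have "covers \<C> (\<Union>S) C" using U C unfolding covers_def by blast
    then show ?thesis using succ by blast
  qed
qed (rule bot)

text \<open>Transfinite induction: the intersection of all counterexamples is itself the least one,
  and each of the three cases refutes it.\<close>

lemma wchain_induct [consumes 2, case_names bot succ lim]:
  assumes w: "wchain \<C>" and C: "C \<in> \<C>" and bot: "P (\<Inter>\<C>)"
    and succ: "\<And>C D. covers \<C> C D \<Longrightarrow> P C \<Longrightarrow> P D"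
    and lim: "\<And>S. S \<subseteq> \<C> \<Longrightarrow> S \<noteq> {} \<Longrightarrow> (\<And>E. E \<in> S \<Longrightarrow> P E) \<Longrightarrow> P (\<Union>S)"
  shows "P C"
proof (rule ccontr)
  assume "\<not> P C"
  define B where "B = {E \<in> \<C>. \<not> P E}"
  have "B \<noteq> {}" "B \<subseteq> \<C>" using C \<open>\<not> P C\<close> by (auto simp: B_def)
  then have "\<Inter>B \<in> B" using wchainD(1)[OF w] by blast
  then have min: "\<Inter>B \<in> \<C>" "\<not> P (\<Inter>B)" by (auto simp: B_def)
  have below: "P E" if "E \<in> \<C>" "E \<subset> \<Inter>B" for E using that by (auto simp: B_def)
  from w min(1) show False
  proof (cases rule: wchain_cases)
    case bot
    then show False using assms(3) min(2) by simp
  next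
    case (succ D)
    then have "P D" using below by (simp add: covers_def)
    then show False using assms(4)[OF succ] min(2) by simp
  next
    case (lim S)
    then have "P E" if "E \<in> S" for E using below that by blast
    then show False using assms(5)[OF lim(1,2)] lim(3) min(2) by simp
  qed
qed

text \<open>Commuting with unions of pairs makes \<open>\<phi>\<close> monotone. It may be constant
  on stretches of the chain, which deletes factors, but it creates none: every covering pair in the
  image comes from a covering pair of \<C>.\<close>

lemma wchain_image:
  assumes w: "wchain \<C>" and \<phi>: "\<And>S. S \<subseteq> \<C> \<Longrightarrow> S \<noteq> {} \<Longrightarrow> \<phi> (\<Union>S) = \<Union>(\<phi> ` S)"
  shows "wchain (\<phi> ` \<C>)"
    and "covers (\<phi> ` \<C>) D D' \<Longrightarrow> \<exists>C C'. covers \<C> C C' \<and> D = \<phi> C \<and> D' = \<phi> C'"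
proof -
  have mono: "\<phi> A \<subseteq> \<phi> B" if "A \<in> \<C>" "B \<in> \<C>" "A \<subseteq> B" for A B
  proof -
    have "A \<union> B = B" using that by auto
    then show ?thesis using \<phi>[of "{A, B}"] that by auto
  qed
  show "wchain (\<phi> ` \<C>)" unfolding wchain_def
  proof (intro allI impI)
    fix S assume S: "S \<subseteq> \<phi> ` \<C>" "S \<noteq> {}"
    then obtain T where T: "T \<subseteq> \<C>" "S = \<phi> ` T" by (meson subset_imageE)
    with S have ne: "T \<noteq> {}" by auto
    note m = wchainD[OF w T(1) ne]
    have "\<phi> (\<Inter>T) \<subseteq> \<phi> C" if "C \<in> T" for C
      using mono[of "\<Inter>T" C] m(1) T(1) that by blast
    then have "\<phi> (\<Inter>T) = \<Inter>S" using m(1) unfolding T(2) by blast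
    then have "\<Inter>S \<in> S" using m(1) T(2) by (metis imageI)
    moreover have "\<Union>S \<in> \<phi> ` \<C>" using \<phi>[OF T(1) ne] m(2) T(2) by (metis imageI)
    ultimately show "\<Inter>S \<in> S \<and> \<Union>S \<in> \<phi> ` \<C>" ..
  qed
  assume cov: "covers (\<phi> ` \<C>) D D'"
  let ?S = "{C \<in> \<C>. \<phi> C = D}" and ?T = "{C \<in> \<C>. \<phi> C = D'}"
  have ne: "?S \<noteq> {}" "?T \<noteq> {}" using cov by (auto simp: covers_def)
  \<comment> \<open>The last member with value \<open>D\<close> and the first one with value
    \<open>D'\<close>. A member strictly between them would have a value strictly between
    \<open>D\<close> and \<open>D'\<close>.\<close>
  define C where "C = \<Union>?S"
  define C' where "C' = \<Inter>?T"
  have "C \<in> \<C>" unfolding C_def using wchainD(2)[OF w _ ne(1)] by auto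
  have fC: "\<phi> C = D" unfolding C_def using \<phi>[OF _ ne(1)] ne(1) by auto
  have "C' \<in> ?T" unfolding C'_def using wchainD(1)[OF w _ ne(2)] by auto
  then have C': "C' \<in> \<C>" "\<phi> C' = D'" by auto
  have "\<not> C' \<subseteq> C" using mono[OF C'(1) \<open>C \<in> \<C>\<close>] cov fC C' by (auto simp: covers_def)
  then have "C \<subset> C'" using wchain_linear[OF w \<open>C \<in> \<C>\<close> C'(1)] by auto
  moreover have "C' \<subseteq> E" if E: "E \<in> \<C>" "C \<subset> E" for E
  proof (rule ccontr)
    assume "\<not> C' \<subseteq> E"
    then have "E \<subset> C'" using wchain_linear[OF w E(1) C'(1)] by auto
    then have "\<phi> E \<subseteq> D'" "\<phi> E \<noteq> D'" using mono[OF E(1) C'(1)] C' E(1) by (auto simp: C'_def)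
    moreover have "D \<subseteq> \<phi> E" "\<phi> E \<noteq> D"
      using mono[OF \<open>C \<in> \<C>\<close> E(1)] fC E by (auto simp: C_def)
    ultimately show False using cov E(1) unfolding covers_def by blast
  qed
  ultimately have "covers \<C> C C'" using \<open>C \<in> \<C>\<close> C' by (auto simp: covers_def)
  then show "\<exists>C C'. covers \<C> C C' \<and> D = \<phi> C \<and> D' = \<phi> C'" using fC C' by blast
qed

lemma wchain_tail: "wchain \<C> \<Longrightarrow> wchain {E \<in> \<C>. D \<subseteq> E}"
  unfolding wchain_def
proof (intro allI impI)
  fix S assume w: "\<forall>S\<subseteq>\<C>. S \<noteq> {} \<longrightarrow> \<Inter>S \<in> S \<and> \<Union>S \<in> \<C>"
    and S: "S \<subseteq> {E \<in> \<C>. D \<subseteq> E}" "S \<noteq> {}"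
  then obtain E where "E \<in> S" "D \<subseteq> E" by auto
  then have "D \<subseteq> \<Union>S" by auto
  moreover have "S \<subseteq> \<C>" using S by auto
  ultimately show "\<Inter>S \<in> S \<and> \<Union>S \<in> {E \<in> \<C>. D \<subseteq> E}" using w S(2) by simp
qed

lemma covers_tail: "covers {E \<in> \<C>. D \<subseteq> E} C C' \<Longrightarrow> covers \<C> C C'"
  unfolding covers_def by blast

section \<open>Bricks\<close>

text \<open>The generators are the images of the standard basis vectors of \<open>R^n\<close>.
  Generation is phrased through submodules \<open>B\<close>, the form in which pulled back terms of
  a chain use it.\<close>

lemma finitely_presented_imp_finitely_generated:
  assumes "finitely_presented R X"
  obtains E where "finite E" "E \<subseteq> carrier X" "\<And>B. submodule B R X \<Longrightarrow> E \<subseteq> B \<Longrightarrow> B = carrier X"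
proof -
  interpret X: lmodule R X using assms by (simp add: finitely_presented_def lmodule_def)
  obtain n p where p: "p \<in> lmod_hom R (free_lmod R n) X" "p ` carrier (free_lmod R n) = carrier X"
    using assms by (auto simp: finitely_presented_def)
  define e where "e i = (\<lambda>j\<in>{..<n}. if j = i then \<one>\<^bsub>R\<^esub> else \<zero>\<^bsub>R\<^esub>)" for i
  have e: "e i \<in> carrier (free_lmod R n)" for i
    by (auto simp: e_def free_lmod_def)
  show ?thesis
  proof
    show "finite ((\<lambda>i. p (e i)) ` {..<n})" by simp
    show "(\<lambda>i. p (e i)) ` {..<n} \<subseteq> carrier X" using e p(2) by blast
    fix B assume B: "submodule B R X" "(\<lambda>i. p (e i)) ` {..<n} \<subseteq> B"
    have "p v \<in> B" if v: "v \<in> carrier (free_lmod R n)" for v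
    proof -
      \<comment> \<open>\<open>w k\<close> keeps the first \<open>k\<close> coordinates of
        \<open>v\<close>. Passing from \<open>k\<close> to \<open>k + 1\<close> adds one multiple of
        a basis vector, and \<open>w n\<close> is \<open>v\<close>.\<close>
      define w where "w k = (\<lambda>j\<in>{..<n}. if j < k then v j else \<zero>\<^bsub>R\<^esub>)" for k
      have vj: "v j \<in> carrier R" if "j < n" for j using v that by (auto simp: free_lmod_def)
      have w: "w k \<in> carrier (free_lmod R n)" for k
        using vj by (auto simp: w_def free_lmod_def)
      have "k \<le> n \<Longrightarrow> p (w k) \<in> B" for k
      proof (induction k)
        case 0
        have "\<zero>\<^bsub>R\<^esub> \<odot>\<^bsub>free_lmod R n\<^esub> w 0 = w 0"
          by (auto simp: w_def free_lmod_def)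
        moreover have "p (\<zero>\<^bsub>R\<^esub> \<odot>\<^bsub>free_lmod R n\<^esub> w 0) = \<zero>\<^bsub>R\<^esub> \<odot>\<^bsub>X\<^esub> p (w 0)"
          using p(1) w[of 0] by (simp add: lmod_hom_def)
        moreover have "p (w 0) \<in> carrier X" using p(2) w by blast
        ultimately show ?case using X.submoduleD(2)[OF B(1)] by simp
      next
        case (Suc k)
        have vk: "v k \<in> carrier R" using vj Suc.prems by simp
        define t where "t = v k \<odot>\<^bsub>free_lmod R n\<^esub> e k"
        have t: "t \<in> carrier (free_lmod R n)"
          using vk by (auto simp: t_def e_def free_lmod_def)
        have "w (Suc k) = w k \<oplus>\<^bsub>free_lmod R n\<^esub> t"
          using vj vk by (auto simp: w_def t_def e_def free_lmod_def fun_eq_iff less_Suc_eq)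
        then have "p (w (Suc k)) = p (w k) \<oplus>\<^bsub>X\<^esub> p t"
          using p(1) w t by (simp add: lmod_hom_def)
        moreover have "p t = v k \<odot>\<^bsub>X\<^esub> p (e k)"
          using p(1) e vk by (simp add: lmod_hom_def t_def)
        moreover have "p (e k) \<in> B" using B(2) Suc.prems by auto
        ultimately show ?case using Suc X.submoduleD(3,4)[OF B(1)] vk by simp
      qed
      then have "p (w n) \<in> B" by blast
      moreover have "w n i = v i" for i
        using v by (cases "i < n") (simp_all add: w_def free_lmod_def PiE_def extensional_def)
      then have "w n = v" by (rule ext)
      ultimately show ?thesis by simp
    qed
    then have "p ` carrier (free_lmod R n) \<subseteq> B" by (rule image_subsetI)
    then show "B = carrier X" using p(2) X.submoduleD(1)[OF B(1)] by simp
  qed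
qed

text \<open>A non-zero element of a division ring is a unit, and a two-sided inverse in
  \<open>End_ring\<close> is an inverse function on the carrier. \<open>h\<close> is first
  restricted, as elements of \<open>End_ring\<close> are extensional.\<close>

lemma brick_endomorphism:
  assumes "brick R X" and h: "h \<in> lmod_hom R X X" and nz: "x \<in> carrier X" "h x \<noteq> \<zero>\<^bsub>X\<^esub>"
  shows "bij_betw h (carrier X) (carrier X)"
proof -
  let ?h = "restrict h (carrier X)" and ?E = "End_ring R X"
  interpret X: lmodule R X
    using assms by (simp add: brick_def finitely_presented_def lmodule_def)
  have "?h \<in> carrier ?E" using h by (auto simp: End_ring_def lmod_hom_def Pi_iff)
  moreover have "?h \<noteq> \<zero>\<^bsub>?E\<^esub>" using nz by (auto simp: End_ring_def fun_eq_iff)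
  ultimately have "?h \<in> Units ?E" using assms(1) by (auto simp: brick_def division_ring_def)
  then obtain g where g: "g \<in> carrier ?E" "compose (carrier X) g ?h = (\<lambda>x\<in>carrier X. x)"
    "compose (carrier X) ?h g = (\<lambda>x\<in>carrier X. x)"
    by (auto simp: Units_def End_ring_def)
  have gh: "g (h x) = x" if "x \<in> carrier X" for x
    using fun_cong[OF g(2), of x] that by (simp add: compose_def)
  have gc: "g x \<in> carrier X" if "x \<in> carrier X" for x
    using g(1) that by (auto simp: End_ring_def lmod_hom_def)
  have hg: "h (g x) = x" if "x \<in> carrier X" for x
    using fun_cong[OF g(3), of x] that gc[OF that] by (simp add: compose_def)
  show ?thesis
    using gh hg gc h by (intro bij_betw_byWitness[where f' = g]) (auto simp: lmod_hom_def)
qed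

section \<open>Filtrations as chains of submodules\<close>

text \<open>\<open>brick_ext R \<X> N A B\<close> says that \<open>B/A\<close> is isomorphic to a module in \<open>\<X>\<close>.\<close>

definition brick_ext ::
  "('r, 's) ring_scheme \<Rightarrow> ('r, 'x) module set \<Rightarrow> ('r, 'm) module \<Rightarrow> 'm set \<Rightarrow> 'm set \<Rightarrow> bool" where
  "brick_ext R \<X> N A B \<longleftrightarrow> (\<exists>X\<in>\<X>. \<exists>u\<in>hom_mod R X N A.
     (\<forall>x\<in>carrier X. u x \<in> A \<longrightarrow> x = \<zero>\<^bsub>X\<^esub>) \<and> B = A <+>\<^bsub>N\<^esub> u ` carrier X)"

text \<open>The set of terms of an \<X>-filtration of \<open>N/A\<close>, pulled back to submodules
  of \<open>N\<close> that contain \<open>A\<close>.\<close>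

definition brick_chain ::
  "('r, 's) ring_scheme \<Rightarrow> ('r, 'x) module set \<Rightarrow> ('r, 'm) module \<Rightarrow> 'm set \<Rightarrow> 'm set set \<Rightarrow> bool" where
  "brick_chain R \<X> N A \<C> \<longleftrightarrow> wchain \<C> \<and> (\<forall>C\<in>\<C>. submodule C R N \<and> A \<subseteq> C) \<and>
     A \<in> \<C> \<and> carrier N \<in> \<C> \<and> (\<forall>C D. covers \<C> C D \<longrightarrow> brick_ext R \<X> N C D)"

definition cofiltered ::
  "('r, 's) ring_scheme \<Rightarrow> ('r, 'x) module set \<Rightarrow> ('r, 'm) module \<Rightarrow> 'm set \<Rightarrow> bool" where
  "cofiltered R \<X> N A \<longleftrightarrow> (\<exists>\<C>. brick_chain R \<X> N A \<C>)"

definition admissible ::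
  "('r, 's) ring_scheme \<Rightarrow> ('r, 'x) module set \<Rightarrow> ('r, 'm) module \<Rightarrow> 'm set \<Rightarrow> bool" where
  "admissible R \<X> N K \<longleftrightarrow> submodule K R N \<and>
     (\<forall>A. cofiltered R \<X> N A \<longrightarrow> cofiltered R \<X> N (A <+>\<^bsub>N\<^esub> K))"

lemma brick_chainD:
  assumes "brick_chain R \<X> N A \<C>"
  shows "wchain \<C>" "C \<in> \<C> \<Longrightarrow> submodule C R N" "C \<in> \<C> \<Longrightarrow> A \<subseteq> C" "A \<in> \<C>" "carrier N \<in> \<C>"
    "covers \<C> C D \<Longrightarrow> brick_ext R \<X> N C D" "\<Inter>\<C> = A"
  using assms by (auto simp: brick_chain_def)

text \<open>The terms above \<open>D\<close> filter \<open>N/D\<close>.\<close>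

lemma cofiltered_tail:
  assumes "brick_chain R \<X> N A \<C>" "D \<in> \<C>" "D \<subseteq> carrier N" shows "cofiltered R \<X> N D"
proof -
  have "brick_chain R \<X> N D {E \<in> \<C>. D \<subseteq> E}"
    using brick_chainD[OF assms(1)] assms(2,3) wchain_tail covers_tail[of \<C> D]
    by (auto simp: brick_chain_def)
  then show ?thesis by (auto simp: cofiltered_def)
qed

locale semibrick_module = lmodule R N
  for R :: "('r, 's) ring_scheme" (structure) and N :: "('r, 'n) module" (structure) +
  fixes \<X> :: "('r, 'x) module set"
  assumes semibrick: "semibrick R \<X>"
begin

lemma brickX: "X \<in> \<X> \<Longrightarrow> brick R X"
  using semibrick by (auto simp: semibrick_def)

lemma lmoduleX: "X \<in> \<X> \<Longrightarrow> lmodule R X"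
  using brickX by (auto simp: brick_def finitely_presented_def lmodule_def)

lemma cofiltered_submodule: "cofiltered R \<X> N A \<Longrightarrow> submodule A R N"
  by (auto simp: cofiltered_def brick_chain_def)

text \<open>Common pattern of three transports: adding \<open>K\<close>, intersecting with
  \<open>K\<close>, and passing to a quotient. Only factors that do not collapse under
  \<open>\<phi>\<close> have to be identified, hence the premise of strict inclusion in
  \<open>ext\<close>.\<close>

lemma brick_chain_image:
  assumes ch: "brick_chain R \<X> N A \<C>"
    and "\<And>S. S \<subseteq> \<C> \<Longrightarrow> S \<noteq> {} \<Longrightarrow> \<phi> (\<Union>S) = \<Union>(\<phi> ` S)"
    and "\<And>C. C \<in> \<C> \<Longrightarrow> submodule (\<phi> C) R P"
    and "\<phi> (carrier N) = carrier P"
    and ext: "\<And>C D. covers \<C> C D \<Longrightarrow> \<phi> C \<subset> \<phi> D \<Longrightarrow> brick_ext R \<Y> P (\<phi> C) (\<phi> D)"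
  shows "brick_chain R \<Y> P (\<phi> A) (\<phi> ` \<C>)"
proof -
  have w: "wchain (\<phi> ` \<C>)"
    "\<And>D D'. covers (\<phi> ` \<C>) D D' \<Longrightarrow> \<exists>C C'. covers \<C> C C' \<and> D = \<phi> C \<and> D' = \<phi> C'"
    by (rule wchain_image[OF brick_chainD(1)[OF ch] assms(2)]; assumption)+
  have "\<phi> A \<subseteq> \<phi> C" if "C \<in> \<C>" for C
  proof -
    have "\<Union>{A, C} = C" using brick_chainD(3)[OF ch that] by auto
    then show ?thesis using assms(2)[of "{A, C}"] that brick_chainD(4)[OF ch] by auto
  qed
  moreover have "brick_ext R \<Y> P D D'" if cov: "covers (\<phi> ` \<C>) D D'" for D D'
  proof -
    obtain C C' where C: "covers \<C> C C'" "D = \<phi> C" "D' = \<phi> C'" using w(2)[OF cov] by blast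
    moreover have "D \<subset> D'" using cov by (simp add: covers_def)
    ultimately show ?thesis using ext by simp
  qed
  moreover have "carrier P \<in> \<phi> ` \<C>" using assms(4) brick_chainD(5)[OF ch] by (metis imageI)
  ultimately show ?thesis unfolding brick_chain_def
    using w(1) assms(3) brick_chainD(4)[OF ch] by auto
qed

text \<open>In the first alternative the factor \<open>D/C\<close> survives adding \<open>K\<close>
  and disappears on intersecting with \<open>K\<close>; in the second it is the other way
  round.\<close>

definition compatible :: "'n set set \<Rightarrow> 'n set \<Rightarrow> bool" where
  "compatible \<C> K \<longleftrightarrow> (\<forall>C D. covers \<C> C D \<longrightarrow> K \<inter> D \<subseteq> C \<or> D \<subseteq> C <+>\<^bsub>N\<^esub> K)"

text \<open>A surviving factor keeps its brick and its lift \<open>u\<close>: if \<open>u x\<close>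
  is congruent modulo \<open>C\<close> to some \<open>k\<close> in \<open>K\<close>, then
  \<open>k\<close> lies in \<open>K \<inter> D\<close>, hence in \<open>C\<close>, so
  \<open>u\<close> stays injective modulo \<open>C + K\<close>.\<close>

lemma cofiltered_add_compatible:
  assumes ch: "brick_chain R \<X> N A \<C>" and K: "submodule K R N" and comp: "compatible \<C> K"
  shows "cofiltered R \<X> N (A <+>\<^bsub>N\<^esub> K)"
proof -
  note Kc = submoduleD(1)[OF K]
  have "brick_chain R \<X> N (A <+>\<^bsub>N\<^esub> K) ((\<lambda>C. C <+>\<^bsub>N\<^esub> K) ` \<C>)"
  proof (rule brick_chain_image[OF ch])
    show "\<Union>S <+>\<^bsub>N\<^esub> K = (\<Union>C\<in>S. C <+>\<^bsub>N\<^esub> K)" for S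
      unfolding set_add_def' by blast
    show "submodule (C <+>\<^bsub>N\<^esub> K) R N" if "C \<in> \<C>" for C
      using submodule_set_add brick_chainD(2)[OF ch that] K by blast
    show "carrier N <+>\<^bsub>N\<^esub> K = carrier N"
      using set_add_least[OF submodule_carrier subset_refl Kc]
        set_add_upper1[OF submodule_carrier submoduleD(2)[OF K]] by blast
    fix C D assume cov: "covers \<C> C D" and less: "C <+>\<^bsub>N\<^esub> K \<subset> D <+>\<^bsub>N\<^esub> K"
    have CD: "submodule C R N" "submodule D R N" "C \<subset> D"
      using cov brick_chainD(2)[OF ch] by (auto simp: covers_def)
    note CK = submodule_set_add[OF CD(1) K]
    have "\<not> D \<subseteq> C <+>\<^bsub>N\<^esub> K"
      using less set_add_least[OF CK _ set_add_upper2[OF CD(1) Kc]] by blast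
    then have KD: "K \<inter> D \<subseteq> C" using comp cov by (auto simp: compatible_def)
    obtain X u where X: "X \<in> \<X>" and u: "u \<in> hom_mod R X N C"
      and inj: "\<And>x. x \<in> carrier X \<Longrightarrow> u x \<in> C \<Longrightarrow> x = \<zero>\<^bsub>X\<^esub>" and D: "D = C <+>\<^bsub>N\<^esub> u ` carrier X"
      using brick_chainD(6)[OF ch cov] by (auto simp: brick_ext_def)
    have uc: "u ` carrier X \<subseteq> carrier N" using hom_modD(1)[OF u] by auto
    have uD: "u x \<in> D" if "x \<in> carrier X" for x
      unfolding D using set_add_upper2[OF CD(1) uc] that by auto
    have "x = \<zero>\<^bsub>X\<^esub>" if x: "x \<in> carrier X" "u x \<in> C <+>\<^bsub>N\<^esub> K" for x
    proof -
      obtain k where k: "k \<in> K" "cong_mod N C (u x) k"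
        using x(2) mem_set_add_iff[OF CD(1) Kc] by blast
      then have "k \<in> D" using cong_mod_mem'[OF CD(1,2)] uD[OF x(1)] CD(3) by blast
      then have "k \<in> C" using k KD by auto
      then show ?thesis using inj[OF x(1)] cong_mod_mem[OF CD(1) k(2)] by blast
    qed
    moreover have "u \<in> hom_mod R X N (C <+>\<^bsub>N\<^esub> K)"
      using hom_mod_mono[OF u set_add_upper1[OF CD(1) submoduleD(2)[OF K]]] .
    moreover have "D <+>\<^bsub>N\<^esub> K = (C <+>\<^bsub>N\<^esub> K) <+>\<^bsub>N\<^esub> u ` carrier X"
      unfolding D using set_add_assoc[OF submoduleD(1)[OF CD(1)]] set_add_commute[OF uc Kc] uc Kc by simp
    ultimately show "brick_ext R \<X> N (C <+>\<^bsub>N\<^esub> K) (D <+>\<^bsub>N\<^esub> K)"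
      using X unfolding brick_ext_def by blast
  qed
  then show ?thesis by (auto simp: cofiltered_def)
qed

text \<open>For a surviving factor \<open>D\<close> is contained in \<open>C + K\<close>, and then
  the quotient of \<open>K \<inter> D\<close> by \<open>K \<inter> C\<close> is isomorphic to
  \<open>D/C\<close> by the second isomorphism theorem.\<close>

lemma cofiltered_Int_compatible:
  assumes ch: "brick_chain R \<X> N A \<C>" and K: "submodule K R N" and comp: "compatible \<C> K"
  shows "cofiltered R \<X> (N\<lparr>carrier := K\<rparr>) (K \<inter> A)"
proof -
  note Kc = submoduleD(1)[OF K]
  let ?P = "N\<lparr>carrier := K\<rparr>"
  interpret P: lmodule R ?P by (rule lmodule_submodule[OF K])
  have "brick_chain R \<X> ?P (K \<inter> A) ((\<inter>) K ` \<C>)"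
  proof (rule brick_chain_image[OF ch])
    show "K \<inter> \<Union>S = \<Union>((\<inter>) K ` S)" for S by auto
    show "submodule (K \<inter> C) R ?P" if "C \<in> \<C>" for C
      using submodule_of_submodule[OF K] submodule_Int[OF K brick_chainD(2)[OF ch that]] by auto
    show "K \<inter> carrier N = carrier ?P" using Kc by auto
    fix C D assume cov: "covers \<C> C D" and less: "K \<inter> C \<subset> K \<inter> D"
    have CD: "submodule C R N" "submodule D R N" "C \<subset> D"
      using cov brick_chainD(2)[OF ch] by (auto simp: covers_def)
    have DK: "D \<subseteq> C <+>\<^bsub>N\<^esub> K" using less comp cov unfolding compatible_def by blast
    obtain X u where X: "X \<in> \<X>" and u: "u \<in> hom_mod R X N C"
      and inj: "\<And>x. x \<in> carrier X \<Longrightarrow> u x \<in> C \<Longrightarrow> x = \<zero>\<^bsub>X\<^esub>" and D: "D = C <+>\<^bsub>N\<^esub> u ` carrier X"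
      using brick_chainD(6)[OF ch cov] by (auto simp: brick_ext_def)
    interpret X: lmodule R X by (rule lmoduleX[OF X])
    have uc: "u ` carrier X \<subseteq> carrier N" using hom_modD(1)[OF u] by auto
    have uD: "u x \<in> D" if "x \<in> carrier X" for x
      unfolding D using set_add_upper2[OF CD(1) uc] that by auto
    \<comment> \<open>The lift is corrected by elements of \<open>C\<close> so that its values lie
      in \<open>K\<close>. The result \<open>v\<close> induces the same map into
      \<open>D/C\<close>.\<close>
    have "\<exists>k\<in>K. cong_mod N C (u x) k" if "x \<in> carrier X" for x
      using uD[OF that] DK mem_set_add_iff[OF CD(1) Kc] by blast
    then obtain v where v: "\<And>x. x \<in> carrier X \<Longrightarrow> v x \<in> K \<and> cong_mod N C (u x) (v x)" by metis
    then have vK: "v x \<in> K" and uv: "cong_mod N C (u x) (v x)" and vu: "cong_mod N C (v x) (u x)"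
      if "x \<in> carrier X" for x using that cong_mod_sym[OF CD(1)] by blast+
    \<comment> \<open>The difference of two elements of \<open>K\<close> lies in \<open>K\<close>,
      so a congruence modulo \<open>C\<close> between them holds modulo
      \<open>K \<inter> C\<close>.\<close>
    have vC: "cong_mod ?P (K \<inter> C) a b" if "a \<in> K" "b \<in> K" "cong_mod N C a b" for a b
      using that cong_mod_Int[OF K CD(1)] cong_mod_if_mem[OF K] by (simp add: cong_mod_carrier_update[OF Kc])
    have "v \<in> hom_mod R X ?P (K \<inter> C)"
      unfolding hom_mod_def mem_Collect_eq
    proof (intro conjI ballI)
      show "v \<in> carrier X \<rightarrow> carrier ?P" using vK by auto
    next
      fix x y assume xy: "x \<in> carrier X" "y \<in> carrier X"
      have "cong_mod N C (v (x \<oplus>\<^bsub>X\<^esub> y)) (u x \<oplus>\<^bsub>N\<^esub> u y)"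
        using cong_mod_trans[OF CD(1) vu hom_modD(2)[OF u xy]] xy by simp
      then have "cong_mod N C (v (x \<oplus>\<^bsub>X\<^esub> y)) (v x \<oplus>\<^bsub>N\<^esub> v y)"
        using cong_mod_trans[OF CD(1) _ cong_mod_add[OF CD(1) uv[OF xy(1)] uv[OF xy(2)]]] by blast
      then show "cong_mod ?P (K \<inter> C) (v (x \<oplus>\<^bsub>X\<^esub> y)) (v x \<oplus>\<^bsub>?P\<^esub> v y)"
        using vC vK xy submoduleD(3)[OF K] by simp
    next
      fix a x assume ax: "a \<in> carrier R" "x \<in> carrier X"
      have "cong_mod N C (v (a \<odot>\<^bsub>X\<^esub> x)) (a \<odot>\<^bsub>N\<^esub> u x)"
        using cong_mod_trans[OF CD(1) vu hom_modD(3)[OF u ax]] ax by simp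
      then have "cong_mod N C (v (a \<odot>\<^bsub>X\<^esub> x)) (a \<odot>\<^bsub>N\<^esub> v x)"
        using cong_mod_trans[OF CD(1) _ cong_mod_smult[OF CD(1) uv[OF ax(2)] ax(1)]] by blast
      then show "cong_mod ?P (K \<inter> C) (v (a \<odot>\<^bsub>X\<^esub> x)) (a \<odot>\<^bsub>?P\<^esub> v x)"
        using vC vK ax submoduleD(4)[OF K] by simp
    qed
    moreover have "x = \<zero>\<^bsub>X\<^esub>" if "x \<in> carrier X" "v x \<in> K \<inter> C" for x
      using inj[OF that(1)] cong_mod_mem[OF CD(1) uv[OF that(1)]] that(2) by blast
    moreover have "K \<inter> D = (K \<inter> C) <+>\<^bsub>?P\<^esub> v ` carrier X"
    proof -
      have sKC: "submodule (K \<inter> C) R ?P"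
        using submodule_of_submodule[OF K] submodule_Int[OF K CD(1)] by auto
      have vc: "v ` carrier X \<subseteq> carrier ?P" using vK by auto
      have "y \<in> K \<inter> D \<longleftrightarrow> (\<exists>k\<in>v ` carrier X. cong_mod ?P (K \<inter> C) y k)" for y
      proof
        assume y: "y \<in> K \<inter> D"
        then obtain x where x: "x \<in> carrier X" "cong_mod N C y (u x)"
          using mem_set_add_iff[OF CD(1) uc] unfolding D by blast
        then have "cong_mod N C y (v x)" using cong_mod_trans[OF CD(1) _ uv] by blast
        then show "\<exists>k\<in>v ` carrier X. cong_mod ?P (K \<inter> C) y k" using vC vK x y by blast
      next
        assume "\<exists>k\<in>v ` carrier X. cong_mod ?P (K \<inter> C) y k"
        then obtain x where x: "x \<in> carrier X" "y \<in> K" "cong_mod N (K \<inter> C) y (v x)"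
          by (auto simp: cong_mod_carrier_update[OF Kc])
        then have "cong_mod N C y (u x)"
          using cong_mod_trans[OF CD(1) cong_mod_mono vu] by blast
        then show "y \<in> K \<inter> D" using mem_set_add_iff[OF CD(1) uc] x unfolding D by blast
      qed
      then show ?thesis using P.mem_set_add_iff[OF sKC vc] by blast
    qed
    ultimately show "brick_ext R \<X> ?P (K \<inter> C) (K \<inter> D)"
      using X unfolding brick_ext_def by blast
  qed
  then show ?thesis by (auto simp: cofiltered_def)
qed

text \<open>Take the covering pair \<open>C\<close>, \<open>D\<close> with \<open>D\<close> the
  least term containing \<open>u(X)\<close>. Reading \<open>u\<close> modulo \<open>C\<close> gives
  a non-zero map from \<open>X\<close> to the brick of the factor \<open>D/C\<close>, hence an
  isomorphism. So \<open>A + u(X)\<close> is a complement of \<open>C\<close> in \<open>D\<close>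
  modulo \<open>A\<close>, and adding it to the chain deletes \<open>D/C\<close> and nothing
  else.\<close>

lemma hom_mod_dichotomy:
  assumes cof: "cofiltered R \<X> N A" and X: "X \<in> \<X>" and u: "u \<in> hom_mod R X N A"
    and nz: "\<not> u ` carrier X \<subseteq> A"
  shows "\<And>x. x \<in> carrier X \<Longrightarrow> u x \<in> A \<Longrightarrow> x = \<zero>\<^bsub>X\<^esub>"
    and "cofiltered R \<X> N (A <+>\<^bsub>N\<^esub> u ` carrier X)"
proof -
  obtain \<C> where ch: "brick_chain R \<X> N A \<C>" using cof by (auto simp: cofiltered_def)
  note w = brick_chainD(1)[OF ch] and sub = brick_chainD(2)[OF ch] and AC = brick_chainD(3)[OF ch]
  note sA = sub[OF brick_chainD(4)[OF ch]]
  interpret X: lmodule R X by (rule lmoduleX[OF X])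
  have uc: "u ` carrier X \<subseteq> carrier N" using hom_modD(1)[OF u] by auto
  obtain E where E: "finite E" "E \<subseteq> carrier X" "\<And>B. submodule B R X \<Longrightarrow> E \<subseteq> B \<Longrightarrow> B = carrier X"
    using finitely_presented_imp_finitely_generated brickX[OF X] unfolding brick_def by metis
  define T where "T = {C \<in> \<C>. u ` carrier X \<subseteq> C}"
  have T: "T \<subseteq> \<C>" "T \<noteq> {}" using brick_chainD(5)[OF ch] uc by (auto simp: T_def)
  define D where "D = \<Inter>T"
  have "D \<in> T" unfolding D_def by (rule wchainD(1)[OF w T])
  then have D: "D \<in> \<C>" "u ` carrier X \<subseteq> D" by (auto simp: T_def)
  have least: "\<not> u ` carrier X \<subseteq> C" if "C \<in> \<C>" "C \<subset> D" for C
    using that by (auto simp: D_def T_def)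
  from w D(1) obtain C where cov: "covers \<C> C D"
  proof (cases rule: wchain_cases)
    case bot
    then show ?thesis using brick_chainD(7)[OF ch] D(2) nz by simp
  next
    case (lim S)
    \<comment> \<open>A limit term is excluded: finitely many generators have their values in one
      \<open>B\<close> of the linearly ordered \<open>S\<close>, so all of \<open>u(X)\<close> lies
      in \<open>B\<close>, against the minimality of \<open>D\<close>.\<close>
    have "\<exists>B\<in>S. u ` F \<subseteq> B" if "finite F" "F \<subseteq> carrier X" for F
      using that
    proof (induction F rule: finite_induct)
      case empty
      then show ?case using lim(2) by auto
    next
      case (insert e F)
      then obtain B where B: "B \<in> S" "u ` F \<subseteq> B" by auto
      obtain B' where B': "B' \<in> S" "u e \<in> B'" using insert.prems D(2) lim(3) by auto
      have "B \<subseteq> B' \<or> B' \<subseteq> B" using wchain_linear[OF w] B(1) B'(1) lim(1) by blast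
      then show ?case using B B' by blast
    qed
    from this[OF E(1,2)] obtain B where B: "B \<in> S" "u ` E \<subseteq> B" by auto
    then have BC: "B \<in> \<C>" using lim(1) by auto
    have "{x \<in> carrier X. u x \<in> B} = carrier X"
      by (rule E(3)[OF submodule_hom_mod_vimage[OF X.lmodule_axioms sA u sub[OF BC] AC[OF BC]]])
        (use B E in auto)
    then have "u ` carrier X \<subseteq> B" by auto
    then show ?thesis using least[OF BC] lim(4)[OF B(1)] by simp
  qed
  have C: "C \<in> \<C>" "C \<subset> D" using cov by (auto simp: covers_def)
  note sC = sub[OF C(1)] and sD = sub[OF D(1)]
  have u': "u \<in> hom_mod R X N C" by (rule hom_mod_mono[OF u AC[OF C(1)]])
  obtain Y v where Y: "Y \<in> \<X>" and v: "v \<in> hom_mod R Y N C"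
    and vinj: "\<And>x. x \<in> carrier Y \<Longrightarrow> v x \<in> C \<Longrightarrow> x = \<zero>\<^bsub>Y\<^esub>" and Dv: "D = C <+>\<^bsub>N\<^esub> v ` carrier Y"
    using brick_chainD(6)[OF ch cov] by (auto simp: brick_ext_def)
  interpret Y: lmodule R Y by (rule lmoduleX[OF Y])
  have vc: "v ` carrier Y \<subseteq> carrier N" using hom_modD(1)[OF v] by auto
  \<comment> \<open>\<open>\<theta>\<close> is \<open>u\<close> modulo \<open>C\<close> followed by
    the inverse of the isomorphism from \<open>Y\<close> to \<open>D/C\<close> induced by
    \<open>v\<close>. Injectivity of \<open>v\<close> modulo \<open>C\<close> makes its values
    unique, and additivity and linearity follow from uniqueness.\<close>
  have "\<exists>y\<in>carrier Y. cong_mod N C (u x) (v y)" if "x \<in> carrier X" for x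
    using D(2) that mem_set_add_iff[OF sC vc] unfolding Dv by blast
  then obtain \<theta> where \<theta>: "\<And>x. x \<in> carrier X \<Longrightarrow> \<theta> x \<in> carrier Y \<and> cong_mod N C (u x) (v (\<theta> x))"
    by metis
  then have \<theta>Y: "\<And>x. x \<in> carrier X \<Longrightarrow> \<theta> x \<in> carrier Y"
    and u\<theta>: "\<And>x. x \<in> carrier X \<Longrightarrow> cong_mod N C (u x) (v (\<theta> x))" by blast+
  have eq: "\<theta> x = y" if "x \<in> carrier X" "y \<in> carrier Y" "cong_mod N C (u x) (v y)" for x y
    using hom_mod_injD[OF Y.lmodule_axioms sC v vinj \<theta>Y[OF that(1)] that(2)]
      cong_mod_trans[OF sC cong_mod_sym[OF sC u\<theta>[OF that(1)]] that(3)] by blast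
  have hom: "\<theta> \<in> lmod_hom R X Y"
    unfolding lmod_hom_def mem_Collect_eq
  proof (intro conjI ballI)
    show "\<theta> \<in> carrier X \<rightarrow> carrier Y" using \<theta>Y by auto
  next
    fix x y assume xy: "x \<in> carrier X" "y \<in> carrier X"
    have "cong_mod N C (u (x \<oplus>\<^bsub>X\<^esub> y)) (v (\<theta> x) \<oplus>\<^bsub>N\<^esub> v (\<theta> y))"
      by (rule cong_mod_trans[OF sC hom_modD(2)[OF u' xy] cong_mod_add[OF sC u\<theta>[OF xy(1)] u\<theta>[OF xy(2)]]])
    then have "cong_mod N C (u (x \<oplus>\<^bsub>X\<^esub> y)) (v (\<theta> x \<oplus>\<^bsub>Y\<^esub> \<theta> y))"
      using cong_mod_trans[OF sC _ cong_mod_sym[OF sC hom_modD(2)[OF v \<theta>Y[OF xy(1)] \<theta>Y[OF xy(2)]]]] by blast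
    then show "\<theta> (x \<oplus>\<^bsub>X\<^esub> y) = \<theta> x \<oplus>\<^bsub>Y\<^esub> \<theta> y" using eq xy \<theta>Y by simp
  next
    fix a x assume ax: "a \<in> carrier R" "x \<in> carrier X"
    have "cong_mod N C (u (a \<odot>\<^bsub>X\<^esub> x)) (a \<odot>\<^bsub>N\<^esub> v (\<theta> x))"
      by (rule cong_mod_trans[OF sC hom_modD(3)[OF u' ax] cong_mod_smult[OF sC u\<theta>[OF ax(2)] ax(1)]])
    then have "cong_mod N C (u (a \<odot>\<^bsub>X\<^esub> x)) (v (a \<odot>\<^bsub>Y\<^esub> \<theta> x))"
      using cong_mod_trans[OF sC _ cong_mod_sym[OF sC hom_modD(3)[OF v ax(1) \<theta>Y[OF ax(2)]]]] by blast
    then show "\<theta> (a \<odot>\<^bsub>X\<^esub> x) = a \<odot>\<^bsub>Y\<^esub> \<theta> x" using eq ax \<theta>Y by simp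
  qed
  \<comment> \<open>Minimality of \<open>D\<close> keeps \<open>u(X)\<close> out of
    \<open>C\<close>, so \<open>\<theta>\<close> is non-zero. Orthogonality then forces
    \<open>Y = X\<close>, and the brick property makes \<open>\<theta>\<close> bijective.\<close>
  obtain z where z: "z \<in> carrier X" "u z \<notin> C" using least[OF C] by auto
  have "\<theta> z \<noteq> \<zero>\<^bsub>Y\<^esub>"
    using z(2) cong_mod_mem[OF sC u\<theta>[OF z(1)]] hom_mod_zero[OF Y.lmodule_axioms sC v] by auto
  moreover have "\<theta> z = \<zero>\<^bsub>Y\<^esub>" if "X \<noteq> Y"
    using semibrick X Y that hom z(1) by (simp add: semibrick_def)
  ultimately have YX: "Y = X" by blast
  have hom': "\<theta> \<in> lmod_hom R X X" and nz': "\<theta> z \<noteq> \<zero>\<^bsub>X\<^esub>" using hom \<open>\<theta> z \<noteq> \<zero>\<^bsub>Y\<^esub>\<close> YX by simp_all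
  have bij: "bij_betw \<theta> (carrier X) (carrier X)"
    by (rule brick_endomorphism[OF brickX[OF X] hom' z(1) nz'])
  have "\<theta> \<zero>\<^bsub>X\<^esub> = \<zero>\<^bsub>X\<^esub>"
    by (rule lmod_hom_zero[OF X.lmodule_axioms X.lmodule_axioms hom'])
  have injC: "x = \<zero>\<^bsub>X\<^esub>" if x: "x \<in> carrier X" "u x \<in> C" for x
  proof -
    have "v (\<theta> x) \<in> C" using cong_mod_mem'[OF sC sC u\<theta>[OF x(1)]] x(2) by blast
    then have "\<theta> x = \<theta> \<zero>\<^bsub>X\<^esub>" using vinj \<theta>Y x(1) \<open>\<theta> \<zero>\<^bsub>X\<^esub> = \<zero>\<^bsub>X\<^esub>\<close> YX by simp
    then show ?thesis using bij x(1) by (auto simp: bij_betw_def inj_on_def)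
  qed
  then show "\<And>x. x \<in> carrier X \<Longrightarrow> u x \<in> A \<Longrightarrow> x = \<zero>\<^bsub>X\<^esub>" using AC[OF C(1)] by blast
  let ?K = "A <+>\<^bsub>N\<^esub> u ` carrier X"
  have sK: "submodule ?K R N" by (rule submodule_hom_mod_image[OF X.lmodule_axioms sA u])
  have KD: "?K \<subseteq> D" by (rule set_add_least[OF sD AC[OF D(1)] D(2)])
  \<comment> \<open>\<open>KC\<close> and \<open>DK\<close> together state that
    \<open>A + u(X)\<close> is a complement of \<open>C\<close> in \<open>D\<close> modulo
    \<open>A\<close>.\<close>
  have KC: "?K \<inter> C \<subseteq> A"
  proof
    fix y assume y: "y \<in> ?K \<inter> C"
    then obtain x where x: "x \<in> carrier X" "cong_mod N A y (u x)"
      using mem_set_add_iff[OF sA uc] by blast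
    then have "u x \<in> C" using cong_mod_mem'[OF sA sC _ AC[OF C(1)]] y by blast
    then have "x = \<zero>\<^bsub>X\<^esub>" using injC x by simp
    then show "y \<in> A" using hom_mod_zero[OF X.lmodule_axioms sA u] cong_mod_mem[OF sA x(2)] by auto
  qed
  have DK: "D \<subseteq> C <+>\<^bsub>N\<^esub> ?K"
  proof
    fix y assume "y \<in> D"
    then obtain t where t: "t \<in> carrier X" "cong_mod N C y (v t)"
      using mem_set_add_iff[OF sC vc] unfolding Dv YX by blast
    then have "t \<in> \<theta> ` carrier X" using bij_betw_imp_surj_on[OF bij] by simp
    then obtain x where x: "x \<in> carrier X" "\<theta> x = t" by blast
    then have "cong_mod N C y (u x)"
      using cong_mod_trans[OF sC t(2) cong_mod_sym[OF sC]] u\<theta> by blast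
    moreover have "u x \<in> ?K" using set_add_upper2[OF sA uc] x(1) by auto
    ultimately show "y \<in> C <+>\<^bsub>N\<^esub> ?K" using mem_set_add_iff[OF sC submoduleD(1)[OF sK]] by blast
  qed
  have "?K \<inter> D' \<subseteq> C' \<or> D' \<subseteq> C' <+>\<^bsub>N\<^esub> ?K" if c: "covers \<C> C' D'" for C' D'
  proof -
    have C': "C' \<in> \<C>" "D' \<in> \<C>" using c by (auto simp: covers_def)
    \<comment> \<open>Factors below \<open>C\<close> are met trivially by \<open>KC\<close>, factors
      above \<open>D\<close> because they start with a term containing \<open>A + u(X)\<close>. Only
      \<open>D/C\<close> itself is covered.\<close>
    consider "D' \<subseteq> C" | "C' = C" | "D \<subseteq> C'"
      using wchain_linear[OF w C'(1) C(1)] c cov C' unfolding covers_def by blast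
    then show ?thesis
    proof cases
      case 1
      then show ?thesis using KC AC[OF C'(1)] by blast
    next
      case 2
      then have "D' \<subseteq> D" using c C(2) D(1) by (auto simp: covers_def)
      then show ?thesis using DK 2 by blast
    next
      case 3
      then show ?thesis using KD by blast
    qed
  qed
  then have "compatible \<C> ?K" by (auto simp: compatible_def)
  moreover have "A <+>\<^bsub>N\<^esub> ?K = ?K"
  proof (rule set_add_absorb[OF sA sK])
    show "A \<subseteq> ?K"
      using mem_set_add_iff[OF sA uc] cong_mod_if_mem[OF sA _ hom_mod_zero[OF X.lmodule_axioms sA u]]
        X.M.zero_closed by blast
  qed
  ultimately show "cofiltered R \<X> N ?K" using cofiltered_add_compatible[OF ch sK] by simp
qed

end

section \<open>Admissible submodules\<close>

text \<open>\<open>socle_hull R \<X> N A\<close> is the preimage in \<open>N\<close> of the \<open>\<X>\<close>-socle of \<open>N/A\<close>.\<close>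

definition socle_hull ::
  "('r, 's) ring_scheme \<Rightarrow> ('r, 'x) module set \<Rightarrow> ('r, 'm) module \<Rightarrow> 'm set \<Rightarrow> 'm set" where
  "socle_hull R \<X> N A = \<Inter>{B. submodule B R N \<and> A \<subseteq> B \<and>
     (\<forall>X\<in>\<X>. \<forall>u\<in>hom_mod R X N A. u ` carrier X \<subseteq> B)}"

context semibrick_module
begin

text \<open>\<open>set_add_upper1\<close> asks for zero in the second summand, but a lift need not
  take the value zero. It is enough that it sends zero into \<open>A\<close>.\<close>

lemma set_add_hom_mod_upper:
  assumes "X \<in> \<X>" "submodule A R N" "u \<in> hom_mod R X N A"
  shows "A \<subseteq> A <+>\<^bsub>N\<^esub> u ` carrier X" "u ` carrier X \<subseteq> A <+>\<^bsub>N\<^esub> u ` carrier X"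
proof -
  interpret X: lmodule R X by (rule lmoduleX[OF assms(1)])
  have uc: "u ` carrier X \<subseteq> carrier N" using hom_modD(1)[OF assms(3)] by auto
  show "A \<subseteq> A <+>\<^bsub>N\<^esub> u ` carrier X"
    using mem_set_add_iff[OF assms(2) uc] X.M.zero_closed
      cong_mod_if_mem[OF assms(2) _ hom_mod_zero[OF X.lmodule_axioms assms(2,3)]] by blast
  show "u ` carrier X \<subseteq> A <+>\<^bsub>N\<^esub> u ` carrier X" by (rule set_add_upper2[OF assms(2) uc])
qed

section \<open>Closure properties of admissibility\<close>

lemma admissible_submodule: "admissible R \<X> N K \<Longrightarrow> submodule K R N"
  by (simp add: admissible_def)

lemma admissibleD:
  "admissible R \<X> N K \<Longrightarrow> cofiltered R \<X> N A \<Longrightarrow> cofiltered R \<X> N (A <+>\<^bsub>N\<^esub> K)"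
  by (simp add: admissible_def)

lemma admissible_zero: "admissible R \<X> N {\<zero>\<^bsub>N\<^esub>}"
proof -
  have "A <+>\<^bsub>N\<^esub> {\<zero>\<^bsub>N\<^esub>} = A" if "cofiltered R \<X> N A" for A
    using zero_set_add set_add_commute submoduleD(1)[OF cofiltered_submodule[OF that]]
      submoduleD(1)[OF submodule_zero] by simp
  then show ?thesis using submodule_zero by (simp add: admissible_def)
qed

lemma admissible_add:
  assumes "admissible R \<X> N K" "admissible R \<X> N L" shows "admissible R \<X> N (K <+>\<^bsub>N\<^esub> L)"
proof -
  note s = admissible_submodule[OF assms(1)] admissible_submodule[OF assms(2)]
  have "cofiltered R \<X> N (A <+>\<^bsub>N\<^esub> (K <+>\<^bsub>N\<^esub> L))" if A: "cofiltered R \<X> N A" for A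
    using admissibleD[OF assms(2) admissibleD[OF assms(1) A]]
      set_add_assoc[OF submoduleD(1)[OF cofiltered_submodule[OF A]] submoduleD(1)[OF s(1)] submoduleD(1)[OF s(2)]]
    by simp
  then show ?thesis using submodule_set_add[OF s] by (simp add: admissible_def)
qed

text \<open>The same lift \<open>u\<close> is read modulo \<open>A + K\<close>. Either its image is
  absorbed there and nothing changes, or the dichotomy applies.\<close>

lemma admissible_hom_mod:
  assumes K: "admissible R \<X> N K" and X: "X \<in> \<X>" and u: "u \<in> hom_mod R X N K"
  shows "admissible R \<X> N (K <+>\<^bsub>N\<^esub> u ` carrier X)"
proof -
  note sK = admissible_submodule[OF K]
  have uc: "u ` carrier X \<subseteq> carrier N" using hom_modD(1)[OF u] by auto
  have sKu: "submodule (K <+>\<^bsub>N\<^esub> u ` carrier X) R N"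
    by (rule submodule_hom_mod_image[OF lmoduleX[OF X] sK u])
  have "cofiltered R \<X> N (A <+>\<^bsub>N\<^esub> (K <+>\<^bsub>N\<^esub> u ` carrier X))" if A: "cofiltered R \<X> N A" for A
  proof -
    note sA = cofiltered_submodule[OF A]
    let ?B = "A <+>\<^bsub>N\<^esub> K"
    have B: "cofiltered R \<X> N ?B" by (rule admissibleD[OF K A])
    note sB = cofiltered_submodule[OF B]
    have uB: "u \<in> hom_mod R X N ?B"
      by (rule hom_mod_mono[OF u set_add_upper2[OF sA submoduleD(1)[OF sK]]])
    have "cofiltered R \<X> N (?B <+>\<^bsub>N\<^esub> u ` carrier X)"
    proof (cases "u ` carrier X \<subseteq> ?B")
      case True
      then have "?B <+>\<^bsub>N\<^esub> u ` carrier X \<subseteq> ?B" using set_add_least[OF sB] by blast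
      moreover have "?B \<subseteq> ?B <+>\<^bsub>N\<^esub> u ` carrier X" by (rule set_add_hom_mod_upper(1)[OF X sB uB])
      ultimately show ?thesis using B by simp
    next
      case False
      then show ?thesis using hom_mod_dichotomy(2)[OF B X uB] by blast
    qed
    then show ?thesis
      using set_add_assoc[OF submoduleD(1)[OF sA] submoduleD(1)[OF sK] uc] by simp
  qed
  then show ?thesis using sKu by (simp add: admissible_def)
qed

text \<open>The lift \<open>u\<close> defining \<open>D/C\<close> is read modulo
  \<open>C + K\<close>. If it vanishes there, \<open>K\<close> covers the factor; if it is injective
  there, \<open>K\<close> meets the factor trivially.\<close>

lemma brick_ext_dichotomy:
  assumes ext: "brick_ext R \<X> N C D" and C: "submodule C R N" and K: "submodule K R N"
    and cof: "cofiltered R \<X> N (C <+>\<^bsub>N\<^esub> K)"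
  shows "K \<inter> D \<subseteq> C \<or> D \<subseteq> C <+>\<^bsub>N\<^esub> K"
proof -
  note Kc = submoduleD(1)[OF K]
  obtain X u where X: "X \<in> \<X>" and u: "u \<in> hom_mod R X N C" and D: "D = C <+>\<^bsub>N\<^esub> u ` carrier X"
    using ext by (auto simp: brick_ext_def)
  note CK = set_add_upper1[OF C submoduleD(2)[OF K]] and sCK = cofiltered_submodule[OF cof]
  have uc: "u ` carrier X \<subseteq> carrier N" using hom_modD(1)[OF u] by auto
  show ?thesis
  proof (cases "u ` carrier X \<subseteq> C <+>\<^bsub>N\<^esub> K")
    case True
    then show ?thesis unfolding D using set_add_least[OF sCK CK] by blast
  next
    case False
    note inj = hom_mod_dichotomy(1)[OF cof X hom_mod_mono[OF u CK] False]
    have "k \<in> C" if k: "k \<in> K" "k \<in> D" for k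
    proof -
      obtain x where x: "x \<in> carrier X" "cong_mod N C k (u x)"
        using k(2) mem_set_add_iff[OF C uc] unfolding D by blast
      then have "u x \<in> C <+>\<^bsub>N\<^esub> K"
        using mem_set_add_iff[OF C Kc] cong_mod_sym[OF C x(2)] k(1) by blast
      then have "x = \<zero>\<^bsub>X\<^esub>" using inj x(1) by blast
      then show ?thesis using hom_mod_zero[OF lmoduleX[OF X] C u] cong_mod_mem[OF C x(2)] by auto
    qed
    then show ?thesis by blast
  qed
qed

text \<open>Every term \<open>C\<close> of the chain is cofiltered by its tail, so admissibility of
  \<open>K\<close> may be used with \<open>C\<close> in place of \<open>A\<close>.\<close>

lemma admissible_compatible:
  assumes ch: "brick_chain R \<X> N A \<C>" and K: "admissible R \<X> N K" shows "compatible \<C> K"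
  unfolding compatible_def
proof (intro allI impI)
  fix C D assume cov: "covers \<C> C D"
  then have C: "C \<in> \<C>" by (simp add: covers_def)
  note sC = brick_chainD(2)[OF ch C]
  show "K \<inter> D \<subseteq> C \<or> D \<subseteq> C <+>\<^bsub>N\<^esub> K"
    by (rule brick_ext_dichotomy[OF brick_chainD(6)[OF ch cov] sC admissible_submodule[OF K]
          admissibleD[OF K cofiltered_tail[OF ch C submoduleD(1)[OF sC]]]])
qed

text \<open>Compatibility survives unions: if one \<open>K\<close> of the chain covers the factor,
  so does the union; otherwise every \<open>K\<close> meets it trivially, and hence the union
  does.\<close>

lemma admissible_Union:
  assumes "S \<noteq> {}" and adm: "\<And>K. K \<in> S \<Longrightarrow> admissible R \<X> N K"
    and lin: "\<And>K L. K \<in> S \<Longrightarrow> L \<in> S \<Longrightarrow> K \<subseteq> L \<or> L \<subseteq> K"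
  shows "admissible R \<X> N (\<Union>S)"
proof -
  have sU: "submodule (\<Union>S) R N"
    by (rule submodule_Union[OF assms(1) admissible_submodule[OF adm] lin])
  have "cofiltered R \<X> N (A <+>\<^bsub>N\<^esub> \<Union>S)" if A: "cofiltered R \<X> N A" for A
  proof -
    obtain \<C> where ch: "brick_chain R \<X> N A \<C>" using A by (auto simp: cofiltered_def)
    have "\<Union>S \<inter> D \<subseteq> C \<or> D \<subseteq> C <+>\<^bsub>N\<^esub> \<Union>S" if cov: "covers \<C> C D" for C D
    proof (cases "\<exists>K\<in>S. D \<subseteq> C <+>\<^bsub>N\<^esub> K")
      case True
      then obtain K where "K \<in> S" "D \<subseteq> C <+>\<^bsub>N\<^esub> K" by blast
      moreover from this have "C <+>\<^bsub>N\<^esub> K \<subseteq> C <+>\<^bsub>N\<^esub> \<Union>S" unfolding set_add_def' by blast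
      ultimately show ?thesis by blast
    next
      case False
      then have "K \<inter> D \<subseteq> C" if "K \<in> S" for K
        using admissible_compatible[OF ch adm[OF that]] cov that by (auto simp: compatible_def)
      then show ?thesis by blast
    qed
    then have "compatible \<C> (\<Union>S)" by (auto simp: compatible_def)
    then show ?thesis using cofiltered_add_compatible[OF ch sU] by blast
  qed
  then show ?thesis using sU by (simp add: admissible_def)
qed

lemma admissible_image:
  assumes M: "lmodule R M" and cof: "cofiltered R \<X> M {\<zero>\<^bsub>M\<^esub>}" and f: "f \<in> lmod_hom R M N"
  shows "admissible R \<X> N (f ` carrier M)"
proof -
  interpret M': lmodule R M by fact
  obtain \<C> where ch: "brick_chain R \<X> M {\<zero>\<^bsub>M\<^esub>} \<C>" using cof by (auto simp: cofiltered_def)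
  note w = brick_chainD(1)[OF ch] and sub = brick_chainD(2)[OF ch]
  have fc: "f ` carrier M \<subseteq> carrier N" using f by (auto simp: lmod_hom_def)
  from w brick_chainD(5)[OF ch] show ?thesis
  proof (induction rule: wchain_induct)
    case bot
    show ?case
      using admissible_zero lmod_hom_zero[OF M lmodule_axioms f] by (simp add: brick_chainD(7)[OF ch])
  next
    case (succ C D)
    note ext = brick_chainD(6)[OF ch succ(1)]
    have C: "C \<in> \<C>" using succ(1) by (simp add: covers_def)
    note sC = sub[OF C]
    obtain X u where X: "X \<in> \<X>" and u: "u \<in> hom_mod R X M C" and D: "D = C <+>\<^bsub>M\<^esub> u ` carrier X"
      using ext by (auto simp: brick_ext_def)
    have uc: "u ` carrier X \<subseteq> carrier M" using hom_modD(1)[OF u] by auto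
    have "f \<circ> u \<in> hom_mod R X N (f ` C)"
      by (rule hom_mod_comp[OF sC M admissible_submodule[OF succ(2)] u f subset_refl])
    from admissible_hom_mod[OF succ(2) X this]
    have "admissible R \<X> N (f ` C <+>\<^bsub>N\<^esub> (f \<circ> u) ` carrier X)" .
    moreover have "f ` D = f ` C <+>\<^bsub>N\<^esub> (f \<circ> u) ` carrier X"
    proof -
      have hom: "f (c \<oplus>\<^bsub>M\<^esub> u x) = f c \<oplus>\<^bsub>N\<^esub> f (u x)" if "c \<in> C" "x \<in> carrier X" for c x
      proof -
        have "c \<in> carrier M" "u x \<in> carrier M" using that M'.submoduleD(1)[OF sC] uc by auto
        then show ?thesis using f by (simp add: lmod_hom_def)
      qed
      have "f ` D = (\<Union>c\<in>C. \<Union>x\<in>carrier X. {f (c \<oplus>\<^bsub>M\<^esub> u x)})"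
        unfolding D set_add_def' by blast
      also have "\<dots> = (\<Union>c\<in>C. \<Union>x\<in>carrier X. {f c \<oplus>\<^bsub>N\<^esub> f (u x)})"
        using hom by simp
      also have "\<dots> = f ` C <+>\<^bsub>N\<^esub> (f \<circ> u) ` carrier X"
        unfolding set_add_def' comp_def by blast
      finally show ?thesis .
    qed
    ultimately show ?case by simp
  next
    case (lim S)
    have lin: "K \<subseteq> L \<or> L \<subseteq> K" if "K \<in> S" "L \<in> S" for K L
      using wchain_linear[OF w] that lim(1) by blast
    have "admissible R \<X> N (\<Union>((`) f ` S))"
      by (rule admissible_Union) (use lim lin in \<open>blast+\<close>)
    then show ?case by (simp add: image_Union)
  qed
qed

section \<open>Socle hulls\<close>

lemma socle_hull_submodule: "submodule (socle_hull R \<X> N A) R N" if "submodule A R N"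
  unfolding socle_hull_def
proof (rule submodule_Inter)
  have "carrier N \<in> {B. submodule B R N \<and> A \<subseteq> B \<and> (\<forall>X\<in>\<X>. \<forall>u\<in>hom_mod R X N A. u ` carrier X \<subseteq> B)}"
    using submodule_carrier submoduleD(1)[OF that] by (auto simp: hom_mod_def)
  then show "{B. submodule B R N \<and> A \<subseteq> B \<and> (\<forall>X\<in>\<X>. \<forall>u\<in>hom_mod R X N A. u ` carrier X \<subseteq> B)} \<noteq> {}"
    by blast
qed blast

lemma socle_hull_upper: "A \<subseteq> socle_hull R \<X> N A"
  by (auto simp: socle_hull_def)

lemma socle_hull_image:
  "X \<in> \<X> \<Longrightarrow> u \<in> hom_mod R X N A \<Longrightarrow> u ` carrier X \<subseteq> socle_hull R \<X> N A"
  unfolding socle_hull_def by blast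

lemma socle_hull_least:
  assumes "submodule B R N" "A \<subseteq> B" "\<And>X u. X \<in> \<X> \<Longrightarrow> u \<in> hom_mod R X N A \<Longrightarrow> u ` carrier X \<subseteq> B"
  shows "socle_hull R \<X> N A \<subseteq> B"
  using assms unfolding socle_hull_def by blast

text \<open>Zorn's lemma, with \<open>admissible_Union\<close> bounding chains. It is applied with
  \<open>Q\<close> an upper bound on \<open>T\<close> or on \<open>T \<inter> I\<close>, and such
  conditions pass to unions.\<close>

lemma admissible_maximal:
  assumes A: "admissible R \<X> N A" "Q A"
    and Q: "\<And>S. S \<noteq> {} \<Longrightarrow> (\<And>T. T \<in> S \<Longrightarrow> Q T) \<Longrightarrow> Q (\<Union>S)"
  obtains T where "admissible R \<X> N T" "Q T" "A \<subseteq> T"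
    "\<And>T'. admissible R \<X> N T' \<Longrightarrow> Q T' \<Longrightarrow> T \<subseteq> T' \<Longrightarrow> T' = T"
proof -
  let ?F = "{T. admissible R \<X> N T \<and> Q T \<and> A \<subseteq> T}"
  have "\<exists>T\<in>?F. \<forall>T'\<in>?F. T \<subseteq> T' \<longrightarrow> T' = T"
  proof (rule subset_Zorn_nonempty)
    show "?F \<noteq> {}" using A by blast
    fix S assume S: "S \<noteq> {}" "subset.chain ?F S"
    then have "T \<in> ?F" if "T \<in> S" for T using that by (auto simp: subset_chain_def)
    moreover have "T \<subseteq> T' \<or> T' \<subseteq> T" if "T \<in> S" "T' \<in> S" for T T'
      using S(2) that by (auto simp: subset_chain_def)
    ultimately have "admissible R \<X> N (\<Union>S)" "Q (\<Union>S)" "A \<subseteq> \<Union>S"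
      using admissible_Union[OF S(1)] Q[OF S(1)] S(1) by (simp, simp, blast)
    then show "\<Union>S \<in> ?F" by blast
  qed
  then obtain T where T: "T \<in> ?F" and max: "\<forall>T'\<in>?F. T \<subseteq> T' \<longrightarrow> T' = T" by (rule bexE)
  show ?thesis
  proof (rule that[of T])
    show "admissible R \<X> N T" "Q T" "A \<subseteq> T" using T by simp_all
    show "T' = T" if "admissible R \<X> N T'" "Q T'" "T \<subseteq> T'" for T'
      using max T that by (metis (mono_tags, lifting) mem_Collect_eq order_trans)
  qed
qed

text \<open>The images of the maps from bricks do not form a chain, so their sum is reached through
  a maximal admissible \<open>T\<close> between \<open>A\<close> and the hull. Adding any
  \<open>u(X)\<close> keeps \<open>T\<close> admissible, so \<open>T\<close> already contains
  it.\<close>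

lemma admissible_socle_hull:
  assumes A: "admissible R \<X> N A" shows "admissible R \<X> N (socle_hull R \<X> N A)"
proof -
  note sA = admissible_submodule[OF A]
  let ?S = "socle_hull R \<X> N A"
  obtain T where T: "admissible R \<X> N T" "T \<subseteq> ?S" "A \<subseteq> T"
    and max: "\<And>T'. admissible R \<X> N T' \<Longrightarrow> T' \<subseteq> ?S \<Longrightarrow> T \<subseteq> T' \<Longrightarrow> T' = T"
    by (rule admissible_maximal[OF A, where Q = "\<lambda>T. T \<subseteq> ?S"])
      (use socle_hull_upper in \<open>blast+\<close>)
  note sT = admissible_submodule[OF T(1)]
  have "u ` carrier X \<subseteq> T" if X: "X \<in> \<X>" and u: "u \<in> hom_mod R X N A" for X u
  proof -
    note uT = hom_mod_mono[OF u T(3)]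
    note up = set_add_hom_mod_upper[OF X sT uT]
    have "T <+>\<^bsub>N\<^esub> u ` carrier X = T"
      by (rule max[OF admissible_hom_mod[OF T(1) X uT]
            set_add_least[OF socle_hull_submodule[OF sA] T(2) socle_hull_image[OF X u]] up(1)])
    then show ?thesis using up(2) by simp
  qed
  then have "?S \<subseteq> T" by (rule socle_hull_least[OF sT T(3)])
  then show ?thesis using T by (metis subset_antisym)
qed

text \<open>An element of \<open>I\<close> in the hull may be a sum of contributions none of which
  lies in \<open>I\<close>. The remedy is a relative complement: a submodule \<open>T\<close> with
  \<open>T \<inter> I\<close> inside \<open>A\<close> that absorbs all contributions from outside
  \<open>T + I\<close>.\<close>

lemma socle_hull_Int:
  assumes N0: "cofiltered R \<X> N {\<zero>\<^bsub>N\<^esub>}" and I: "admissible R \<X> N I" and A: "admissible R \<X> N A"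
  shows "socle_hull R \<X> (N\<lparr>carrier := I\<rparr>) (I \<inter> A) = I \<inter> socle_hull R \<X> N A"
proof -
  note sI = admissible_submodule[OF I] and sA = admissible_submodule[OF A]
  note Ic = submoduleD(1)[OF sI]
  let ?P = "N\<lparr>carrier := I\<rparr>"
  interpret P: semibrick_module R ?P \<X>
    using lmodule_submodule[OF sI] semibrick by (simp add: semibrick_module_def semibrick_module_axioms_def)
  have sIA: "submodule (I \<inter> A) R ?P"
    using submodule_of_submodule[OF sI] submodule_Int[OF sI sA] by auto
  let ?S = "socle_hull R \<X> ?P (I \<inter> A)"
  have sS: "submodule ?S R N" "?S \<subseteq> I"
    using P.socle_hull_submodule[OF sIA] submodule_of_submodule[OF sI] by auto
  show ?thesis
  proof
    \<comment> \<open>A map from \<open>X\<close> to \<open>I/(I \<inter> A)\<close> is also a map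
      to \<open>N/A\<close>; this gives the easy inclusion.\<close>
    have hom: "u \<in> hom_mod R X N A" if "u \<in> hom_mod R X ?P (I \<inter> A)" for X :: "('r, 'x) module" and u
      using that Ic cong_mod_mono[of N "I \<inter> A" _ _ A] unfolding hom_mod_def
      by (auto simp: cong_mod_carrier_update[OF Ic] Pi_iff)
    have im: "u ` carrier X \<subseteq> I" if "u \<in> hom_mod R X ?P (I \<inter> A)" for X :: "('r, 'x) module" and u
      using hom_modD(1)[OF that] by auto
    show "?S \<subseteq> I \<inter> socle_hull R \<X> N A"
    proof (rule P.socle_hull_least)
      show "submodule (I \<inter> socle_hull R \<X> N A) R ?P"
        using submodule_of_submodule[OF sI] submodule_Int[OF sI socle_hull_submodule[OF sA]] by auto
      show "I \<inter> A \<subseteq> I \<inter> socle_hull R \<X> N A" using socle_hull_upper[of A] by auto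
      show "u ` carrier X \<subseteq> I \<inter> socle_hull R \<X> N A"
        if "X \<in> \<X>" "u \<in> hom_mod R X ?P (I \<inter> A)" for X u
        using im[OF that(2)] socle_hull_image[OF that(1) hom[OF that(2)]] by auto
    qed
  next
    obtain T where T: "admissible R \<X> N T" "T \<inter> I \<subseteq> A" "A \<subseteq> T"
      and max: "\<And>T'. admissible R \<X> N T' \<Longrightarrow> T' \<inter> I \<subseteq> A \<Longrightarrow> T \<subseteq> T' \<Longrightarrow> T' = T"
      by (rule admissible_maximal[OF A, where Q = "\<lambda>T. T \<inter> I \<subseteq> A"]) blast+
    note sT = admissible_submodule[OF T(1)]
    have "T <+>\<^bsub>N\<^esub> I = ({\<zero>\<^bsub>N\<^esub>} <+>\<^bsub>N\<^esub> T) <+>\<^bsub>N\<^esub> I" using zero_set_add submoduleD(1)[OF sT] by simp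
    then have TI: "cofiltered R \<X> N (T <+>\<^bsub>N\<^esub> I)"
      using admissibleD[OF I admissibleD[OF T(1) N0]] by simp
    have mTI: "y \<in> T <+>\<^bsub>N\<^esub> I \<longleftrightarrow> (\<exists>i\<in>I. cong_mod N T y i)" for y by (rule mem_set_add_iff[OF sT Ic])
    have mTS: "y \<in> T <+>\<^bsub>N\<^esub> ?S \<longleftrightarrow> (\<exists>i\<in>?S. cong_mod N T y i)" for y
      by (rule mem_set_add_iff[OF sT submoduleD(1)[OF sS(1)]])
    have TTI: "T \<subseteq> T <+>\<^bsub>N\<^esub> I" by (rule set_add_upper1[OF sT submoduleD(2)[OF sI]])
    have TTS: "T \<subseteq> T <+>\<^bsub>N\<^esub> ?S" by (rule set_add_upper1[OF sT submoduleD(2)[OF sS(1)]])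
    \<comment> \<open>On \<open>I\<close>, congruence modulo the large \<open>T\<close> already
      implies congruence modulo \<open>I \<inter> A\<close>, because \<open>T \<inter> I\<close>
      lies in \<open>A\<close>.\<close>
    have congI: "cong_mod ?P (I \<inter> A) a b" if "a \<in> I" "b \<in> I" "cong_mod N T a b" for a b
    proof -
      have "cong_mod N (T \<inter> I) a b"
        using that cong_mod_Int[OF sT sI] cong_mod_if_mem[OF sI] by blast
      then have "cong_mod N (I \<inter> A) a b" by (rule cong_mod_mono) (use T(2) in blast)
      then show ?thesis using that by (simp add: cong_mod_carrier_update[OF Ic])
    qed
    have "u ` carrier X \<subseteq> T <+>\<^bsub>N\<^esub> ?S" if X: "X \<in> \<X>" and u: "u \<in> hom_mod R X N A" for X u
    proof -
      interpret X: lmodule R X by (rule lmoduleX[OF X])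
      have uc: "u ` carrier X \<subseteq> carrier N" using hom_modD(1)[OF u] by auto
      note uT = hom_mod_mono[OF u T(3)]
      note up = set_add_hom_mod_upper[OF X sT uT]
      show ?thesis
      proof (cases "u ` carrier X \<subseteq> T <+>\<^bsub>N\<^esub> I")
        case True
        \<comment> \<open>Here \<open>u\<close> is corrected by elements of \<open>T\<close> to a
          lift \<open>v\<close> with values in \<open>I\<close>. By \<open>congI\<close> it is a
          homomorphism modulo \<open>I \<inter> A\<close>, so its image lies in the hull computed
          inside \<open>I\<close>.\<close>
        then have "\<exists>i\<in>I. cong_mod N T (u x) i" if "x \<in> carrier X" for x using mTI that by blast
        then obtain v where "\<And>x. x \<in> carrier X \<Longrightarrow> v x \<in> I \<and> cong_mod N T (u x) (v x)" by metis
        then have vI: "v x \<in> I" and uv: "cong_mod N T (u x) (v x)" and vu: "cong_mod N T (v x) (u x)"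
          if "x \<in> carrier X" for x using that cong_mod_sym[OF sT] by blast+
        have "v \<in> hom_mod R X ?P (I \<inter> A)"
          unfolding hom_mod_def mem_Collect_eq
        proof (intro conjI ballI)
          show "v \<in> carrier X \<rightarrow> carrier ?P" using vI by auto
        next
          fix x y assume xy: "x \<in> carrier X" "y \<in> carrier X"
          have "cong_mod N T (v (x \<oplus>\<^bsub>X\<^esub> y)) (u x \<oplus>\<^bsub>N\<^esub> u y)"
            using cong_mod_trans[OF sT vu hom_modD(2)[OF uT xy]] xy by simp
          then have "cong_mod N T (v (x \<oplus>\<^bsub>X\<^esub> y)) (v x \<oplus>\<^bsub>N\<^esub> v y)"
            using cong_mod_trans[OF sT _ cong_mod_add[OF sT uv[OF xy(1)] uv[OF xy(2)]]] by blast
          then show "cong_mod ?P (I \<inter> A) (v (x \<oplus>\<^bsub>X\<^esub> y)) (v x \<oplus>\<^bsub>?P\<^esub> v y)"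
            using congI vI xy submoduleD(3)[OF sI] by simp
        next
          fix a x assume ax: "a \<in> carrier R" "x \<in> carrier X"
          have "cong_mod N T (v (a \<odot>\<^bsub>X\<^esub> x)) (a \<odot>\<^bsub>N\<^esub> u x)"
            using cong_mod_trans[OF sT vu hom_modD(3)[OF uT ax]] ax by simp
          then have "cong_mod N T (v (a \<odot>\<^bsub>X\<^esub> x)) (a \<odot>\<^bsub>N\<^esub> v x)"
            using cong_mod_trans[OF sT _ cong_mod_smult[OF sT uv[OF ax(2)] ax(1)]] by blast
          then show "cong_mod ?P (I \<inter> A) (v (a \<odot>\<^bsub>X\<^esub> x)) (a \<odot>\<^bsub>?P\<^esub> v x)"
            using congI vI ax submoduleD(4)[OF sI] by simp
        qed
        from P.socle_hull_image[OF X this] show ?thesis using mTS uv by blast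
      next
        case False
        \<comment> \<open>Now \<open>u\<close> is injective modulo \<open>T + I\<close>, so adding
          \<open>u(X)\<close> to \<open>T\<close> creates no new element of \<open>I\<close>.
          Maximality of \<open>T\<close> then gives \<open>u(X)\<close> inside
          \<open>T\<close>.\<close>
        note inj = hom_mod_dichotomy(1)[OF TI X hom_mod_mono[OF uT TTI] False]
        have "y \<in> A" if y: "y \<in> T <+>\<^bsub>N\<^esub> u ` carrier X" "y \<in> I" for y
        proof -
          obtain x where x: "x \<in> carrier X" "cong_mod N T y (u x)"
            using y(1) mem_set_add_iff[OF sT uc] by blast
          then have "u x \<in> T <+>\<^bsub>N\<^esub> I" using mTI cong_mod_sym[OF sT] y(2) by blast
          then have "x = \<zero>\<^bsub>X\<^esub>" using inj x(1) by blast
          then have "y \<in> T" using hom_mod_zero[OF X.lmodule_axioms sT uT] cong_mod_mem[OF sT x(2)] by auto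
          then show ?thesis using T(2) y(2) by blast
        qed
        then have "T <+>\<^bsub>N\<^esub> u ` carrier X = T"
          by (intro max[OF admissible_hom_mod[OF T(1) X uT] _ up(1)]) blast
        then show ?thesis using up(2) TTS by simp
      qed
    qed
    then have hull: "socle_hull R \<X> N A \<subseteq> T <+>\<^bsub>N\<^esub> ?S"
      using T(3) TTS by (intro socle_hull_least[OF submodule_set_add[OF sT sS(1)]]) auto
    show "I \<inter> socle_hull R \<X> N A \<subseteq> ?S"
    proof
      fix y assume y: "y \<in> I \<inter> socle_hull R \<X> N A"
      then obtain s where s: "s \<in> ?S" "cong_mod N T y s" using hull mTS by blast
      then have "cong_mod ?P (I \<inter> A) y s" using congI y sS(2) by blast
      then show "y \<in> ?S"
        using P.cong_mod_mem[OF P.socle_hull_submodule[OF sIA] _ P.socle_hull_upper s(1)] by blast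
    qed
  qed
qed

end

section \<open>Quotient modules\<close>

text \<open>\<open>X_filtration\<close> supplies isomorphisms from a factor to a brick, whereas
  \<open>brick_ext\<close> uses maps from the brick.\<close>

lemma lmod_iso_inverse:
  assumes "lmodule R X" "lmodule R Y" and h: "h \<in> lmod_hom R X Y" "bij_betw h (carrier X) (carrier Y)"
  shows "inv_into (carrier X) h \<in> lmod_hom R Y X"
    and "bij_betw (inv_into (carrier X) h) (carrier Y) (carrier X)"
proof -
  interpret X: lmodule R X by fact
  interpret Y: lmodule R Y by fact
  let ?g = "inv_into (carrier X) h"
  show b: "bij_betw ?g (carrier Y) (carrier X)" by (rule bij_betw_inv_into[OF h(2)])
  have gX: "?g y \<in> carrier X" if "y \<in> carrier Y" for y using b that by (rule bij_betw_apply)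
  have hg: "h (?g y) = y" if "y \<in> carrier Y" for y by (rule bij_betw_inv_into_right[OF h(2) that])
  have gh: "?g (h x) = x" if "x \<in> carrier X" for x by (rule bij_betw_inv_into_left[OF h(2) that])
  have add: "h (x \<oplus>\<^bsub>X\<^esub> y) = h x \<oplus>\<^bsub>Y\<^esub> h y" if "x \<in> carrier X" "y \<in> carrier X" for x y
    using h(1) that by (simp add: lmod_hom_def)
  have smult: "h (a \<odot>\<^bsub>X\<^esub> x) = a \<odot>\<^bsub>Y\<^esub> h x" if "a \<in> carrier R" "x \<in> carrier X" for a x
    using h(1) that by (simp add: lmod_hom_def)
  show "?g \<in> lmod_hom R Y X"
    unfolding lmod_hom_def mem_Collect_eq
  proof (intro conjI ballI)
    show "?g \<in> carrier Y \<rightarrow> carrier X" using gX by auto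
    show "?g (x \<oplus>\<^bsub>Y\<^esub> y) = ?g x \<oplus>\<^bsub>X\<^esub> ?g y" if "x \<in> carrier Y" "y \<in> carrier Y" for x y
      using gh[of "?g x \<oplus>\<^bsub>X\<^esub> ?g y"] add[of "?g x" "?g y"] gX hg that by simp
    show "?g (a \<odot>\<^bsub>Y\<^esub> x) = a \<odot>\<^bsub>X\<^esub> ?g x" if "a \<in> carrier R" "x \<in> carrier Y" for a x
      using gh[of "a \<odot>\<^bsub>X\<^esub> ?g x"] smult[of a "?g x"] gX hg that by simp
  qed
qed

context lmodule
begin

section \<open>Cosets and the module structure of \<open>N/A\<close>\<close>

lemma coset_eq_Collect:
  assumes "submodule A R N" "x \<in> carrier N" shows "A +>\<^bsub>N\<^esub> x = {y. cong_mod N A y x}"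
proof -
  have "a \<oplus>\<^bsub>N\<^esub> x \<in> carrier N" if "a \<in> A" for a using that assms submoduleD(1)[OF assms(1)] by auto
  then show ?thesis using assms(2) unfolding a_r_coset_def' cong_mod_def by blast
qed

lemma coset_eq_iff:
  assumes A: "submodule A R N" and "x \<in> carrier N" "y \<in> carrier N"
  shows "A +>\<^bsub>N\<^esub> x = A +>\<^bsub>N\<^esub> y \<longleftrightarrow> cong_mod N A x y"
  unfolding coset_eq_Collect[OF A assms(2)] coset_eq_Collect[OF A assms(3)]
  using cong_mod_refl[OF A assms(2)] cong_mod_sym[OF A] cong_mod_trans[OF A] by blast

lemma carrier_quot: "carrier (lmod_quot N A) = (\<lambda>x. A +>\<^bsub>N\<^esub> x) ` carrier N"
  by (auto simp: lmod_quot_def A_RCOSETS_def' a_r_coset_def')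

lemma zero_quot:
  assumes "submodule A R N" shows "\<zero>\<^bsub>lmod_quot N A\<^esub> = A +>\<^bsub>N\<^esub> \<zero>\<^bsub>N\<^esub>"
  using cong_mod_zero[OF assms] by (simp add: lmod_quot_def coset_eq_Collect[OF assms])

lemma add_quot:
  assumes A: "submodule A R N" and "x \<in> carrier N" "y \<in> carrier N"
  shows "(A +>\<^bsub>N\<^esub> x) \<oplus>\<^bsub>lmod_quot N A\<^esub> (A +>\<^bsub>N\<^esub> y) = A +>\<^bsub>N\<^esub> (x \<oplus>\<^bsub>N\<^esub> y)"
proof -
  have xy: "x \<oplus>\<^bsub>N\<^esub> y \<in> carrier N" using assms by simp
  have "set_add N (A +>\<^bsub>N\<^esub> x) (A +>\<^bsub>N\<^esub> y) = A +>\<^bsub>N\<^esub> (x \<oplus>\<^bsub>N\<^esub> y)"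
  proof
    show "set_add N (A +>\<^bsub>N\<^esub> x) (A +>\<^bsub>N\<^esub> y) \<subseteq> A +>\<^bsub>N\<^esub> (x \<oplus>\<^bsub>N\<^esub> y)"
      unfolding coset_eq_Collect[OF A xy] coset_eq_Collect[OF A assms(2)] coset_eq_Collect[OF A assms(3)]
        set_add_def' using cong_mod_add[OF A] by blast
  next
    show "A +>\<^bsub>N\<^esub> (x \<oplus>\<^bsub>N\<^esub> y) \<subseteq> set_add N (A +>\<^bsub>N\<^esub> x) (A +>\<^bsub>N\<^esub> y)"
    proof
      fix z assume "z \<in> A +>\<^bsub>N\<^esub> (x \<oplus>\<^bsub>N\<^esub> y)"
      then obtain a where a: "a \<in> A" "z = a \<oplus>\<^bsub>N\<^esub> (x \<oplus>\<^bsub>N\<^esub> y)" by (auto simp: a_r_coset_def')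
      then have "z = (a \<oplus>\<^bsub>N\<^esub> x) \<oplus>\<^bsub>N\<^esub> y"
        using assms(2,3) submoduleD(1)[OF A] by (simp add: M.a_assoc subset_iff)
      moreover have "a \<oplus>\<^bsub>N\<^esub> x \<in> A +>\<^bsub>N\<^esub> x" using a by (auto simp: a_r_coset_def')
      moreover have "y \<in> A +>\<^bsub>N\<^esub> y"
        using cong_mod_refl[OF A assms(3)] by (simp add: coset_eq_Collect[OF A assms(3)])
      ultimately show "z \<in> set_add N (A +>\<^bsub>N\<^esub> x) (A +>\<^bsub>N\<^esub> y)" unfolding set_add_def' by blast
    qed
  qed
  then show ?thesis by (simp add: lmod_quot_def)
qed

text \<open>The union over all representatives in \<open>lmod_quot\<close> collapses, since each of
  them yields the same coset.\<close>

lemma smult_quot: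
  assumes A: "submodule A R N" and a: "a \<in> carrier R" and x: "x \<in> carrier N"
  shows "a \<odot>\<^bsub>lmod_quot N A\<^esub> (A +>\<^bsub>N\<^esub> x) = A +>\<^bsub>N\<^esub> (a \<odot>\<^bsub>N\<^esub> x)"
proof -
  have "A +>\<^bsub>N\<^esub> (a \<odot>\<^bsub>N\<^esub> y) = A +>\<^bsub>N\<^esub> (a \<odot>\<^bsub>N\<^esub> x)" if "y \<in> A +>\<^bsub>N\<^esub> x" for y
  proof -
    have c: "cong_mod N A y x" using that by (simp add: coset_eq_Collect[OF A x])
    then have "y \<in> carrier N" by (simp add: cong_mod_def)
    then show ?thesis using cong_mod_smult[OF A c a] coset_eq_iff[OF A] a x by simp
  qed
  moreover have "x \<in> A +>\<^bsub>N\<^esub> x" using cong_mod_refl[OF A x] by (simp add: coset_eq_Collect[OF A x])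
  ultimately have "(\<Union>y\<in>A +>\<^bsub>N\<^esub> x. A +>\<^bsub>N\<^esub> (a \<odot>\<^bsub>N\<^esub> y)) = A +>\<^bsub>N\<^esub> (a \<odot>\<^bsub>N\<^esub> x)" by blast
  then show ?thesis by (simp add: lmod_quot_def)
qed

lemma lmodule_quot:
  assumes A: "submodule A R N" shows "lmodule R (lmod_quot N A)"
proof -
  let ?Q = "lmod_quot N A"
  note Q = carrier_quot zero_quot[OF A] add_quot[OF A] smult_quot[OF A]
  have "abelian_group ?Q"
  proof (rule abelian_groupI)
    fix x assume "x \<in> carrier ?Q"
    then obtain n where n: "n \<in> carrier N" "x = A +>\<^bsub>N\<^esub> n" unfolding Q by blast
    then have "(A +>\<^bsub>N\<^esub> \<ominus>\<^bsub>N\<^esub> n) \<oplus>\<^bsub>?Q\<^esub> x = \<zero>\<^bsub>?Q\<^esub>" by (simp add: Q M.l_neg)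
    then show "\<exists>y\<in>carrier ?Q. y \<oplus>\<^bsub>?Q\<^esub> x = \<zero>\<^bsub>?Q\<^esub>" using n unfolding Q(1) by blast
  next
    show "x \<oplus>\<^bsub>?Q\<^esub> y = y \<oplus>\<^bsub>?Q\<^esub> x" if xy: "x \<in> carrier ?Q" "y \<in> carrier ?Q" for x y
    proof -
      obtain n m where "n \<in> carrier N" "x = A +>\<^bsub>N\<^esub> n" "m \<in> carrier N" "y = A +>\<^bsub>N\<^esub> m"
        using xy unfolding Q by blast
      then show ?thesis using M.a_comm[of n m] by (simp add: Q)
    qed
  qed (auto simp: Q M.a_assoc)
  then show ?thesis
    by (intro lmodule.intro left_module.intro left_module_axioms.intro)
      (use R.ring_axioms in
        \<open>auto simp: Q smult_l_distr smult_r_distr smult_assoc1\<close>)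
qed

section \<open>Maps into a quotient, socles and factors\<close>

lemma coset_hom:
  assumes A: "submodule A R N" shows "(\<lambda>x. A +>\<^bsub>N\<^esub> x) \<in> lmod_hom R N (lmod_quot N A)"
  by (auto simp: lmod_hom_def carrier_quot add_quot[OF A] smult_quot[OF A])

lemma hom_mod_coset:
  assumes X: "lmodule R X" and A: "submodule A R N" and u: "u \<in> carrier X \<rightarrow> carrier N"
  shows "u \<in> hom_mod R X N A \<longleftrightarrow> (\<lambda>x. A +>\<^bsub>N\<^esub> u x) \<in> lmod_hom R X (lmod_quot N A)"
proof -
  interpret X: lmodule R X by fact
  have uc: "u x \<in> carrier N" if "x \<in> carrier X" for x using u that by auto
  show ?thesis
    unfolding hom_mod_def lmod_hom_def mem_Collect_eq carrier_quot using u
    by (auto simp: add_quot[OF A] smult_quot[OF A] uc coset_eq_iff[OF A])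
qed

lemma hom_quot_lift:
  assumes X: "lmodule R X" and A: "submodule A R N" and g: "g \<in> lmod_hom R X (lmod_quot N A)"
  obtains u where "u \<in> hom_mod R X N A" "\<And>x. x \<in> carrier X \<Longrightarrow> g x = A +>\<^bsub>N\<^esub> u x"
proof -
  interpret X: lmodule R X by fact
  have "g x \<in> carrier (lmod_quot N A)" if "x \<in> carrier X" for x using g that by (auto simp: lmod_hom_def)
  then have "\<exists>n\<in>carrier N. g x = A +>\<^bsub>N\<^esub> n" if "x \<in> carrier X" for x
    using that unfolding carrier_quot by blast
  then obtain u where u: "\<And>x. x \<in> carrier X \<Longrightarrow> u x \<in> carrier N \<and> g x = A +>\<^bsub>N\<^esub> u x" by metis
  then have "u \<in> carrier X \<rightarrow> carrier N" by auto
  moreover have "(\<lambda>x. A +>\<^bsub>N\<^esub> u x) \<in> lmod_hom R X (lmod_quot N A)"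
    using g u unfolding lmod_hom_def by (auto simp: Pi_iff)
  ultimately have "u \<in> hom_mod R X N A" using hom_mod_coset[OF X A] by blast
  then show ?thesis using that u by blast
qed

lemma mem_coset_image_iff:
  assumes A: "submodule A R N" and B: "submodule B R N" "A \<subseteq> B" and x: "x \<in> carrier N"
  shows "A +>\<^bsub>N\<^esub> x \<in> (\<lambda>x. A +>\<^bsub>N\<^esub> x) ` B \<longleftrightarrow> x \<in> B"
proof
  assume "A +>\<^bsub>N\<^esub> x \<in> (\<lambda>x. A +>\<^bsub>N\<^esub> x) ` B"
  then obtain b where b: "b \<in> B" "A +>\<^bsub>N\<^esub> x = A +>\<^bsub>N\<^esub> b" by blast
  then have "b \<in> carrier N" using submoduleD(1)[OF B(1)] by blast
  then have "cong_mod N A x b" using coset_eq_iff[OF A x] b(2) by blast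
  then show "x \<in> B" using cong_mod_mem[OF B(1)] B(2) b(1) by blast
qed blast

lemma submodule_coset_image:
  assumes A: "submodule A R N" and B: "submodule B R N"
  shows "submodule ((\<lambda>x. A +>\<^bsub>N\<^esub> x) ` B) R (lmod_quot N A)"
proof -
  interpret Q: lmodule R "lmod_quot N A" by (rule lmodule_quot[OF A])
  have Bc: "x \<in> carrier N" if "x \<in> B" for x using submoduleD(1)[OF B] that by blast
  show ?thesis unfolding Q.submodule_iff
  proof (intro conjI ballI)
    show "(\<lambda>x. A +>\<^bsub>N\<^esub> x) ` B \<subseteq> carrier (lmod_quot N A)" using Bc unfolding carrier_quot by blast
    show "\<zero>\<^bsub>lmod_quot N A\<^esub> \<in> (\<lambda>x. A +>\<^bsub>N\<^esub> x) ` B"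
      using submoduleD(2)[OF B] unfolding zero_quot[OF A] by blast
    show "x \<oplus>\<^bsub>lmod_quot N A\<^esub> y \<in> (\<lambda>x. A +>\<^bsub>N\<^esub> x) ` B"
      if "x \<in> (\<lambda>x. A +>\<^bsub>N\<^esub> x) ` B" "y \<in> (\<lambda>x. A +>\<^bsub>N\<^esub> x) ` B" for x y
      using that submoduleD(3)[OF B] Bc by (auto simp: add_quot[OF A])
    show "a \<odot>\<^bsub>lmod_quot N A\<^esub> x \<in> (\<lambda>x. A +>\<^bsub>N\<^esub> x) ` B"
      if "a \<in> carrier R" "x \<in> (\<lambda>x. A +>\<^bsub>N\<^esub> x) ` B" for a x
      using that submoduleD(4)[OF B] Bc by (auto simp: smult_quot[OF A])
  qed
qed

lemma submodule_coset_vimage: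
  assumes A: "submodule A R N" and B: "submodule B R (lmod_quot N A)"
  shows "submodule {x \<in> carrier N. A +>\<^bsub>N\<^esub> x \<in> B} R N"
proof -
  interpret Q: lmodule R "lmod_quot N A" by (rule lmodule_quot[OF A])
  note b = Q.submoduleD[OF B]
  show ?thesis unfolding submodule_iff
  proof (intro conjI ballI)
    show "\<zero>\<^bsub>N\<^esub> \<in> {x \<in> carrier N. A +>\<^bsub>N\<^esub> x \<in> B}" using b(2) by (simp add: zero_quot[OF A])
    show "x \<oplus>\<^bsub>N\<^esub> y \<in> {x \<in> carrier N. A +>\<^bsub>N\<^esub> x \<in> B}"
      if "x \<in> {x \<in> carrier N. A +>\<^bsub>N\<^esub> x \<in> B}" "y \<in> {x \<in> carrier N. A +>\<^bsub>N\<^esub> x \<in> B}" for x y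
      using b(3)[of "A +>\<^bsub>N\<^esub> x" "A +>\<^bsub>N\<^esub> y"] that by (simp add: add_quot[OF A])
    show "a \<odot>\<^bsub>N\<^esub> x \<in> {x \<in> carrier N. A +>\<^bsub>N\<^esub> x \<in> B}"
      if "a \<in> carrier R" "x \<in> {x \<in> carrier N. A +>\<^bsub>N\<^esub> x \<in> B}" for a x
      using b(4)[of a "A +>\<^bsub>N\<^esub> x"] that by (simp add: smult_quot[OF A])
  qed blast
qed

text \<open>Submodules of \<open>N/A\<close> correspond to submodules of \<open>N\<close> above
  \<open>A\<close>, and maps from a brick to \<open>N/A\<close> to lifts. Under this dictionary the
  span of all images becomes the intersection defining the hull.\<close>

lemma X_socle_vimage:
  assumes lX: "\<And>X. X \<in> \<X> \<Longrightarrow> lmodule R X" and A: "submodule A R N"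
  shows "{x \<in> carrier N. A +>\<^bsub>N\<^esub> x \<in> X_socle R \<X> (lmod_quot N A)} = socle_hull R \<X> N A"
proof -
  let ?Q = "lmod_quot N A"
  interpret Q: lmodule R ?Q by (rule lmodule_quot[OF A])
  let ?G = "\<Union>X\<in>\<X>. \<Union>f\<in>lmod_hom R X ?Q. f ` carrier X"
  have soc: "X_socle R \<X> ?Q = \<Inter>{H. submodule H R ?Q \<and> ?G \<subseteq> H}"
    by (simp add: X_socle_def lmod_span_def)
  have "?G \<subseteq> carrier ?Q" by (auto simp: lmod_hom_def)
  then have "carrier ?Q \<in> {H. submodule H R ?Q \<and> ?G \<subseteq> H}" using Q.submodule_carrier by blast
  then have sS: "submodule (X_socle R \<X> ?Q) R ?Q"
    unfolding soc by (intro Q.submodule_Inter) blast+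
  have GS: "?G \<subseteq> X_socle R \<X> ?Q" unfolding soc by blast
  show ?thesis
  proof
    let ?V = "{x \<in> carrier N. A +>\<^bsub>N\<^esub> x \<in> X_socle R \<X> ?Q}"
    have "A +>\<^bsub>N\<^esub> a = \<zero>\<^bsub>?Q\<^esub>" "a \<in> carrier N" if "a \<in> A" for a
      using that cong_mod_zero[OF A] submoduleD(1)[OF A] coset_eq_iff[OF A, of a "\<zero>\<^bsub>N\<^esub>"]
      by (auto simp: zero_quot[OF A])
    then have AV: "A \<subseteq> ?V" using Q.submoduleD(2)[OF sS] by auto
    have "u ` carrier X \<subseteq> ?V" if X: "X \<in> \<X>" and u: "u \<in> hom_mod R X N A" for X u
    proof -
      have "(\<lambda>x. A +>\<^bsub>N\<^esub> u x) \<in> lmod_hom R X ?Q"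
        using hom_mod_coset[OF lX[OF X] A] u hom_modD(1)[OF u] by blast
      then have "A +>\<^bsub>N\<^esub> u x \<in> ?G" if "x \<in> carrier X" for x using X that by blast
      then show ?thesis using GS hom_modD(1)[OF u] by blast
    qed
    then show "socle_hull R \<X> N A \<subseteq> ?V"
      using submodule_coset_vimage[OF A sS] AV unfolding socle_hull_def by blast
    show "?V \<subseteq> socle_hull R \<X> N A"
      unfolding socle_hull_def
    proof (rule Inter_greatest)
      fix B assume "B \<in> {B. submodule B R N \<and> A \<subseteq> B \<and> (\<forall>X\<in>\<X>. \<forall>u\<in>hom_mod R X N A. u ` carrier X \<subseteq> B)}"
      then have B: "submodule B R N" "A \<subseteq> B"
        and Bu: "\<And>X u. X \<in> \<X> \<Longrightarrow> u \<in> hom_mod R X N A \<Longrightarrow> u ` carrier X \<subseteq> B" by blast+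
      have "g x \<in> (\<lambda>x. A +>\<^bsub>N\<^esub> x) ` B"
        if X: "X \<in> \<X>" and g: "g \<in> lmod_hom R X ?Q" and x: "x \<in> carrier X" for X g x
      proof -
        obtain u where "u \<in> hom_mod R X N A" "g x = A +>\<^bsub>N\<^esub> u x"
          using hom_quot_lift[OF lX[OF X] A g] x by metis
        then show ?thesis using Bu[OF X] x by blast
      qed
      then have "?G \<subseteq> (\<lambda>x. A +>\<^bsub>N\<^esub> x) ` B" by blast
      then have "X_socle R \<X> ?Q \<subseteq> (\<lambda>x. A +>\<^bsub>N\<^esub> x) ` B"
        unfolding soc using submodule_coset_image[OF A B(1)] by blast
      then show "?V \<subseteq> B" using mem_coset_image_iff[OF A B] by blast
    qed
  qed
qed

lemma brick_ext_iff_quot: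
  assumes lX: "\<And>X. X \<in> \<X> \<Longrightarrow> lmodule R X" and C: "submodule C R N" and D: "submodule D R N" "C \<subseteq> D"
  shows "brick_ext R \<X> N C D \<longleftrightarrow> (\<exists>X\<in>\<X>. lmod_iso R (lmod_quot (N\<lparr>carrier := D\<rparr>) C) X)"
proof -
  let ?P = "N\<lparr>carrier := D\<rparr>"
  let ?Q = "lmod_quot ?P C"
  note Dc = submoduleD(1)[OF D(1)]
  interpret P: lmodule R ?P by (rule lmodule_submodule[OF D(1)])
  have CP: "submodule C R ?P" using submodule_of_submodule[OF D(1)] C D(2) by blast
  note Q = P.lmodule_quot[OF CP]
  interpret Q: lmodule R ?Q by (rule Q)
  show ?thesis
  proof
    assume "brick_ext R \<X> N C D"
    then obtain X u where X: "X \<in> \<X>" and u: "u \<in> hom_mod R X N C"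
      and inj: "\<And>x. x \<in> carrier X \<Longrightarrow> u x \<in> C \<Longrightarrow> x = \<zero>\<^bsub>X\<^esub>" and Du: "D = C <+>\<^bsub>N\<^esub> u ` carrier X"
      by (auto simp: brick_ext_def)
    interpret X: lmodule R X by (rule lX[OF X])
    have uc: "u ` carrier X \<subseteq> carrier N" using hom_modD(1)[OF u] by auto
    have uD: "u x \<in> D" if "x \<in> carrier X" for x
      unfolding Du using set_add_upper2[OF C uc] that by auto
    have uP: "u \<in> hom_mod R X ?P C"
      unfolding hom_mod_def mem_Collect_eq cong_mod_carrier_update[OF Dc]
      using hom_modD(2,3)[OF u] uD submoduleD(3,4)[OF D(1)] by auto
    let ?g = "\<lambda>x. C +>\<^bsub>?P\<^esub> u x"
    have g: "?g \<in> lmod_hom R X ?Q" using P.hom_mod_coset[OF lX[OF X] CP] uP uD by auto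
    have "bij_betw ?g (carrier X) (carrier ?Q)"
      unfolding bij_betw_def
    proof
      show "inj_on ?g (carrier X)"
        using P.hom_mod_injD[OF lX[OF X] CP uP inj] P.coset_eq_iff[OF CP] uD
        by (auto intro!: inj_onI)
      have "z \<in> ?g ` carrier X" if z: "z \<in> carrier ?Q" for z
      proof -
        obtain d where d: "d \<in> D" "z = C +>\<^bsub>?P\<^esub> d" using z unfolding P.carrier_quot by auto
        then obtain x where x: "x \<in> carrier X" "cong_mod N C d (u x)"
          using mem_set_add_iff[OF C uc] unfolding Du by blast
        then have "cong_mod ?P C d (u x)" using d uD by (simp add: cong_mod_carrier_update[OF Dc])
        then have "z = ?g x" using P.coset_eq_iff[OF CP] d uD[OF x(1)] by simp
        then show ?thesis using x(1) by blast
      qed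
      then show "?g ` carrier X = carrier ?Q" using g by (auto simp: lmod_hom_def)
    qed
    then show "\<exists>X\<in>\<X>. lmod_iso R ?Q X"
      using lmod_iso_inverse[OF lX[OF X] Q g] X unfolding lmod_iso_def by blast
  next
    assume "\<exists>X\<in>\<X>. lmod_iso R ?Q X"
    then obtain X h where X: "X \<in> \<X>" and h: "h \<in> lmod_hom R ?Q X" "bij_betw h (carrier ?Q) (carrier X)"
      unfolding lmod_iso_def by blast
    interpret X: lmodule R X by (rule lX[OF X])
    obtain g where g: "g \<in> lmod_hom R X ?Q" "bij_betw g (carrier X) (carrier ?Q)"
      using lmod_iso_inverse[OF Q lX[OF X] h] by blast
    obtain u where u: "u \<in> hom_mod R X ?P C" and gu: "\<And>x. x \<in> carrier X \<Longrightarrow> g x = C +>\<^bsub>?P\<^esub> u x"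
      using P.hom_quot_lift[OF lX[OF X] CP g(1)] by metis
    have uD: "u x \<in> D" if "x \<in> carrier X" for x using hom_modD(1)[OF u that] by simp
    then have uc: "u ` carrier X \<subseteq> carrier N" using Dc by auto
    have uN: "u \<in> hom_mod R X N C"
      using u uc unfolding hom_mod_def by (auto simp: cong_mod_carrier_update[OF Dc])
    have "x = \<zero>\<^bsub>X\<^esub>" if x: "x \<in> carrier X" "u x \<in> C" for x
    proof -
      have "u \<zero>\<^bsub>X\<^esub> \<in> C" by (rule P.hom_mod_zero[OF lX[OF X] CP u])
      then have "cong_mod ?P C (u x) (u \<zero>\<^bsub>X\<^esub>)" using P.cong_mod_if_mem[OF CP x(2)] by blast
      then have "g x = g \<zero>\<^bsub>X\<^esub>" using P.coset_eq_iff[OF CP] gu x(1) uD by simp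
      then show ?thesis using bij_betw_imp_inj_on[OF g(2)] x(1) by (simp add: inj_on_def)
    qed
    moreover have "D = C <+>\<^bsub>N\<^esub> u ` carrier X"
    proof
      show "C <+>\<^bsub>N\<^esub> u ` carrier X \<subseteq> D" using set_add_least[OF D] uD by blast
      show "D \<subseteq> C <+>\<^bsub>N\<^esub> u ` carrier X"
      proof
        fix d assume d: "d \<in> D"
        then have "C +>\<^bsub>?P\<^esub> d \<in> carrier ?Q" unfolding P.carrier_quot by auto
        then have "C +>\<^bsub>?P\<^esub> d \<in> g ` carrier X" using bij_betw_imp_surj_on[OF g(2)] by simp
        then obtain x where x: "x \<in> carrier X" "C +>\<^bsub>?P\<^esub> d = g x" by blast
        then have "cong_mod ?P C d (u x)" using P.coset_eq_iff[OF CP] d uD gu by simp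
        then have "cong_mod N C d (u x)" by (simp add: cong_mod_carrier_update[OF Dc])
        then show "d \<in> C <+>\<^bsub>N\<^esub> u ` carrier X" using mem_set_add_iff[OF C uc] x(1) by blast
      qed
    qed
    ultimately show "brick_ext R \<X> N C D" using X uN unfolding brick_ext_def by blast
  qed
qed

end

context semibrick_module
begin

text \<open>All terms contain \<open>A\<close>, so \<open>mem_coset_image_iff\<close> applies to
  them, and every factor keeps its brick after passing to cosets.\<close>

lemma cofiltered_quot:
  assumes cof: "cofiltered R \<X> N A"
  shows "cofiltered R \<X> (lmod_quot N A) {\<zero>\<^bsub>lmod_quot N A\<^esub>}"
proof -
  let ?Q = "lmod_quot N A" and ?\<pi> = "\<lambda>x. A +>\<^bsub>N\<^esub> x"
  note A = cofiltered_submodule[OF cof]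
  interpret Q: lmodule R ?Q by (rule lmodule_quot[OF A])
  obtain \<C> where ch: "brick_chain R \<X> N A \<C>" using cof by (auto simp: cofiltered_def)
  note AC = brick_chainD(3)[OF ch] and sub = brick_chainD(2)[OF ch]
  have "?\<pi> ` A = {\<zero>\<^bsub>?Q\<^esub>}"
  proof -
    have "?\<pi> a = \<zero>\<^bsub>?Q\<^esub>" if "a \<in> A" for a
      using that cong_mod_zero[OF A, of a] submoduleD(1)[OF A] coset_eq_iff[OF A, of a "\<zero>\<^bsub>N\<^esub>"]
      by (auto simp: zero_quot[OF A])
    then show ?thesis using submoduleD(2)[OF A] by auto
  qed
  moreover have "brick_chain R \<X> ?Q (?\<pi> ` A) ((`) ?\<pi> ` \<C>)"
  proof (rule brick_chain_image[OF ch])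
    show "?\<pi> ` \<Union>S = \<Union>((`) ?\<pi> ` S)" for S by blast
    show "submodule (?\<pi> ` C) R ?Q" if "C \<in> \<C>" for C by (rule submodule_coset_image[OF A sub[OF that]])
    show "?\<pi> ` carrier N = carrier ?Q" by (simp add: carrier_quot)
    fix C D assume cov: "covers \<C> C D"
    then have C: "C \<in> \<C>" by (simp add: covers_def)
    note sC = sub[OF C] and s\<pi>C = submodule_coset_image[OF A sub[OF C]]
    obtain X u where X: "X \<in> \<X>" and u: "u \<in> hom_mod R X N C"
      and inj: "\<And>x. x \<in> carrier X \<Longrightarrow> u x \<in> C \<Longrightarrow> x = \<zero>\<^bsub>X\<^esub>" and Du: "D = C <+>\<^bsub>N\<^esub> u ` carrier X"
      using brick_chainD(6)[OF ch cov] by (auto simp: brick_ext_def)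
    have "?\<pi> \<circ> u \<in> hom_mod R X ?Q (?\<pi> ` C)"
      by (rule Q.hom_mod_comp[OF sC lmodule_axioms s\<pi>C u coset_hom[OF A] subset_refl])
    moreover have "x = \<zero>\<^bsub>X\<^esub>" if x: "x \<in> carrier X" "(?\<pi> \<circ> u) x \<in> ?\<pi> ` C" for x
      using mem_coset_image_iff[OF A sC AC[OF C]] hom_modD(1)[OF u x(1)] inj[OF x(1)] x(2) by simp
    moreover have "?\<pi> ` D = (?\<pi> ` C) <+>\<^bsub>?Q\<^esub> (?\<pi> \<circ> u) ` carrier X"
    proof -
      have hom: "?\<pi> c \<oplus>\<^bsub>?Q\<^esub> ?\<pi> (u x) = ?\<pi> (c \<oplus>\<^bsub>N\<^esub> u x)" if "c \<in> C" "x \<in> carrier X" for c x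
        using add_quot[OF A] that submoduleD(1)[OF sC] hom_modD(1)[OF u] by blast
      have "?\<pi> ` D = (\<Union>c\<in>C. \<Union>x\<in>carrier X. {?\<pi> (c \<oplus>\<^bsub>N\<^esub> u x)})"
        unfolding Du set_add_def' by blast
      also have "\<dots> = (\<Union>c\<in>C. \<Union>x\<in>carrier X. {?\<pi> c \<oplus>\<^bsub>?Q\<^esub> ?\<pi> (u x)})"
        using hom by simp
      also have "\<dots> = (?\<pi> ` C) <+>\<^bsub>?Q\<^esub> (?\<pi> \<circ> u) ` carrier X"
        unfolding set_add_def' comp_def by blast
      finally show ?thesis .
    qed
    ultimately show "brick_ext R \<X> ?Q (?\<pi> ` C) (?\<pi> ` D)" using X unfolding brick_ext_def by blast
  qed
  ultimately show ?thesis by (auto simp: cofiltered_def)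
qed

end

section \<open>Filtrations indexed by ordinals\<close>

lemma ordinal_cases [consumes 2, case_names zero succ limit]:
  assumes "Well_order r" "i \<in> Field r"
  obtains (zero) "i = wo_rel.minim r (Field r)" | (succ) j where "j \<in> underS r i" "i = wo_rel.suc r {j}"
    | (limit) "limit_ord r i"
proof -
  interpret wo: wo_rel r by (rule wo_rel.intro[OF assms(1)])
  show ?thesis
  proof (cases "underS r i = {}")
    case True
    have "(i, j) \<in> r" if "j \<in> Field r" for j
    proof (rule ccontr)
      assume "(i, j) \<notin> r"
      then have "j \<in> underS r i"
        using wo.TOTALS assms(2) that wo.REFL by (auto simp: underS_def refl_on_def)
      then show False using True by blast
    qed
    then have "i = wo.minim (Field r)" using wo.equals_minim[OF subset_refl assms(2)] by blast
    then show ?thesis by (rule zero)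
  next
    case False
    then show ?thesis using succ limit assms(2) unfolding limit_ord_def by blast
  qed
qed

text \<open>The element \<open>j\<close> above \<open>i\<close> guarantees that \<open>i\<close> has
  a strict upper bound, without which \<open>wo_rel.suc\<close> is meaningless.\<close>

lemma suc_ordinal:
  assumes "Well_order r" "i \<in> underS r j"
  shows "i \<in> underS r (wo_rel.suc r {i})" "(wo_rel.suc r {i}, j) \<in> r"
    and "k \<in> underS r (wo_rel.suc r {i}) \<Longrightarrow> (k, i) \<in> r"
proof -
  interpret wo: wo_rel r by (rule wo_rel.intro[OF assms(1)])
  have ij: "(i, j) \<in> r" "i \<noteq> j" using assms(2) by (auto simp: underS_def)
  then have F: "i \<in> Field r" "j \<in> Field r" by (auto simp: Field_def)
  have j: "j \<in> wo.AboveS {i}" using ij F by (auto simp: AboveS_def)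
  have "{i} \<subseteq> Field r" "wo.AboveS {i} \<noteq> {}" using F j by auto
  from wo.suc_greater[OF this] show "i \<in> underS r (wo.suc {i})" by (auto simp: underS_def)
  show "(wo.suc {i}, j) \<in> r" by (rule wo.suc_least_AboveS[OF j])
  assume k: "k \<in> underS r (wo.suc {i})"
  show "(k, i) \<in> r"
  proof (rule ccontr)
    assume n: "(k, i) \<notin> r"
    have kF: "k \<in> Field r" using k by (auto simp: underS_def Field_def)
    then have "(i, k) \<in> r" "i \<noteq> k" using n wo.TOTALS F(1) wo.REFL by (auto simp: refl_on_def)
    then have "k \<in> wo.AboveS {i}" using kF by (auto simp: AboveS_def)
    then have "(wo.suc {i}, k) \<in> r" by (rule wo.suc_least_AboveS)
    then show False using k wo.ANTISYM by (auto simp: underS_def antisym_def)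
  qed
qed

lemma underS_trans:
  assumes "Well_order r" "(i, j) \<in> r" "k \<in> underS r i" shows "k \<in> underS r j"
proof -
  interpret wo: wo_rel r by (rule wo_rel.intro[OF assms(1)])
  show ?thesis using assms(2,3) wo.TRANS wo.ANTISYM unfolding underS_def trans_def antisym_def by blast
qed

lemma filtration_induct [consumes 3, case_names zero succ limit]:
  assumes wo: "Well_order r" and "\<mu> \<in> Field r" and i: "i \<in> under r \<mu>"
    and zero: "P (wo_rel.minim r (Field r))"
    and succ: "\<And>j. j \<in> underS r \<mu> \<Longrightarrow> P j \<Longrightarrow> P (wo_rel.suc r {j})"
    and limit: "\<And>j. j \<in> under r \<mu> \<Longrightarrow> limit_ord r j \<Longrightarrow> (\<And>k. k \<in> underS r j \<Longrightarrow> P k) \<Longrightarrow> P j"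
  shows "P i"
proof -
  interpret wo: wo_rel r by (rule wo_rel.intro[OF wo])
  have "i \<in> under r \<mu> \<longrightarrow> P i"
  proof (rule wo.well_order_induct)
    fix x assume IH: "\<forall>y. y \<noteq> x \<and> (y, x) \<in> r \<longrightarrow> y \<in> under r \<mu> \<longrightarrow> P y"
    show "x \<in> under r \<mu> \<longrightarrow> P x"
    proof
      assume x: "x \<in> under r \<mu>"
      then have xr: "(x, \<mu>) \<in> r" "x \<in> Field r" by (auto simp: under_def Field_def)
      have below: "P k" if "k \<in> underS r x" for k
        using underS_trans[OF wo xr(1) that] that IH by (auto simp: underS_def under_def)
      from wo xr(2) show "P x"
      proof (cases rule: ordinal_cases)
        case z: zero
        then show ?thesis using zero by simp
      next
        case s: (succ j)
        then show ?thesis using succ[OF underS_trans[OF wo xr(1) s(1)] below[OF s(1)]] by simp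
      next
        case l: limit
        then show ?thesis using limit[OF x l below] by blast
      qed
    qed
  qed
  then show ?thesis using i by blast
qed

lemma filtrationD:
  assumes "filtration R M r \<mu> F"
  shows "Well_order r" "\<mu> \<in> Field r" "i \<in> under r \<mu> \<Longrightarrow> submodule (F i) R M"
    "(i, j) \<in> r \<Longrightarrow> (j, \<mu>) \<in> r \<Longrightarrow> F i \<subseteq> F j"
    "F (wo_rel.minim r (Field r)) = {\<zero>\<^bsub>M\<^esub>}" "F \<mu> = carrier M"
    "i \<in> under r \<mu> \<Longrightarrow> limit_ord r i \<Longrightarrow> F i = (\<Union>j\<in>underS r i. F j)"
  using assms unfolding filtration_def under_def by blast+

text \<open>Indices may repeat a term. A set of terms is therefore studied through its indices
  \<open>J\<close>: their least element gives the intersection, their supremum the union.\<close>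

lemma wchain_filtration:
  assumes fil: "filtration R M r \<mu> F"
  shows "wchain (F ` under r \<mu>)"
    and "covers (F ` under r \<mu>) C D \<Longrightarrow> \<exists>i\<in>underS r \<mu>. C = F i \<and> D = F (wo_rel.suc r {i})"
proof -
  note fD = filtrationD[OF fil]
  note wo = fD(1)
  interpret wo: wo_rel r by (rule wo_rel.intro[OF wo])
  have uF: "under r \<mu> \<subseteq> Field r" by (auto simp: under_def Field_def)
  have le: "(i, j) \<in> r \<or> (j, i) \<in> r" if "i \<in> under r \<mu>" "j \<in> under r \<mu>" for i j
    using wo.TOTALS uF that by blast
  have lt: "i \<in> underS r j" if "i \<in> under r \<mu>" "j \<in> under r \<mu>" "(j, i) \<notin> r" for i j
    using le[OF that(1,2)] that(1,3) wo.REFL uF by (auto simp: underS_def refl_on_def)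
  have mono: "F i \<subseteq> F j" if "(i, j) \<in> r" "j \<in> under r \<mu>" for i j
    using fD(4) that by (auto simp: under_def)
  show "wchain (F ` under r \<mu>)" unfolding wchain_def
  proof (intro allI impI)
    fix S assume "S \<subseteq> F ` under r \<mu>" "S \<noteq> {}"
    then obtain J where J: "J \<subseteq> under r \<mu>" "S = F ` J" "J \<noteq> {}" by (metis image_empty subset_imageE)
    then have JF: "J \<subseteq> Field r" using uF by blast
    have m: "wo.minim J \<in> J" "\<And>j. j \<in> J \<Longrightarrow> (wo.minim J, j) \<in> r"
      using wo.minim_in[OF JF J(3)] wo.minim_least[OF JF] by auto
    have "F (wo.minim J) \<subseteq> F j" if "j \<in> J" for j using mono[OF m(2)] that J(1) by blast
    then have "\<Inter>S = F (wo.minim J)" using m(1) unfolding J(2) by blast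
    then have 1: "\<Inter>S \<in> S" using m(1) J(2) by simp
    let ?U = "{i \<in> under r \<mu>. \<forall>j\<in>J. (j, i) \<in> r}"
    have U: "?U \<subseteq> Field r" using uF by blast
    have "(\<mu>, \<mu>) \<in> r" using wo.REFL fD(2) by (auto simp: refl_on_def)
    then have "\<mu> \<in> ?U" using J(1) by (auto simp: under_def)
    then have ne: "?U \<noteq> {}" by blast
    \<comment> \<open>The supremum of \<open>J\<close>. If it is not attained, it can only be a
      limit, with \<open>J\<close> cofinal below it, and continuity of \<open>F\<close> gives the
      union.\<close>
    define s where "s = wo.minim ?U"
    have s: "s \<in> under r \<mu>" "\<And>j. j \<in> J \<Longrightarrow> (j, s) \<in> r"
      using wo.minim_in[OF U ne] unfolding s_def by blast+
    have least: "(s, i) \<in> r" if "i \<in> under r \<mu>" "\<And>j. j \<in> J \<Longrightarrow> (j, i) \<in> r" for i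
      unfolding s_def using wo.minim_least[OF U] that by blast
    have "\<Union>S = F s"
    proof (cases "s \<in> J")
      case True
      then show ?thesis using s mono J(2) by blast
    next
      case False
      have Js: "j \<in> underS r s" if "j \<in> J" for j using s(2)[OF that] that False by (auto simp: underS_def)
      have cof: "\<exists>j\<in>J. (k, j) \<in> r" if k: "k \<in> underS r s" for k
      proof (rule ccontr)
        assume n: "\<not> (\<exists>j\<in>J. (k, j) \<in> r)"
        have k\<mu>: "k \<in> under r \<mu>"
          using underS_trans[OF wo _ k] s(1) by (auto simp: under_def underS_def)
        then have "(j, k) \<in> r" if "j \<in> J" for j using le n that J(1) by blast
        then have "(s, k) \<in> r" using least[OF k\<mu>] by blast
        then show False using k wo.ANTISYM by (auto simp: underS_def antisym_def)
      qed
      have "s \<in> Field r" using s(1) uF by blast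
      from wo this have "F s = (\<Union>j\<in>underS r s. F j)"
      proof (cases rule: ordinal_cases)
        case zero
        obtain j where "j \<in> J" using J(3) by blast
        then have "j \<in> underS r s" "(s, j) \<in> r"
          using Js wo.minim_least[OF subset_refl] JF zero by auto
        then show ?thesis using wo.ANTISYM by (auto simp: underS_def antisym_def)
      next
        case (succ i)
        then obtain j where j: "j \<in> J" "(i, j) \<in> r" using cof by blast
        then have "(j, i) \<in> r" using suc_ordinal(3)[OF wo succ(1)] Js succ(2) by simp
        then have "j = i" using j(2) wo.ANTISYM by (auto simp: antisym_def)
        have "(j', i) \<in> r" if "j' \<in> J" for j' using suc_ordinal(3)[OF wo succ(1)] Js[OF that] succ(2) by simp
        then have "(s, i) \<in> r" using least J(1) j(1) \<open>j = i\<close> by blast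
        then show ?thesis using succ(1) wo.ANTISYM by (auto simp: underS_def antisym_def)
      next
        case limit
        then show ?thesis using fD(7)[OF s(1)] by blast
      qed
      moreover have "\<exists>j\<in>J. F k \<subseteq> F j" if k: "k \<in> underS r s" for k using cof[OF k] mono J(1) by blast
      ultimately show ?thesis using Js unfolding J(2) by blast
    qed
    then show "\<Inter>S \<in> S \<and> \<Union>S \<in> F ` under r \<mu>" using 1 s(1) by blast
  qed
  assume cov: "covers (F ` under r \<mu>) C D"
  have CD: "C \<subset> D" using cov by (simp add: covers_def)
  \<comment> \<open>The first index carrying the value \<open>D\<close>. It is neither zero nor a
    limit, since all earlier terms lie in \<open>C\<close>; so it is a successor, and its
    predecessor carries the value \<open>C\<close>.\<close>
  let ?J = "{j \<in> under r \<mu>. F j = D}"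
  have J: "?J \<subseteq> Field r" "?J \<noteq> {}" using uF cov by (auto simp: covers_def)
  define j where "j = wo.minim ?J"
  have "j \<in> ?J" unfolding j_def by (rule wo.minim_in[OF J])
  then have j: "j \<in> under r \<mu>" "F j = D" "(j, \<mu>) \<in> r" by (auto simp: under_def)
  have below: "F k \<subseteq> C" if k: "k \<in> underS r j" for k
  proof -
    have k\<mu>: "k \<in> under r \<mu>" using underS_trans[OF wo j(3) k] by (auto simp: under_def underS_def)
    have "F k \<noteq> D"
      using wo.minim_least[OF J(1), of k] k\<mu> k wo.ANTISYM by (auto simp: j_def underS_def antisym_def)
    moreover have "F k \<subseteq> D" using mono[of k j] k j by (auto simp: underS_def)
    ultimately have "\<not> C \<subset> F k" using cov k\<mu> by (auto simp: covers_def)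
    moreover obtain i where i: "i \<in> under r \<mu>" "C = F i" using cov by (auto simp: covers_def)
    then have "F k \<subseteq> C \<or> C \<subseteq> F k" using le[OF k\<mu> i(1)] mono k\<mu> by blast
    ultimately show ?thesis by blast
  qed
  obtain i where i: "i \<in> under r \<mu>" "C = F i" using cov by (auto simp: covers_def)
  have "(j, i) \<notin> r" using mono[of j i] i j(2) CD by auto
  then have ij: "i \<in> underS r j" by (rule lt[OF i(1) j(1)])
  have "j \<in> Field r" using j(1) uF by blast
  from wo this show "\<exists>i\<in>underS r \<mu>. C = F i \<and> D = F (wo_rel.suc r {i})"
  proof (cases rule: ordinal_cases)
    case zero
    then have "(j, i) \<in> r" using wo.minim_least[OF subset_refl] i(1) uF by auto
    then show ?thesis using \<open>(j, i) \<notin> r\<close> by blast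
  next
    case (succ k)
    have k\<mu>: "k \<in> underS r \<mu>" by (rule underS_trans[OF wo j(3) succ(1)])
    have "(i, k) \<in> r" using suc_ordinal(3)[OF wo succ(1)] ij succ(2) by simp
    then have "C \<subseteq> F k" using mono i(2) k\<mu> by (auto simp: underS_def under_def)
    then have "C = F k" using below[OF succ(1)] by blast
    then show ?thesis using k\<mu> j(2) succ(2) by blast
  next
    case limit
    then have "D = (\<Union>k\<in>underS r j. F k)" using fD(7)[OF j(1)] j(2) by simp
    then have "D \<subseteq> C" using below by blast
    then show ?thesis using CD by blast
  qed
qed

section \<open>Filt(\<X>) in terms of chains of submodules\<close>

lemma well_order_wchain:
  assumes w: "wchain \<C>" and r: "r = {(A, B). A \<in> \<C> \<and> B \<in> \<C> \<and> A \<subseteq> B}"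
  shows "Field r = \<C>" "Well_order r"
proof -
  show F: "Field r = \<C>" by (auto simp: r Field_def)
  have "wf (r - Id)" unfolding wf_eq_minimal
  proof (intro allI impI)
    fix Q :: "'a set set" and x assume x: "x \<in> Q"
    show "\<exists>z\<in>Q. \<forall>y. (y, z) \<in> r - Id \<longrightarrow> y \<notin> Q"
    \<comment> \<open>Sets outside the chain have no predecessors. Otherwise the intersection of the
      members in \<open>Q\<close> is the least one.\<close>
    proof (cases "Q \<inter> \<C> = {}")
      case True
      then show ?thesis using x by (auto simp: r)
    next
      case False
      then have "\<Inter>(Q \<inter> \<C>) \<in> Q \<inter> \<C>" by (intro wchainD(1)[OF w]) auto
      then show ?thesis by (intro bexI[of _ "\<Inter>(Q \<inter> \<C>)"]) (auto simp: r)
    qed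
  qed
  moreover have "Linear_order r" unfolding F
    using wchain_linear[OF w]
    by (auto simp: r order_on_defs refl_on_def trans_def antisym_def total_on_def)
  ultimately show "Well_order r" by (simp add: well_order_on_def)
qed

context semibrick_module
begin

lemma brick_ext_iff:
  assumes "submodule C R N" "submodule D R N" "C \<subseteq> D"
  shows "brick_ext R \<X> N C D \<longleftrightarrow> (\<exists>X\<in>\<X>. lmod_iso R (lmod_quot (N\<lparr>carrier := D\<rparr>) C) X)"
  using lmoduleX assms by (rule brick_ext_iff_quot)

text \<open>One direction takes the set of terms. In the other the chain indexes itself: inclusion
  is the well-order, the filtration is the identity, and its index type is the one demanded by
  \<open>Filt\<close>.\<close>

lemma Filt_iff: "N \<in> Filt R \<X> \<longleftrightarrow> cofiltered R \<X> N {\<zero>\<^bsub>N\<^esub>}"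
proof
  assume "N \<in> Filt R \<X>"
  then obtain r :: "'n set rel" and \<mu> F where X: "X_filtration R \<X> N r \<mu> F" by (auto simp: Filt_def)
  then have fil: "filtration R N r \<mu> F" by (simp add: X_filtration_def)
  note fD = filtrationD[OF fil]
  interpret wo: wo_rel r by (rule wo_rel.intro[OF fD(1)])
  have z: "(wo.minim (Field r), \<mu>) \<in> r" by (rule wo.minim_least[OF subset_refl fD(2)])
  have \<mu>: "\<mu> \<in> under r \<mu>" using wo.REFL fD(2) by (auto simp: refl_on_def under_def)
  have "brick_ext R \<X> N C D" if cov: "covers (F ` under r \<mu>) C D" for C D
  proof -
    obtain i where i: "i \<in> underS r \<mu>" "C = F i" "D = F (wo.suc {i})"
      using wchain_filtration(2)[OF fil cov] by blast
    have CD: "submodule C R N" "submodule D R N" "C \<subseteq> D"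
      using cov fD(3) by (auto simp: covers_def)
    show ?thesis unfolding brick_ext_iff[OF CD]
      using X i unfolding X_filtration_def by blast
  qed
  moreover have "{\<zero>\<^bsub>N\<^esub>} \<in> F ` under r \<mu>" using fD(5) z by (auto simp: under_def image_iff)
  moreover have "carrier N \<in> F ` under r \<mu>" using fD(6) \<mu> by (auto simp: image_iff)
  ultimately have "brick_chain R \<X> N {\<zero>\<^bsub>N\<^esub>} (F ` under r \<mu>)"
    using wchain_filtration(1)[OF fil] fD(3) submoduleD(2) unfolding brick_chain_def by blast
  then show "cofiltered R \<X> N {\<zero>\<^bsub>N\<^esub>}" by (auto simp: cofiltered_def)
next
  assume "cofiltered R \<X> N {\<zero>\<^bsub>N\<^esub>}"
  then obtain \<C> where ch: "brick_chain R \<X> N {\<zero>\<^bsub>N\<^esub>} \<C>" by (auto simp: cofiltered_def)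
  note w = brick_chainD(1)[OF ch] and sub = brick_chainD(2)[OF ch]
  define r where "r = {(A, B). A \<in> \<C> \<and> B \<in> \<C> \<and> A \<subseteq> B}"
  note F = well_order_wchain(1)[OF w r_def] and wo = well_order_wchain(2)[OF w r_def]
  interpret wo: wo_rel r by (rule wo_rel.intro[OF wo])
  have Above: "wo.AboveS {A} = {B \<in> \<C>. A \<subset> B}" if "A \<in> \<C>" for A
    using that F by (auto simp: AboveS_def r_def)
  have lt: "underS r A = {B \<in> \<C>. B \<subset> A}" if "A \<in> \<C>" for A
    using that by (auto simp: underS_def r_def)
  have suc: "wo.suc {A} = B" if "covers \<C> A B" for A B
  proof (rule wo.equals_suc_AboveS[symmetric])
    have c: "A \<in> \<C>" "B \<in> \<C>" "A \<subset> B" "\<And>E. E \<in> \<C> \<Longrightarrow> A \<subset> E \<Longrightarrow> B \<subseteq> E"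
      using that unfolding covers_def by blast+
    show "{A} \<subseteq> Field r" using c F by simp
    show "B \<in> wo.AboveS {A}" using c by (simp add: Above)
    show "(B, E) \<in> r" if "E \<in> wo.AboveS {A}" for E
      using that c unfolding Above[OF c(1)] by (simp add: r_def)
  qed
  have "{\<zero>\<^bsub>N\<^esub>} = wo.minim (Field r)"
  proof (rule wo.equals_minim)
    show "Field r \<subseteq> Field r" "{\<zero>\<^bsub>N\<^esub>} \<in> Field r" using brick_chainD(4)[OF ch] F by auto
    show "({\<zero>\<^bsub>N\<^esub>}, B) \<in> r" if "B \<in> Field r" for B
      using brick_chainD(3,4)[OF ch] that F by (simp add: r_def)
  qed
  moreover have "A = (\<Union>B\<in>underS r A. B)" if A: "A \<in> \<C>" and lim: "limit_ord r A" for A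
  proof -
    from w A show ?thesis
    proof (cases rule: wchain_cases)
      case bot
      then have "underS r A = {}" using lt[OF A] by blast
      then show ?thesis using lim by (simp add: limit_ord_def)
    next
      case (succ D)
      then have "D \<in> underS r A" using lt[OF A] by (simp add: covers_def)
      then show ?thesis using lim suc[OF succ] by (auto simp: limit_ord_def)
    next
      case (lim S)
      then show ?thesis using lt[OF A] by blast
    qed
  qed
  moreover have under: "under r (carrier N) = \<C>"
    using sub submoduleD(1) brick_chainD(5)[OF ch] by (auto simp: under_def r_def)
  ultimately have fil: "filtration R N r (carrier N) (\<lambda>A. A)"
    unfolding filtration_def using wo F brick_chainD(5)[OF ch] sub
    by (auto simp: under_def r_def)
  have "\<exists>X\<in>\<X>. lmod_iso R (lmod_quot (N\<lparr>carrier := wo.suc {A}\<rparr>) A) X"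
    if A: "A \<in> underS r (carrier N)" for A
  proof -
    have AC: "A \<in> \<C>" "A \<subset> carrier N" using A lt[OF brick_chainD(5)[OF ch]] by auto
    \<comment> \<open>The least member properly above \<open>A\<close> covers \<open>A\<close>, so
      it is the successor of \<open>A\<close> in the order \<open>r\<close>.\<close>
    let ?T = "{B \<in> \<C>. A \<subset> B}"
    have "\<Inter>?T \<in> ?T" using AC brick_chainD(5)[OF ch] by (intro wchainD(1)[OF w]) auto
    then have cov: "covers \<C> A (\<Inter>?T)" using AC by (auto simp: covers_def)
    have D: "\<Inter>?T \<in> \<C>" "A \<subseteq> \<Inter>?T" using cov unfolding covers_def by blast+
    show ?thesis
      using brick_chainD(6)[OF ch cov] brick_ext_iff[OF sub[OF AC(1)] sub[OF D(1)] D(2)]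
      unfolding suc[OF cov] by blast
  qed
  then have "X_filtration R \<X> N r (carrier N) (\<lambda>A. A)" using fil by (simp add: X_filtration_def)
  then show "N \<in> Filt R \<X>" using left_module_axioms by (auto simp: Filt_def)
qed

section \<open>Admissible submodules and submodules in Filt(\<X>)\<close>

lemma Filt_submodule_admissible:
  assumes A: "submodule A R N" and F: "N\<lparr>carrier := A\<rparr> \<in> Filt R \<X>" shows "admissible R \<X> N A"
proof -
  let ?P = "N\<lparr>carrier := A\<rparr>"
  interpret P: semibrick_module R ?P \<X>
    using lmodule_submodule[OF A] semibrick by (simp add: semibrick_module_def semibrick_module_axioms_def)
  have "(\<lambda>x. x) \<in> lmod_hom R ?P N" using submoduleD(1)[OF A] by (auto simp: lmod_hom_def)
  from admissible_image[OF P.lmodule_axioms _ this] show ?thesis using F P.Filt_iff by simp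
qed

text \<open>A filtration of \<open>N\<close> is compatible with \<open>K\<close>, so its
  intersection with \<open>K\<close> filters \<open>K\<close>.\<close>

lemma admissible_imp_Filt:
  assumes N: "N \<in> Filt R \<X>" and K: "admissible R \<X> N K" shows "N\<lparr>carrier := K\<rparr> \<in> Filt R \<X>"
proof -
  note sK = admissible_submodule[OF K]
  interpret P: semibrick_module R "N\<lparr>carrier := K\<rparr>" \<X>
    using lmodule_submodule[OF sK] semibrick by (simp add: semibrick_module_def semibrick_module_axioms_def)
  obtain \<C> where ch: "brick_chain R \<X> N {\<zero>\<^bsub>N\<^esub>} \<C>" using N Filt_iff by (auto simp: cofiltered_def)
  have "cofiltered R \<X> (N\<lparr>carrier := K\<rparr>) (K \<inter> {\<zero>\<^bsub>N\<^esub>})"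
    by (rule cofiltered_Int_compatible[OF ch sK admissible_compatible[OF ch K]])
  moreover have "K \<inter> {\<zero>\<^bsub>N\<^esub>} = {\<zero>\<^bsub>N\<^esub>}" using submoduleD(2)[OF sK] by auto
  ultimately show ?thesis using P.Filt_iff by simp
qed

text \<open>\<open>A \<inter> B\<close> is not known to be admissible in \<open>A\<close>, so its
  compatibility with a filtration of \<open>A\<close> is derived from the dichotomy for
  \<open>B\<close> in the ambient \<open>N\<close>.\<close>

lemma Filt_Int:
  assumes N: "N \<in> Filt R \<X>" and A: "admissible R \<X> N A" and B: "admissible R \<X> N B"
  shows "N\<lparr>carrier := A \<inter> B\<rparr> \<in> Filt R \<X>"
proof -
  note sA = admissible_submodule[OF A] and sB = admissible_submodule[OF B]
  note Ac = submoduleD(1)[OF sA] and Bc = submoduleD(1)[OF sB]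
  have N0: "cofiltered R \<X> N {\<zero>\<^bsub>N\<^esub>}" using N Filt_iff by simp
  let ?P = "N\<lparr>carrier := A\<rparr>"
  interpret P: semibrick_module R ?P \<X>
    using lmodule_submodule[OF sA] semibrick by (simp add: semibrick_module_def semibrick_module_axioms_def)
  have sAB: "submodule (A \<inter> B) R ?P"
    using submodule_of_submodule[OF sA] submodule_Int[OF sA sB] by auto
  obtain \<C> where ch: "brick_chain R \<X> ?P {\<zero>\<^bsub>N\<^esub>} \<C>"
    using admissible_imp_Filt[OF N A] P.Filt_iff by (auto simp: cofiltered_def)
  note w = brick_chainD(1)[OF ch]
  have sub: "submodule C R N" "C \<subseteq> A" if "C \<in> \<C>" for C
    using brick_chainD(2)[OF ch that] submodule_of_submodule[OF sA] by auto
  have extN: "brick_ext R \<X> N C D" if cov: "covers \<C> C D" for C D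
  proof -
    have h: "hom_mod R X ?P C \<subseteq> hom_mod R X N C" for X :: "('r, 'x) module"
      using Ac unfolding hom_mod_def by (auto simp: cong_mod_carrier_update[OF Ac])
    obtain X u where "X \<in> \<X>" "u \<in> hom_mod R X ?P C" "\<forall>x\<in>carrier X. u x \<in> C \<longrightarrow> x = \<zero>\<^bsub>X\<^esub>"
      "D = C <+>\<^bsub>?P\<^esub> u ` carrier X"
      using brick_chainD(6)[OF ch cov] unfolding brick_ext_def by blast
    moreover have "C <+>\<^bsub>?P\<^esub> u ` carrier X = C <+>\<^bsub>N\<^esub> u ` carrier X" by (simp add: set_add_def')
    ultimately show ?thesis using h unfolding brick_ext_def by blast
  qed
  \<comment> \<open>The terms of a filtration of \<open>A\<close> are built from zero by brick
    extensions and unions, so they are admissible in \<open>N\<close>. This makes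
    \<open>C + B\<close> cofiltered below.\<close>
  have adm: "admissible R \<X> N C" if "C \<in> \<C>" for C
    using w that
  proof (induction rule: wchain_induct)
    case bot
    then show ?case using admissible_zero by (simp add: brick_chainD(7)[OF ch])
  next
    case (succ C D)
    then show ?case
      using extN[OF succ(1)] admissible_hom_mod[OF succ(2)] unfolding brick_ext_def by blast
  next
    case (lim S)
    then show ?case using wchain_linear[OF w] by (intro admissible_Union) blast+
  qed
  have "(A \<inter> B) \<inter> D \<subseteq> C \<or> D \<subseteq> C <+>\<^bsub>?P\<^esub> (A \<inter> B)" if cov: "covers \<C> C D" for C D
  proof -
    have CD: "C \<in> \<C>" "D \<in> \<C>" "C \<subset> D" using cov by (auto simp: covers_def)
    note sC = sub(1)[OF CD(1)] and sD = sub(1)[OF CD(2)]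
    have "C <+>\<^bsub>N\<^esub> B = ({\<zero>\<^bsub>N\<^esub>} <+>\<^bsub>N\<^esub> C) <+>\<^bsub>N\<^esub> B" using zero_set_add submoduleD(1)[OF sC] by simp
    then have "cofiltered R \<X> N (C <+>\<^bsub>N\<^esub> B)"
      using admissibleD[OF B admissibleD[OF adm[OF CD(1)] N0]] by simp
    from brick_ext_dichotomy[OF extN[OF cov] sC sB this]
    show ?thesis
    proof
      \<comment> \<open>Modular law: a representative in \<open>B\<close> of an element of
        \<open>D\<close> modulo \<open>C\<close> lies in \<open>D\<close> again, hence in
        \<open>A\<close>.\<close>
      assume DB: "D \<subseteq> C <+>\<^bsub>N\<^esub> B"
      have "D \<subseteq> C <+>\<^bsub>N\<^esub> (A \<inter> B)"
      proof
        fix y assume y: "y \<in> D"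
        then obtain b where b: "b \<in> B" "cong_mod N C y b" using DB mem_set_add_iff[OF sC Bc] by blast
        then have "b \<in> D" using cong_mod_mem'[OF sC sD] y CD(3) by blast
        then have "b \<in> A \<inter> B" using b(1) sub(2)[OF CD(2)] by blast
        moreover have "A \<inter> B \<subseteq> carrier N" using Ac by blast
        ultimately show "y \<in> C <+>\<^bsub>N\<^esub> (A \<inter> B)" using mem_set_add_iff[OF sC] b(2) by blast
      qed
      then show ?thesis by (simp add: set_add_def')
    qed blast
  qed
  then have "P.compatible \<C> (A \<inter> B)" by (auto simp: P.compatible_def)
  from P.cofiltered_Int_compatible[OF ch sAB this]
  have cof: "cofiltered R \<X> (N\<lparr>carrier := A \<inter> B\<rparr>) ((A \<inter> B) \<inter> {\<zero>\<^bsub>N\<^esub>})" by simp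
  interpret Q: semibrick_module R "N\<lparr>carrier := A \<inter> B\<rparr>" \<X>
    using lmodule_submodule[OF submodule_Int[OF sA sB]] semibrick
    by (simp add: semibrick_module_def semibrick_module_axioms_def)
  have "(A \<inter> B) \<inter> {\<zero>\<^bsub>N\<^esub>} = {\<zero>\<^bsub>N\<^esub>}" using submoduleD(2)[OF sA] submoduleD(2)[OF sB] by auto
  then show ?thesis using cof Q.Filt_iff by simp
qed

section \<open>Successor steps and continuation by constant terms\<close>

lemma socle_filtration_suc:
  assumes soc: "socle_filtration R \<X> N r \<nu> V" and i: "i \<in> underS r \<nu>"
  shows "V (wo_rel.suc r {i}) = socle_hull R \<X> N (V i)"
proof -
  have "submodule (V i) R N"
    using soc i filtrationD(3)[of R N r \<nu> V i] by (auto simp: socle_filtration_def underS_def under_def)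
  from X_socle_vimage[OF lmoduleX this] show ?thesis
    using soc i unfolding socle_filtration_def by simp
qed

end

text \<open>The lengths \<open>\<mu>\<close> and \<open>\<nu>\<close> are unrelated, so the
  filtration of \<open>N\<close> is extended to the whole well-order; then no case distinction on
  the lengths is needed later.\<close>

lemma continued_filtration:
  assumes fil: "filtration R N r \<nu> V"
  shows "submodule (carrier N) R N \<Longrightarrow> submodule (continued r \<nu> V i) R N"
    and "(i, j) \<in> r \<Longrightarrow> continued r \<nu> V i \<subseteq> continued r \<nu> V j"
    and "continued r \<nu> V (wo_rel.minim r (Field r)) = {\<zero>\<^bsub>N\<^esub>}"
    and "limit_ord r i \<Longrightarrow> continued r \<nu> V i = (\<Union>j\<in>underS r i. continued r \<nu> V j)"
    and "i \<in> Field r \<Longrightarrow> i \<notin> underS r \<nu> \<Longrightarrow> continued r \<nu> V i = carrier N"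
    and "i \<in> underS r \<nu> \<Longrightarrow> continued r \<nu> V i = V i"
    and "i \<in> underS r \<nu> \<Longrightarrow> continued r \<nu> V (wo_rel.suc r {i}) = V (wo_rel.suc r {i})"
proof -
  note fD = filtrationD[OF fil]
  note wo = fD(1)
  interpret wo: wo_rel r by (rule wo_rel.intro[OF wo])
  have top: "V j \<subseteq> carrier N" if "j \<in> under r \<nu>" for j
    using fD(4)[of j \<nu>] fD(2,6) that wo.REFL by (auto simp: under_def refl_on_def)
  have sub: "continued r \<nu> V j \<subseteq> carrier N" for j
    using top fD(6) by (auto simp: continued_def)
  show "submodule (carrier N) R N \<Longrightarrow> submodule (continued r \<nu> V i) R N"
    using fD(3,6) by (simp add: continued_def)
  show "(i, j) \<in> r \<Longrightarrow> continued r \<nu> V i \<subseteq> continued r \<nu> V j"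
  proof (cases "j \<in> under r \<nu>")
    case True
    assume ij: "(i, j) \<in> r"
    then have "i \<in> under r \<nu>" using True wo.TRANS unfolding under_def trans_def by blast
    then show ?thesis using True ij fD(4) by (auto simp: continued_def under_def)
  next
    case False
    then show ?thesis using sub fD(6) by (simp add: continued_def)
  qed
  show "continued r \<nu> V (wo.minim (Field r)) = {\<zero>\<^bsub>N\<^esub>}"
    using wo.minim_least[OF subset_refl fD(2)] fD(5) by (simp add: continued_def under_def)
  show eq: "i \<in> Field r \<Longrightarrow> i \<notin> underS r \<nu> \<Longrightarrow> continued r \<nu> V i = carrier N" for i
    using fD(6) by (auto simp: continued_def underS_def under_def)
  show "i \<in> underS r \<nu> \<Longrightarrow> continued r \<nu> V i = V i"
    by (auto simp: continued_def underS_def under_def)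
  show "i \<in> underS r \<nu> \<Longrightarrow> continued r \<nu> V (wo.suc {i}) = V (wo.suc {i})"
    using suc_ordinal(2)[OF wo] by (auto simp: continued_def under_def)
  show "limit_ord r i \<Longrightarrow> continued r \<nu> V i = (\<Union>j\<in>underS r i. continued r \<nu> V j)"
  proof (cases "i \<in> under r \<nu>")
    case True
    assume lim: "limit_ord r i"
    have "j \<in> under r \<nu>" if "j \<in> underS r i" for j
      using underS_trans[OF wo _ that] True by (auto simp: under_def underS_def)
    then show ?thesis using True fD(7)[OF True lim] by (simp add: continued_def)
  next
    case False
    assume lim: "limit_ord r i"
    then have "i \<in> Field r" by (simp add: limit_ord_def)
    \<comment> \<open>A limit beyond \<open>\<nu>\<close> has \<open>\<nu>\<close> strictly below
      it, so the union already contains the constant value.\<close>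
    then have "\<nu> \<in> underS r i" using False wo.TOTALS fD(2) wo.REFL by (auto simp: under_def underS_def refl_on_def)
    moreover have "continued r \<nu> V \<nu> = carrier N" using eq[OF fD(2)] by (simp add: underS_def)
    ultimately have "carrier N \<subseteq> (\<Union>j\<in>underS r i. continued r \<nu> V j)" by blast
    moreover have "(\<Union>j\<in>underS r i. continued r \<nu> V j) \<subseteq> carrier N" using sub by blast
    moreover have "continued r \<nu> V i = carrier N" using False fD(6) by (simp add: continued_def)
    ultimately show ?thesis by simp
  qed
qed

section \<open>Socle filtrations\<close>

context semibrick_module
begin

text \<open>The preimage under \<open>f\<close> of the hull of \<open>B\<close> is a submodule that
  contains \<open>A\<close> and every image of a brick modulo \<open>A\<close>.\<close>

lemma socle_hull_hom:
  assumes M: "lmodule R M" and f: "f \<in> lmod_hom R M N"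
    and A: "submodule A R M" and B: "submodule B R N" and AB: "f ` A \<subseteq> B"
  shows "f ` socle_hull R \<X> M A \<subseteq> socle_hull R \<X> N B"
proof -
  interpret M': semibrick_module R M \<X>
    using M semibrick by (simp add: semibrick_module_def semibrick_module_axioms_def)
  let ?S = "socle_hull R \<X> N B" and ?V = "{x \<in> carrier M. f x \<in> socle_hull R \<X> N B}"
  note S = submoduleD[OF socle_hull_submodule[OF B]]
  have fh: "f (x \<oplus>\<^bsub>M\<^esub> y) = f x \<oplus>\<^bsub>N\<^esub> f y" if "x \<in> carrier M" "y \<in> carrier M" for x y
    using f that by (simp add: lmod_hom_def)
  have fs: "f (a \<odot>\<^bsub>M\<^esub> x) = a \<odot>\<^bsub>N\<^esub> f x" if "a \<in> carrier R" "x \<in> carrier M" for a x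
    using f that by (simp add: lmod_hom_def)
  have "socle_hull R \<X> M A \<subseteq> ?V"
  proof (rule M'.socle_hull_least)
    show "submodule ?V R M" unfolding M'.submodule_iff
      using S(2-4) lmod_hom_zero[OF M lmodule_axioms f] by (auto simp: fh fs)
    show "A \<subseteq> ?V" using AB M'.submoduleD(1)[OF A] socle_hull_upper[of B] by blast
    show "u ` carrier X \<subseteq> ?V" if X: "X \<in> \<X>" and u: "u \<in> hom_mod R X M A" for X u
    proof -
      have "(f \<circ> u) ` carrier X \<subseteq> ?S"
        by (rule socle_hull_image[OF X hom_mod_comp[OF A M B u f AB]])
      then show ?thesis using hom_modD(1)[OF u] by auto
    qed
  qed
  then show ?thesis by blast
qed

text \<open>Beyond \<open>\<nu>\<close> both sides are all of \<open>N\<close>, as the hull of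
  \<open>N\<close> is \<open>N\<close>.\<close>

lemma continued_suc:
  assumes soc: "socle_filtration R \<X> N r \<nu> V" and j: "j \<in> underS r \<mu>"
  shows "continued r \<nu> V (wo_rel.suc r {j}) = socle_hull R \<X> N (continued r \<nu> V j)"
proof (cases "j \<in> underS r \<nu>")
  case True
  have fil: "filtration R N r \<nu> V" using soc by (simp add: socle_filtration_def)
  show ?thesis
    using socle_filtration_suc[OF soc True] continued_filtration(6,7)[OF fil True] by simp
next
  case False
  have fil: "filtration R N r \<nu> V" using soc by (simp add: socle_filtration_def)
  note wo = filtrationD(1)[OF fil]
  have "j \<in> Field r" using j by (auto simp: underS_def Field_def)
  then have Vj: "continued r \<nu> V j = carrier N" using continued_filtration(5)[OF fil] False by blast
  have "(j, wo_rel.suc r {j}) \<in> r" using suc_ordinal(1)[OF wo j] by (simp add: underS_def)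
  from continued_filtration(2)[OF fil this]
  have "continued r \<nu> V (wo_rel.suc r {j}) = carrier N"
    using submoduleD(1)[OF continued_filtration(1)[OF fil submodule_carrier]] Vj by blast
  moreover have "socle_hull R \<X> N (carrier N) = carrier N"
    using socle_hull_upper[of "carrier N"] submoduleD(1)[OF socle_hull_submodule[OF submodule_carrier]] by blast
  ultimately show ?thesis using Vj by simp
qed

lemma admissible_continued:
  assumes soc: "socle_filtration R \<X> N r \<nu> V" and \<mu>: "\<mu> \<in> Field r" and i: "i \<in> under r \<mu>"
  shows "admissible R \<X> N (continued r \<nu> V i)"
proof -
  have fil: "filtration R N r \<nu> V" using soc by (simp add: socle_filtration_def)
  interpret wo: wo_rel r by (rule wo_rel.intro[OF filtrationD(1)[OF fil]])
  note c = continued_filtration[OF fil]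
  from filtrationD(1)[OF fil] \<mu> i show ?thesis
  proof (induction rule: filtration_induct)
    case zero
    show ?case using admissible_zero by (simp add: c(3))
  next
    case (succ j)
    show ?case unfolding continued_suc[OF soc succ(1)] by (rule admissible_socle_hull[OF succ(2)])
  next
    case (limit j)
    have "admissible R \<X> N (\<Union>(continued r \<nu> V ` underS r j))"
    proof (rule admissible_Union)
      show "continued r \<nu> V ` underS r j \<noteq> {}" using limit(2) by (simp add: limit_ord_def)
      show "admissible R \<X> N K" if "K \<in> continued r \<nu> V ` underS r j" for K using that limit(3) by blast
      fix K L assume "K \<in> continued r \<nu> V ` underS r j" "L \<in> continued r \<nu> V ` underS r j"
      then obtain k l where "K = continued r \<nu> V k" "L = continued r \<nu> V l" "k \<in> underS r j" "l \<in> underS r j"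
        by blast
      moreover from this have "k \<in> Field r" "l \<in> Field r" by (auto simp: underS_def Field_def)
      ultimately show "K \<subseteq> L \<or> L \<subseteq> K" using c(2) wo.TOTALS by blast
    qed
    then show ?case using c(4)[OF limit(2)] by simp
  qed
qed

text \<open>At \<open>i = \<mu>\<close> this bounds the length for the image of \<open>f\<close>:
  the image lies in the term of index \<open>\<mu>\<close> of the filtration of \<open>N\<close>,
  even if \<open>N\<close> itself is reached later.\<close>

lemma image_socle_filtration_subset:
  assumes M: "lmodule R M" and f: "f \<in> lmod_hom R M N"
    and socM: "socle_filtration R \<X> M r \<mu> U" and socN: "socle_filtration R \<X> N r \<nu> V"
    and i: "i \<in> under r \<mu>"
  shows "f ` U i \<subseteq> continued r \<nu> V i"
proof -
  interpret M': semibrick_module R M \<X>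
    using M semibrick by (simp add: semibrick_module_def semibrick_module_axioms_def)
  have filM: "filtration R M r \<mu> U" and filN: "filtration R N r \<nu> V"
    using socM socN by (simp_all add: socle_filtration_def)
  note c = continued_filtration[OF filN] and u = filtrationD[OF filM]
  from u(1,2) i show ?thesis
  proof (induction rule: filtration_induct)
    case zero
    show ?case using lmod_hom_zero[OF M lmodule_axioms f] by (simp add: c(3) u(5))
  next
    case (succ j)
    have "j \<in> under r \<mu>" using succ(1) by (auto simp: underS_def under_def)
    then show ?case
      unfolding continued_suc[OF socN succ(1)] M'.socle_filtration_suc[OF socM succ(1)]
      by (intro socle_hull_hom[OF M f u(3) c(1)[OF submodule_carrier] succ(2)])
  next
    case (limit j)
    then show ?case using c(4)[OF limit(2)] u(7)[OF limit(1,2)] by blast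
  qed
qed

text \<open>Successor steps are \<open>socle_hull_Int\<close>, and limits hold because intersection
  distributes over unions.\<close>

lemma socle_filtration_image:
  assumes N: "N \<in> Filt R \<X>" and M: "lmodule R M" and f: "f \<in> lmod_hom R M N"
    and I: "admissible R \<X> N (f ` carrier M)"
    and socM: "socle_filtration R \<X> M r \<mu> U" and socN: "socle_filtration R \<X> N r \<nu> V"
  shows "socle_filtration R \<X> (N\<lparr>carrier := f ` carrier M\<rparr>) r \<mu> (\<lambda>i. f ` carrier M \<inter> continued r \<nu> V i)"
proof -
  let ?I = "f ` carrier M"
  let ?P = "N\<lparr>carrier := ?I\<rparr>"
  note sI = admissible_submodule[OF I]
  interpret P: semibrick_module R ?P \<X>
    using lmodule_submodule[OF sI] semibrick by (simp add: semibrick_module_def semibrick_module_axioms_def)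
  have filM: "filtration R M r \<mu> U" and filN: "filtration R N r \<nu> V"
    using socM socN by (simp_all add: socle_filtration_def)
  note c = continued_filtration[OF filN] and u = filtrationD[OF filM]
  interpret wo: wo_rel r by (rule wo_rel.intro[OF u(1)])
  have "(\<mu>, \<mu>) \<in> r" using wo.REFL u(2) by (simp add: refl_on_def)
  then have \<mu>: "\<mu> \<in> under r \<mu>" by (simp add: under_def)
  have sub: "submodule (?I \<inter> continued r \<nu> V i) R ?P" for i
    using submodule_of_submodule[OF sI] submodule_Int[OF sI c(1)[OF submodule_carrier]] by blast
  have "filtration R ?P r \<mu> (\<lambda>i. ?I \<inter> continued r \<nu> V i)"
    unfolding filtration_def
  proof (intro conjI ballI impI)
    show "Well_order r" "\<mu> \<in> Field r" using u(1,2) by blast+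
    show "submodule (?I \<inter> continued r \<nu> V i) R ?P" for i by (rule sub)
    show "?I \<inter> continued r \<nu> V i \<subseteq> ?I \<inter> continued r \<nu> V j" if "i \<in> under r j" for i j
      using c(2)[of i j] that by (auto simp: under_def)
    show "?I \<inter> continued r \<nu> V (wo.minim (Field r)) = {\<zero>\<^bsub>?P\<^esub>}"
      using submoduleD(2)[OF sI] by (simp add: c(3))
    show "?I \<inter> continued r \<nu> V \<mu> = carrier ?P"
      using image_socle_filtration_subset[OF M f socM socN \<mu>] u(6) by auto
    show "?I \<inter> continued r \<nu> V i = (\<Union>j\<in>underS r i. ?I \<inter> continued r \<nu> V j)" if "limit_ord r i" for i
      using c(4)[OF that] by blast
  qed
  moreover have "?I \<inter> continued r \<nu> V (wo.suc {i}) =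
      {x \<in> carrier ?P. (?I \<inter> continued r \<nu> V i) +>\<^bsub>?P\<^esub> x \<in> X_socle R \<X> (lmod_quot ?P (?I \<inter> continued r \<nu> V i))}"
    if i: "i \<in> underS r \<mu>" for i
  proof -
    have "i \<in> under r \<mu>" using i by (auto simp: underS_def under_def)
    then have adm: "admissible R \<X> N (continued r \<nu> V i)" by (rule admissible_continued[OF socN u(2)])
    have N0: "cofiltered R \<X> N {\<zero>\<^bsub>N\<^esub>}" using N Filt_iff by blast
    have "{x \<in> carrier ?P. (?I \<inter> continued r \<nu> V i) +>\<^bsub>?P\<^esub> x \<in> X_socle R \<X> (lmod_quot ?P (?I \<inter> continued r \<nu> V i))}
        = socle_hull R \<X> ?P (?I \<inter> continued r \<nu> V i)"
      using lmoduleX sub by (rule P.X_socle_vimage)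
    also have "\<dots> = ?I \<inter> socle_hull R \<X> N (continued r \<nu> V i)" by (rule socle_hull_Int[OF N0 I adm])
    also have "\<dots> = ?I \<inter> continued r \<nu> V (wo.suc {i})" using continued_suc[OF socN i] by simp
    finally show ?thesis by simp
  qed
  ultimately show ?thesis unfolding socle_filtration_def by blast
qed

end

section \<open>Assembly of the three assertions\<close>

theorem proposition3p10:
  fixes R :: "('r, 's) ring_scheme"
    and \<X> :: "('r, 'x) module set"
    and M :: "('r, 'm) module" and N :: "('r, 'n) module"
    and r :: "'o rel" and \<mu> \<nu> :: 'o
    and MF :: "'o \<Rightarrow> 'm set" and NF :: "'o \<Rightarrow> 'n set"
    and f :: "'m \<Rightarrow> 'n"
  assumes "ring R" and "semibrick R \<X>"
    and "M \<in> Filt R \<X>" and "N \<in> Filt R \<X>"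
    and "Well_order r"
    and "socle_filtration R \<X> M r \<mu> MF" and "socle_filtration R \<X> N r \<nu> NF"
    and "f \<in> lmod_hom R M N"
  shows
    "(\<forall>A B. submodule A R N \<and> N\<lparr>carrier := A\<rparr> \<in> Filt R \<X> \<and>
            submodule B R N \<and> N\<lparr>carrier := B\<rparr> \<in> Filt R \<X> \<longrightarrow>
            N\<lparr>carrier := A <+>\<^bsub>N\<^esub> B\<rparr> \<in> Filt R \<X> \<and> N\<lparr>carrier := A \<inter> B\<rparr> \<in> Filt R \<X>)
     \<and> (N\<lparr>carrier := f ` carrier M\<rparr> \<in> Filt R \<X> \<and>
        socle_filtration R \<X> (N\<lparr>carrier := f ` carrier M\<rparr>) r \<mu>
          (\<lambda>i. f ` carrier M \<inter> continued r \<nu> NF i))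
     \<and> lmod_quot N (f ` carrier M) \<in> Filt R \<X>"
proof -
  have lN: "left_module R N" and lM: "left_module R M" using assms(3,4) by (simp_all add: Filt_def)
  interpret N: semibrick_module R N \<X>
    using lN assms(2) by (simp add: semibrick_module_def semibrick_module_axioms_def lmodule_def)
  interpret M: semibrick_module R M \<X>
    using lM assms(2) by (simp add: semibrick_module_def semibrick_module_axioms_def lmodule_def)
  let ?I = "f ` carrier M"
  have M0: "cofiltered R \<X> M {\<zero>\<^bsub>M\<^esub>}" and N0: "cofiltered R \<X> N {\<zero>\<^bsub>N\<^esub>}"
    using assms(3,4) M.Filt_iff N.Filt_iff by blast+
  have I: "admissible R \<X> N ?I" by (rule N.admissible_image[OF M.lmodule_axioms M0 assms(8)])
  note sI = N.admissible_submodule[OF I]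
  have quot: "lmod_quot N ?I \<in> Filt R \<X>"
  proof -
    interpret Q: semibrick_module R "lmod_quot N ?I" \<X>
      using N.lmodule_quot[OF sI] assms(2) by (simp add: semibrick_module_def semibrick_module_axioms_def)
    \<comment> \<open>Admissibility of the image is applied to the zero submodule, which is
      cofiltered because \<open>N\<close> lies in Filt(\<X>).\<close>
    have "cofiltered R \<X> N ?I"
      using N.admissibleD[OF I N0] N.zero_set_add[OF N.submoduleD(1)[OF sI]] by simp
    then show ?thesis unfolding Q.Filt_iff by (rule N.cofiltered_quot)
  qed
  have "N\<lparr>carrier := A <+>\<^bsub>N\<^esub> B\<rparr> \<in> Filt R \<X>" "N\<lparr>carrier := A \<inter> B\<rparr> \<in> Filt R \<X>"
    if "submodule A R N" "N\<lparr>carrier := A\<rparr> \<in> Filt R \<X>" "submodule B R N" "N\<lparr>carrier := B\<rparr> \<in> Filt R \<X>" for A B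
    using N.Filt_submodule_admissible[OF that(1,2)] N.Filt_submodule_admissible[OF that(3,4)]
      N.admissible_imp_Filt[OF assms(4) N.admissible_add] N.Filt_Int[OF assms(4)] by blast+
  then show ?thesis
    using N.admissible_imp_Filt[OF assms(4) I] quot
      N.socle_filtration_image[OF assms(4) M.lmodule_axioms assms(8) I assms(6,7)] by blast
qed

end
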